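(* Let $G$ be a $C^\infty$-rigid Carnot group. Then every $C^1$-contact map is smooth; that is, for every open set $U\subset G$ and every $C^1$-contact map $f:U\to G$, the map $f$ is of class $C^\infty$ on $U$.
   Context: A Carnot group $G$ is a connected, simply connected (real) Lie group whose Lie algebra has a stratification $\mathfrak g=\mathfrak g_{-1}\oplus\dots\oplus\mathfrak g_{-s}$ with $[\mathfrak g_{-1},\mathfrak g_{-i}]=\mathfrak g_{-i-1}$ for $i=1,\dots,s$, where $\mathfrak g_{-s-1}=\{0\}$. The horizontal bundle $\mathcal H\subset TG$ is the left-invariant subbundle whose fiber at $x$ is the left translate of $\mathfrak g_{-1}$ to $T_xG$. $C^k$-contact map ($k\in\{1,2,\dots\}\cup\{\infty\}$): for $U\subset G$ open, a $C^k$ local diffeomorphism $f:U\to G$ such that $d_xf(\mathcal H_x)\subset\mathcal H_{f(x)}$ for every $x\in U$. Contact field: a $C^1$ vector field $Z$ on an open subset $W$ of $G$ is a contact field if $[Z,X]$ is a section of $\mathcal H$ for every smooth section $X$ of $\mathcal H$ over an open subset of $W$ (equivalently, $[Z,X](x)\in\mathcal H_x$ for all $x \in W$ and all left-invariant $X\in\mathfrak g_{-1}$). This is the infinitesimal form of the condition that the local flow of $Z$ consists of contact maps. $C^k$-rigidity (Ottazzi–Warhurst): $G$ is called $C^k$-rigid if for every connected open $U\subset G$ the space $\mathrm{Con}^k(U)=\{f:U\to G : f \text{ is a } C^k\text{-contact map}\}$ is finite dimensional. Known facts of Ottazzi–Warhurst, which give the precise meaning of this condition used here: $C^\infty$-rigid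 groups are $C^2$-rigid, and $G$ is $C^2$-rigid if and only if for every $p\in G$ the real vector space of germs at $p$ of contact fields is finite dimensional. *)

theory Defs
  imports "HOL-Analysis.Analysis" "HOL-Library.Extended_Nat" "HOL-Algebra.Group"
begin

section \<open>Maps of class \<open>C\<^sup>k\<close> between open subsets of Euclidean spaces\<close>

fun Cn_on :: "nat \<Rightarrow> 'a::euclidean_space set \<Rightarrow> ('a \<Rightarrow> 'b::euclidean_space) \<Rightarrow> bool" where
  "Cn_on 0 S f \<longleftrightarrow> continuous_on S f"
| "Cn_on (Suc n) S f \<longleftrightarrow>
     (\<forall>x\<in>S. f differentiable (at x)) \<and>
     (\<forall>v. Cn_on n S (\<lambda>x. frechet_derivative f (at x) v))"

definition Ck_on :: "enat \<Rightarrow> 'a::euclidean_space set \<Rightarrow> ('a \<Rightarrow> 'b::euclidean_space) \<Rightarrow> bool" where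
  "Ck_on k S f \<longleftrightarrow> (\<forall>n. enat n \<le> k \<longrightarrow> Cn_on n S f)"


section \<open>Smooth manifolds\<close>

text \<open>
  A manifold is a whole type \<open>'a\<close> with an atlas of charts with values in a Euclidean
  space \<open>'e\<close>. Only the restriction of the second component of a chart to the first component
  is meaningful.
\<close>

type_synonym ('a, 'e) chart = "'a set \<times> ('a \<Rightarrow> 'e)"

abbreviation chart_dom :: "('a, 'e) chart \<Rightarrow> 'a set" where
  "chart_dom c \<equiv> fst c"

abbreviation chart_map :: "('a, 'e) chart \<Rightarrow> 'a \<Rightarrow> 'e" where
  "chart_map c \<equiv> snd c"

abbreviation chart_inv :: "('a, 'e) chart \<Rightarrow> 'e \<Rightarrow> 'a" where
  "chart_inv c \<equiv> inv_into (fst c) (snd c)"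

definition smooth_atlas ::
  "('a::topological_space, 'e::euclidean_space) chart set \<Rightarrow> bool" where
  "smooth_atlas A \<longleftrightarrow>
     (\<Union>c\<in>A. chart_dom c) = UNIV \<and>
     (\<forall>c\<in>A. open (chart_dom c) \<and> open (chart_map c ` chart_dom c) \<and>
        homeomorphism (chart_dom c) (chart_map c ` chart_dom c) (chart_map c) (chart_inv c)) \<and>
     (\<forall>c\<in>A. \<forall>d\<in>A.
        Ck_on \<infinity> (chart_map c ` (chart_dom c \<inter> chart_dom d)) (chart_map d \<circ> chart_inv c))"

definition prod_atlas ::
  "('a, 'e) chart set \<Rightarrow> ('b, 'd) chart set \<Rightarrow> ('a \<times> 'b, 'e \<times> 'd) chart set" where
  "prod_atlas A B =
     {(chart_dom c \<times> chart_dom d, map_prod (chart_map c) (chart_map d)) | c d. c \<in> A \<and> d \<in> B}"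

definition Ck_map ::
  "enat \<Rightarrow> ('a::topological_space, 'e::euclidean_space) chart set \<Rightarrow>
   ('b::topological_space, 'd::euclidean_space) chart set \<Rightarrow> 'a set \<Rightarrow> ('a \<Rightarrow> 'b) \<Rightarrow> bool" where
  "Ck_map k A B U f \<longleftrightarrow>
     continuous_on U f \<and>
     (\<forall>c\<in>A. \<forall>d\<in>B.
        Ck_on k (chart_map c ` {x \<in> U \<inter> chart_dom c. f x \<in> chart_dom d})
          (chart_map d \<circ> f \<circ> chart_inv c))"

definition Ck_local_diffeo ::
  "enat \<Rightarrow> ('a::topological_space, 'e::euclidean_space) chart set \<Rightarrow>
   ('b::topological_space, 'd::euclidean_space) chart set \<Rightarrow> 'a set \<Rightarrow> ('a \<Rightarrow> 'b) \<Rightarrow> bool" where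
  "Ck_local_diffeo k A B U f \<longleftrightarrow>
     (\<forall>x\<in>U. \<exists>V. open V \<and> x \<in> V \<and> V \<subseteq> U \<and> open (f ` V) \<and> inj_on f V \<and>
        Ck_map k A B V f \<and> Ck_map k B A (f ` V) (inv_into V f))"


section \<open>Tangent vectors and vector fields\<close>

text \<open>
  The tangent space at \<open>x\<close> is the model space \<open>'e\<close>, a tangent vector being represented by its
  coordinates in the chart \<open>chart_at A x\<close> chosen at \<open>x\<close>. Thus a vector field is a map
  \<open>'a \<Rightarrow> 'e\<close>; since the chosen chart varies with the point, this map need not be continuous,
  and regularity and brackets of vector fields are read off after changing coordinates to one
  common chart (\<open>field_in_chart\<close>).
\<close>

definition chart_at :: "('a, 'e) chart set \<Rightarrow> 'a \<Rightarrow> ('a, 'e) chart" where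
  "chart_at A x = (SOME c. c \<in> A \<and> x \<in> chart_dom c)"

definition tangent_map ::
  "('a, 'e::euclidean_space) chart set \<Rightarrow> ('b, 'd::euclidean_space) chart set \<Rightarrow>
   ('a \<Rightarrow> 'b) \<Rightarrow> 'a \<Rightarrow> 'e \<Rightarrow> 'd" where
  "tangent_map A B f x =
     frechet_derivative (chart_map (chart_at B (f x)) \<circ> f \<circ> chart_inv (chart_at A x))
       (at (chart_map (chart_at A x) x))"

definition field_in_chart ::
  "('a, 'e::euclidean_space) chart set \<Rightarrow> ('a, 'e) chart \<Rightarrow> ('a \<Rightarrow> 'e) \<Rightarrow> 'e \<Rightarrow> 'e" where
  "field_in_chart A c X y =
     (let x = chart_inv c y
      in frechet_derivative (chart_map c \<circ> chart_inv (chart_at A x))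
           (at (chart_map (chart_at A x) x)) (X x))"

definition Ck_field ::
  "enat \<Rightarrow> ('a, 'e::euclidean_space) chart set \<Rightarrow> 'a set \<Rightarrow> ('a \<Rightarrow> 'e) \<Rightarrow> bool" where
  "Ck_field k A W X \<longleftrightarrow>
     (\<forall>c\<in>A. Ck_on k (chart_map c ` (W \<inter> chart_dom c)) (field_in_chart A c X))"

text \<open>In coordinates, \<open>[X, Y] = DY(X) - DX(Y)\<close>.\<close>

definition field_bracket ::
  "('a, 'e::euclidean_space) chart set \<Rightarrow> ('a \<Rightarrow> 'e) \<Rightarrow> ('a \<Rightarrow> 'e) \<Rightarrow> 'a \<Rightarrow> 'e" where
  "field_bracket A X Y x =
     (let c = chart_at A x; p = chart_map c x;
          X' = field_in_chart A c X; Y' = field_in_chart A c Y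
      in frechet_derivative Y' (at p) (X' p) - frechet_derivative X' (at p) (Y' p))"


section \<open>Lie groups and Carnot groups\<close>

locale lie_group = group G
  for G :: "'a::{t2_space, second_countable_topology} monoid" (structure) +
  fixes A :: "('a, 'e::euclidean_space) chart set"
  assumes carrier_UNIV: "carrier G = UNIV"
    and smooth_atlas: "smooth_atlas A"
    and smooth_mult: "Ck_map \<infinity> (prod_atlas A A) A UNIV (\<lambda>(x, y). x \<otimes> y)"
    and smooth_inverse: "Ck_map \<infinity> A A UNIV (\<lambda>x. inv x)"

text \<open>The Lie algebra is the tangent space \<open>'e\<close> at the identity, identified with the
  left-invariant vector fields.\<close>

definition left_invariant_field ::
  "'a monoid \<Rightarrow> ('a, 'e::euclidean_space) chart set \<Rightarrow> 'e \<Rightarrow> 'a \<Rightarrow> 'e" where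
  "left_invariant_field G A v x = tangent_map A A (\<lambda>y. x \<otimes>\<^bsub>G\<^esub> y) \<one>\<^bsub>G\<^esub> v"

definition lie_bracket ::
  "'a monoid \<Rightarrow> ('a, 'e::euclidean_space) chart set \<Rightarrow> 'e \<Rightarrow> 'e \<Rightarrow> 'e" where
  "lie_bracket G A u v =
     field_bracket A (left_invariant_field G A u) (left_invariant_field G A v) \<one>\<^bsub>G\<^esub>"

text \<open>\<open>V i\<close> is the stratum \<open>\<gg>\<^bsub>-i\<^esub>\<close>, and \<open>s\<close> is the number of strata.\<close>

locale carnot_group = lie_group G A
  for G :: "'a::{t2_space, second_countable_topology} monoid" (structure)
    and A :: "('a, 'e::euclidean_space) chart set" +
  fixes V :: "nat \<Rightarrow> 'e set" and s :: nat
  assumes connected: "connected (UNIV :: 'a set)"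
    and simply_connected: "simply_connected (UNIV :: 'a set)"
    and steps: "s \<ge> 1"
    and subspaces: "\<And>i. i \<in> {1..s} \<Longrightarrow> subspace (V i)"
    and direct_sum: "\<And>w. \<exists>!u. u \<in> (\<Pi>\<^sub>E i\<in>{1..s}. V i) \<and> w = (\<Sum>i=1..s. u i)"
    and top_stratum: "V (s + 1) = {0}"
    and brackets: "\<And>i. i \<in> {1..s} \<Longrightarrow>
          span {lie_bracket G A u v | u v. u \<in> V 1 \<and> v \<in> V i} = V (i + 1)"


section \<open>Contact maps, contact fields and rigidity\<close>

text \<open>Below, \<open>D\<close> is the first stratum, as a subspace of the tangent space at the identity.\<close>

definition horizontal ::
  "'a monoid \<Rightarrow> ('a, 'e::euclidean_space) chart set \<Rightarrow> 'e set \<Rightarrow> 'a \<Rightarrow> 'e set" where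
  "horizontal G A D x = tangent_map A A (\<lambda>y. x \<otimes>\<^bsub>G\<^esub> y) \<one>\<^bsub>G\<^esub> ` D"

definition contact_map ::
  "enat \<Rightarrow> 'a::topological_space monoid \<Rightarrow> ('a, 'e::euclidean_space) chart set \<Rightarrow> 'e set \<Rightarrow>
   'a set \<Rightarrow> ('a \<Rightarrow> 'a) \<Rightarrow> bool" where
  "contact_map k G A D U f \<longleftrightarrow>
     Ck_local_diffeo k A A U f \<and>
     (\<forall>x\<in>U. tangent_map A A f x ` horizontal G A D x \<subseteq> horizontal G A D (f x))"

definition contact_field ::
  "'a::topological_space monoid \<Rightarrow> ('a, 'e::euclidean_space) chart set \<Rightarrow> 'e set \<Rightarrow>
   'a set \<Rightarrow> ('a \<Rightarrow> 'e) \<Rightarrow> bool" where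
  "contact_field G A D W Z \<longleftrightarrow>
     open W \<and> Ck_field 1 A W Z \<and>
     (\<forall>W' X. open W' \<and> W' \<subseteq> W \<and> Ck_field \<infinity> A W' X \<and> (\<forall>x\<in>W'. X x \<in> horizontal G A D x) \<longrightarrow>
        (\<forall>x\<in>W'. field_bracket A Z X x \<in> horizontal G A D x))"

definition contact_field_near ::
  "'a::topological_space monoid \<Rightarrow> ('a, 'e::euclidean_space) chart set \<Rightarrow> 'e set \<Rightarrow>
   'a \<Rightarrow> ('a \<Rightarrow> 'e) \<Rightarrow> bool" where
  "contact_field_near G A D p Z \<longleftrightarrow> (\<exists>W. p \<in> W \<and> contact_field G A D W Z)"

text \<open>
  The space of germs at \<open>p\<close> of contact fields has a finite spanning set. Germs are handled
  through representatives: two fields have the same germ iff they agree eventually in \<open>nhds p\<close>.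
\<close>

definition finite_dim_contact_germs ::
  "'a::topological_space monoid \<Rightarrow> ('a, 'e::euclidean_space) chart set \<Rightarrow> 'e set \<Rightarrow> 'a \<Rightarrow> bool" where
  "finite_dim_contact_germs G A D p \<longleftrightarrow>
     (\<exists>B. finite B \<and> (\<forall>Y\<in>B. contact_field_near G A D p Y) \<and>
        (\<forall>Z. contact_field_near G A D p Z \<longrightarrow>
           (\<exists>r. eventually (\<lambda>x. Z x = (\<Sum>Y\<in>B. r Y *\<^sub>R Y x)) (nhds p))))"

text \<open>
  The space of smooth contact maps is not a vector space; the precise meaning of its being
  "finite dimensional", which is the same for \<open>C\<^sup>\<infinity>\<close> and \<open>C\<^sup>2\<close> contact maps (Ottazzi--Warhurst),
  is that all spaces of germs of \<open>C\<^sup>1\<close> contact fields are finite dimensional.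
\<close>

definition smoothly_rigid ::
  "'a::topological_space monoid \<Rightarrow> ('a, 'e::euclidean_space) chart set \<Rightarrow> 'e set \<Rightarrow> bool" where
  "smoothly_rigid G A D \<longleftrightarrow> (\<forall>p. finite_dim_contact_germs G A D p)"

end

theory Submission
  imports Defs
begin

text \<open>
  Only the left-invariant distribution matters. In a chart at the identity write a field as
  \<open>y \<mapsto> LL y (z y)\<close> with \<open>LL\<close> the differential of left translation. It is a contact field if \<open>z\<close> is
  \<open>C\<^sup>1\<close> and satisfies a linear first-order equation in the horizontal directions, which is invariant
  under left translations. Rigidity makes the set of local solutions closed under pointwise
  limits: for bounded \<open>a\<close> the germ of a normalised series \<open>\<Sum>n. a\<^sub>n T\<^sub>n\<close> of solutions lies in a fixed
  finite-dimensional space, and by Baire's theorem this holds on a neighbourhood independent of \<open>a\<close>.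
  Difference quotients along left translations then show that solutions are smooth.

  For a \<open>C\<^sup>1\<close> contact map \<open>f\<close> the maps \<open>f \<circ> L \<circ> f\<^sup>-\<^sup>1\<close>, with \<open>L\<close> the left translation by \<open>t v\<close>, are
  contact maps whose increments divided by \<open>t\<close> converge uniformly, as \<open>t \<rightarrow> 0\<close>, to the push-forward of
  a right-invariant field, while their error in the contact equation tends to \<open>0\<close>. Averaging over
  left translations with a bump function turns uniform into \<open>C\<^sup>1\<close> convergence (integrate by parts)
  and commutes with the contact equation, so the averages of the push-forward are \<open>C\<^sup>1\<close> solutions,
  and they approximate it. Hence the push-forward is itself a solution, so it is smooth: the
  right-invariant derivatives of \<open>f\<close> are smooth functions of \<open>f\<close>, and \<open>f\<close> is smooth by bootstrapping.
\<close>

section \<open>Calculus of maps of class \<open>C\<^sup>n\<close>\<close>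

text \<open>Rigidity bounds the dimension of spaces of germs, and every germ brings its own
  neighbourhood; along a sequence of solutions these could shrink to a point. A finite-dimensional
  space of functions on one fixed ball is therefore not given but has to be won, which is the
  purpose of the Baire argument. Once it is available, finite dimension replaces estimates: no bound
  on derivatives is asked of a pointwise convergent sequence of solutions.

  The second obstacle is that the push-forward by a C^1 map is only continuous, so the contact
  equation cannot even be written for it. Smoothing \<open>f\<close> itself would destroy the
  nonlinear contact condition, whereas the equation for fields is linear and left-invariant. The
  increments satisfy an exact nonlinear condition whose linearisation is the contact equation; this
  controls the combination of derivatives in that equation, while the full derivative of the
  difference quotients may blow up. Right-invariant fields are chosen because their flows are left
  translations, which are contact maps.\<close>

abbreviation fd :: "('a::real_normed_vector \<Rightarrow> 'b::real_normed_vector) \<Rightarrow> 'a \<Rightarrow> 'a \<Rightarrow> 'b" where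
  "fd f x \<equiv> frechet_derivative f (at x)"

lemma fd_eqI: "(f has_derivative f') (at x) \<Longrightarrow> fd f x = f'"
  using frechet_derivative_at by metis

lemma fd_cong_open:
  assumes "open S" "x \<in> S" "\<And>y. y \<in> S \<Longrightarrow> f y = g y"
  shows "fd f x = fd g x"
proof -
  have "(f has_derivative d) (at x) \<longleftrightarrow> (g has_derivative d) (at x)" for d
    using assms has_derivative_transform_within_open by metis
  then show ?thesis by (simp add: frechet_derivative_def)
qed

lemma fd_unique_on:
  assumes "open S" "x \<in> S" "\<And>y. y \<in> S \<Longrightarrow> f y = g y" "(f has_derivative f') (at x)" "(g has_derivative g') (at x)"
  shows "f' v = g' v"
  using fd_cong_open[OF assms(1-3)] fd_eqI[OF assms(4)] fd_eqI[OF assms(5)] by simp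

lemma Cn_on_Suc_derivative:
  "Cn_on (Suc n) S f \<Longrightarrow> x \<in> S \<Longrightarrow> (f has_derivative fd f x) (at x)"
  by (simp add: frechet_derivative_works)

lemma Cn_on_Suc_linear: "Cn_on (Suc n) S f \<Longrightarrow> x \<in> S \<Longrightarrow> linear (fd f x)"
  using Cn_on_Suc_derivative has_derivative_linear by blast

lemma Cn_on_subset: "Cn_on n S f \<Longrightarrow> T \<subseteq> S \<Longrightarrow> Cn_on n T f"
  by (induction n arbitrary: f) (auto intro: continuous_on_subset)

lemma Cn_on_SucD: "Cn_on (Suc n) S f \<Longrightarrow> Cn_on n S f"
proof (induction n arbitrary: f)
  case 0
  then show ?case
    by (auto intro!: continuous_at_imp_continuous_on differentiable_imp_continuous_within)
next
  case (Suc n)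
  then show ?case using Cn_on.simps(2) by blast
qed

lemma Cn_on_le: "Cn_on n S f \<Longrightarrow> m \<le> n \<Longrightarrow> Cn_on m S f"
  by (induction n) (auto simp: le_Suc_eq dest: Cn_on_SucD simp del: Cn_on.simps)

lemma Cn_on_continuous_on: "Cn_on n S f \<Longrightarrow> continuous_on S f"
  using Cn_on_le[of n S f 0] by simp

text \<open>Openness matters: derivatives are taken in the full space, so at a boundary point they
  would see values outside \<open>S\<close>.\<close>

lemma Cn_on_cong:
  assumes "Cn_on n S f" "open S" "\<And>x. x \<in> S \<Longrightarrow> f x = g x"
  shows "Cn_on n S g"
  using assms
proof (induction n arbitrary: f g)
  case 0
  then show ?case using continuous_on_cong by force
next
  case (Suc n)
  have eq: "fd f x = fd g x" if "x \<in> S" for x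
    using fd_cong_open[of S x f g] Suc.prems that by blast
  have "g differentiable (at x)" if "x \<in> S" for x
    using has_derivative_transform_within_open[OF Cn_on_Suc_derivative[OF Suc.prems(1) that]
        Suc.prems(2) that Suc.prems(3)]
    by (auto simp: differentiable_def)
  moreover have "Cn_on n S (\<lambda>x. fd g x v)" for v
    using Suc.IH[of "\<lambda>x. fd f x v" "\<lambda>x. fd g x v"] Suc.prems eq by simp
  ultimately show ?case by simp
qed

lemma Cn_on_SucI:
  assumes "open S" "\<And>x. x \<in> S \<Longrightarrow> (f has_derivative f' x) (at x)"
    "\<And>v. Cn_on n S (\<lambda>x. f' x v)"
  shows "Cn_on (Suc n) S f"
proof -
  have "Cn_on n S (\<lambda>x. fd f x v)" for v
    by (rule Cn_on_cong[OF assms(3)[of v] assms(1)]) (metis assms(2) fd_eqI)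
  then show ?thesis using assms(2) by (auto simp: differentiable_def)
qed

text \<open>Differentiability is meant at the point in the full space, hence is local on any set,
  and order zero is continuity within \<open>S\<close>. So the lemma applies directly to the chart
  images in the final theorem.\<close>

lemma Cn_on_open_cover:
  assumes "\<And>x. x \<in> S \<Longrightarrow> \<exists>T. open T \<and> x \<in> T \<and> Cn_on n (S \<inter> T) f"
  shows "Cn_on n S f"
  using assms
proof (induction n arbitrary: f)
  case 0
  have "continuous (at x within S) f" if x: "x \<in> S" for x
  proof -
    obtain T where T: "open T" "x \<in> T" "continuous_on (S \<inter> T) f"
      using 0[OF x] by auto
    then have "continuous (at x within S \<inter> T) f"
      using x by (simp add: continuous_on_eq_continuous_within)
    then show ?thesis
      using at_within_nhd[of x T "S \<inter> T" S] T by (auto simp: continuous_within)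
  qed
  then show ?case by (simp add: continuous_on_eq_continuous_within)
next
  case (Suc n)
  have "f differentiable (at x)" if "x \<in> S" for x
    using Suc.prems[OF that] that by auto
  moreover have "Cn_on n S (\<lambda>x. fd f x v)" for v
  proof (rule Suc.IH)
    fix x assume "x \<in> S"
    from Suc.prems[OF this] show "\<exists>T. open T \<and> x \<in> T \<and> Cn_on n (S \<inter> T) (\<lambda>x. fd f x v)"
      by auto
  qed
  ultimately show ?case by simp
qed

lemma Cn_on_const: "Cn_on n S (\<lambda>x. c)"
proof (induction n arbitrary: c)
  case (Suc n)
  have "fd (\<lambda>x. c) x = (\<lambda>v. 0)" for x :: 'a
    by (rule fd_eqI) simp
  then show ?case using Suc[of 0] by simp
qed simp

lemma Cn_on_bounded_linear_compose:
  assumes "open S" "bounded_linear L" "Cn_on n S f"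
  shows "Cn_on n S (\<lambda>x. L (f x))"
  using assms(3)
proof (induction n arbitrary: f)
  case 0
  then show ?case using assms(2) bounded_linear.continuous_on by (auto simp: comp_def)
next
  case (Suc n)
  show ?case
  proof (rule Cn_on_SucI[OF assms(1)])
    show "((\<lambda>x. L (f x)) has_derivative (\<lambda>v. L (fd f x v))) (at x)" if "x \<in> S" for x
      using bounded_linear.has_derivative[OF assms(2) Cn_on_Suc_derivative[OF Suc.prems that]] .
    show "Cn_on n S (\<lambda>x. L (fd f x v))" for v
      using Suc.IH Suc.prems by simp
  qed
qed

lemma Cn_on_ident: "open S \<Longrightarrow> Cn_on n S (\<lambda>x. x)"
proof (cases n)
  case (Suc m)
  assume "open S"
  then show ?thesis unfolding Suc by (intro Cn_on_SucI[where f'="\<lambda>x v. v"] Cn_on_const) auto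
qed simp

lemma Cn_on_add:
  assumes "open S" "Cn_on n S f" "Cn_on n S g"
  shows "Cn_on n S (\<lambda>x. f x + g x)"
  using assms(2,3)
proof (induction n arbitrary: f g)
  case 0
  then show ?case by (auto intro: continuous_intros)
next
  case (Suc n)
  show ?case
  proof (rule Cn_on_SucI[OF assms(1)])
    show "((\<lambda>x. f x + g x) has_derivative (\<lambda>v. fd f x v + fd g x v)) (at x)" if "x \<in> S" for x
      using Cn_on_Suc_derivative[OF _ that] Suc.prems by (intro derivative_intros) blast+
    show "Cn_on n S (\<lambda>x. fd f x v + fd g x v)" for v
      using Suc.IH Suc.prems by simp
  qed
qed

lemma Cn_on_sum:
  assumes "open S" "\<And>i. i \<in> I \<Longrightarrow> Cn_on n S (f i)"
  shows "Cn_on n S (\<lambda>x. \<Sum>i\<in>I. f i x)"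
  using assms(2)
  by (induction I rule: infinite_finite_induct)
     (auto intro: Cn_on_const Cn_on_add[OF assms(1)])

lemma Cn_on_scaleR:
  assumes "open S" "Cn_on n S a" "Cn_on n S f"
  shows "Cn_on n S (\<lambda>x. a x *\<^sub>R f x)"
  using assms(2,3)
proof (induction n arbitrary: a f)
  case 0
  then show ?case by (auto intro: continuous_intros)
next
  case (Suc n)
  show ?case
  proof (rule Cn_on_SucI[OF assms(1)])
    show "((\<lambda>x. a x *\<^sub>R f x) has_derivative (\<lambda>v. a x *\<^sub>R fd f x v + fd a x v *\<^sub>R f x)) (at x)"
      if "x \<in> S" for x
      by (intro derivative_intros Cn_on_Suc_derivative[OF Suc.prems(1) that]
          Cn_on_Suc_derivative[OF Suc.prems(2) that])
    show "Cn_on n S (\<lambda>x. a x *\<^sub>R fd f x v + fd a x v *\<^sub>R f x)" for v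
      using Suc.IH Suc.prems Cn_on_SucD[OF Suc.prems(1)] Cn_on_SucD[OF Suc.prems(2)]
      by (intro Cn_on_add[OF assms(1)]) auto
  qed
qed

lemma Cn_on_minus: "open S \<Longrightarrow> Cn_on n S f \<Longrightarrow> Cn_on n S (\<lambda>x. - f x)"
  using Cn_on_bounded_linear_compose[OF _ bounded_linear_minus[OF bounded_linear_ident]] by blast

lemma Cn_on_diff:
  "open S \<Longrightarrow> Cn_on n S f \<Longrightarrow> Cn_on n S g \<Longrightarrow> Cn_on n S (\<lambda>x. f x - g x)"
  using Cn_on_add[OF _ _ Cn_on_minus, of S n f g] by simp

lemma Cn_on_inner_left: "open S \<Longrightarrow> Cn_on n S f \<Longrightarrow> Cn_on n S (\<lambda>x. f x \<bullet> b)"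
  using Cn_on_bounded_linear_compose[OF _ bounded_linear_inner_left] by blast

lemma Cn_on_mult:
  fixes a b :: "'a::euclidean_space \<Rightarrow> real"
  shows "open S \<Longrightarrow> Cn_on n S a \<Longrightarrow> Cn_on n S b \<Longrightarrow> Cn_on n S (\<lambda>x. a x * b x)"
  using Cn_on_scaleR[of S n a b] by simp

lemma bounded_linear_Pair_left: "bounded_linear (\<lambda>x. (x, 0))"
  by (intro bounded_linear_Pair bounded_linear_ident bounded_linear_zero)

lemma bounded_linear_Pair_right: "bounded_linear (\<lambda>x. (0, x))"
  by (intro bounded_linear_Pair bounded_linear_ident bounded_linear_zero)

lemma Cn_on_Pair:
  assumes "open S" "Cn_on n S f" "Cn_on n S g"
  shows "Cn_on n S (\<lambda>x. (f x, g x))"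
proof -
  have "Cn_on n S (\<lambda>x. (f x, 0) + (0, g x))"
    by (intro Cn_on_add Cn_on_bounded_linear_compose[OF _ bounded_linear_Pair_left]
        Cn_on_bounded_linear_compose[OF _ bounded_linear_Pair_right] assms)
  then show ?thesis by simp
qed

lemma Cn_on_fst: "open S \<Longrightarrow> Cn_on n S f \<Longrightarrow> Cn_on n S (\<lambda>x. fst (f x))"
  using Cn_on_bounded_linear_compose[OF _ bounded_linear_fst] by blast

lemma Cn_on_snd: "open S \<Longrightarrow> Cn_on n S f \<Longrightarrow> Cn_on n S (\<lambda>x. snd (f x))"
  using Cn_on_bounded_linear_compose[OF _ bounded_linear_snd] by blast

lemma linear_sum_Basis:
  fixes L :: "'a::euclidean_space \<Rightarrow> 'b::real_vector"
  assumes "linear L"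
  shows "L v = (\<Sum>b\<in>Basis. (v \<bullet> b) *\<^sub>R L b)"
proof -
  have "L v = L (\<Sum>b\<in>Basis. (v \<bullet> b) *\<^sub>R b)" by (simp add: euclidean_representation)
  then show ?thesis by (simp add: linear_sum[OF assms] linear_cmul[OF assms])
qed

text \<open>\<open>Cn_on\<close> speaks of derivatives in a fixed direction. Expanding
  \<open>h x\<close> in the basis lets the direction vary with the point; the chain rule and all
  moving frames below rely on this.\<close>

lemma Cn_on_linear_family:
  fixes K :: "'a::euclidean_space \<Rightarrow> 'b::euclidean_space \<Rightarrow> 'c::euclidean_space"
  assumes "open S" "\<And>x. x \<in> S \<Longrightarrow> linear (K x)" "\<And>v. Cn_on n S (\<lambda>x. K x v)" "Cn_on n S h"
  shows "Cn_on n S (\<lambda>x. K x (h x))"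
proof (rule Cn_on_cong[OF _ assms(1)])
  show "Cn_on n S (\<lambda>x. \<Sum>b\<in>Basis. (h x \<bullet> b) *\<^sub>R K x b)"
    by (intro Cn_on_sum Cn_on_scaleR Cn_on_inner_left assms)
  show "(\<Sum>b\<in>Basis. (h x \<bullet> b) *\<^sub>R K x b) = K x (h x)" if "x \<in> S" for x
    using linear_sum_Basis[OF assms(2)[OF that], of "h x"] by simp
qed

lemma Cn_on_compose:
  assumes "open S" "Cn_on n S f" "Cn_on n T g" "\<And>x. x \<in> S \<Longrightarrow> f x \<in> T"
  shows "Cn_on n S (\<lambda>x. g (f x))"
  using assms(2,3)
proof (induction n arbitrary: g)
  case 0
  then show ?case
    using continuous_on_compose2[of T g S f] assms(4) by auto
next
  case (Suc n)
  note df = Cn_on_Suc_derivative[OF Suc.prems(1)] and dg = Cn_on_Suc_derivative[OF Suc.prems(2)]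
  show ?case
  proof (rule Cn_on_SucI[OF assms(1)])
    show "((\<lambda>x. g (f x)) has_derivative (\<lambda>v. fd g (f x) (fd f x v))) (at x)" if "x \<in> S" for x
      using has_derivative_compose[OF df[OF that] dg[OF assms(4)[OF that]]] .
    show "Cn_on n S (\<lambda>x. fd g (f x) (fd f x v))" for v
    proof (rule Cn_on_linear_family[where K="\<lambda>x. fd g (f x)" and h="\<lambda>x. fd f x v", OF assms(1)])
      show "linear (fd g (f x))" if "x \<in> S" for x
        using Cn_on_Suc_linear[OF Suc.prems(2) assms(4)[OF that]] .
      show "Cn_on n S (\<lambda>x. fd g (f x) w)" for w
        using Suc.IH[OF Cn_on_SucD[OF Suc.prems(1)], of "\<lambda>y. fd g y w"] Suc.prems(2) by simp
      show "Cn_on n S (\<lambda>x. fd f x v)" using Suc.prems(1) by simp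
    qed
  qed
qed

lemma Cn_on_fd_compose:
  assumes "open S" "Cn_on (Suc n) T g" "Cn_on n S f" "Cn_on n S h" "\<And>x. x \<in> S \<Longrightarrow> f x \<in> T"
  shows "Cn_on n S (\<lambda>x. fd g (f x) (h x))"
proof (rule Cn_on_linear_family[where K="\<lambda>x. fd g (f x)" and h=h, OF assms(1)])
  show "linear (fd g (f x))" if "x \<in> S" for x
    using Cn_on_Suc_linear[OF assms(2) assms(5)[OF that]] .
  show "Cn_on n S (\<lambda>x. fd g (f x) v)" for v
    using Cn_on_compose[OF assms(1,3) _ assms(5), of "\<lambda>y. fd g y v"] assms(2) by simp
qed (use assms in auto)

lemma fd_compose:
  assumes "(f has_derivative f') (at x)" "(g has_derivative g') (at (f x))"
  shows "fd (\<lambda>x. g (f x)) x v = g' (f' v)"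
  using fd_eqI[OF has_derivative_compose[OF assms]] by simp

section \<open>Symmetry of second derivatives\<close>

lemma second_difference_mvt:
  fixes g :: "real \<Rightarrow> real \<Rightarrow> real"
  assumes "h > 0"
    and s: "\<And>s t. 0 \<le> s \<Longrightarrow> s \<le> h \<Longrightarrow> 0 \<le> t \<Longrightarrow> t \<le> h \<Longrightarrow> ((\<lambda>s. g s t) has_real_derivative gs s t) (at s)"
    and st: "\<And>s t. 0 \<le> s \<Longrightarrow> s \<le> h \<Longrightarrow> 0 \<le> t \<Longrightarrow> t \<le> h \<Longrightarrow> ((\<lambda>t. gs s t) has_real_derivative gst s t) (at t)"
  shows "\<exists>s t. 0 < s \<and> s < h \<and> 0 < t \<and> t < h \<and> g h h - g h 0 - g 0 h + g 0 0 = h * h * gst s t"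
proof -
  have "\<exists>s. 0 < s \<and> s < h \<and> (g h h - g h 0) - (g 0 h - g 0 0) = (h - 0) * (gs s h - gs s 0)"
    using assms(1) by (intro MVT2 derivative_intros s) auto
  then obtain s where s: "0 < s" "s < h" "(g h h - g h 0) - (g 0 h - g 0 0) = h * (gs s h - gs s 0)"
    by auto
  have "\<exists>t. 0 < t \<and> t < h \<and> gs s h - gs s 0 = (h - 0) * gst s t"
    using assms(1) s by (intro MVT2 st) auto
  then obtain t where t: "0 < t" "t < h" "gs s h - gs s 0 = h * gst s t"
    by auto
  show ?thesis using s t by (intro exI[of _ s] exI[of _ t]) auto
qed

text \<open>The second difference of a component of \<open>f\<close> over a small parallelogram with
  sides along \<open>u\<close> and \<open>v\<close> is \<open>h * h\<close> times a mixed derivative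
  at a nearby point, in either order of differentiation. Continuity of both mixed derivatives then
  forces equality at \<open>x\<close>.\<close>

lemma symmetric_fd:
  fixes f :: "'a::euclidean_space \<Rightarrow> 'b::euclidean_space"
  assumes "open S" "x \<in> S" and f: "Cn_on 2 S f"
  shows "fd (\<lambda>y. fd f y u) x v = fd (\<lambda>y. fd f y v) x u"
proof (rule euclidean_eqI)
  fix b :: 'b
  assume b: "b \<in> Basis"
  have f2: "Cn_on (Suc (Suc 0)) S f" using f by (simp add: numeral_2_eq_2)
  have f1: "Cn_on (Suc 0) S (\<lambda>y. fd f y w)" for w using f2 by simp
  define H where "H = (\<lambda>w z y. fd (\<lambda>y. fd f y w) y z \<bullet> b)"
  have contH: "continuous (at x) (H w z)" for w z
  proof -
    have "continuous_on S (\<lambda>y. fd (\<lambda>y. fd f y w) y z)" using f1[of w] by simp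
    then show ?thesis
      using assms unfolding H_def
      by (intro continuous_intros) (auto simp: continuous_on_eq_continuous_at)
  qed
  have "dist (H u v x) (H v u x) \<le> e" if e: "e > 0" for e
  proof -
    obtain d1 where d1: "d1 > 0" "\<And>y. dist y x < d1 \<Longrightarrow> dist (H u v y) (H u v x) < e/2"
      using contH[of u v] half_gt_zero[OF e] unfolding continuous_at_eps_delta by blast
    obtain d2 where d2: "d2 > 0" "\<And>y. dist y x < d2 \<Longrightarrow> dist (H v u y) (H v u x) < e/2"
      using contH[of v u] half_gt_zero[OF e] unfolding continuous_at_eps_delta by blast
    obtain d3 where d3: "d3 > 0" "ball x d3 \<subseteq> S"
      using assms open_contains_ball by blast
    define d where "d = min d1 (min d2 d3)"
    \<comment> \<open>The whole parallelogram then stays within distance \<open>d\<close> of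
      \<open>x\<close>; the summand 1 covers \<open>u = v = 0\<close>.\<close>
    define h where "h = d / (2 * (norm u + norm v + 1))"
    have "d > 0" using d1 d2 d3 by (simp add: d_def)
    then have h: "h > 0" by (simp add: h_def add_nonneg_pos)
    have near: "dist (x + s *\<^sub>R u + t *\<^sub>R v) x < d" if "0 \<le> s" "s \<le> h" "0 \<le> t" "t \<le> h" for s t
    proof -
      have "dist (x + s *\<^sub>R u + t *\<^sub>R v) x = norm (s *\<^sub>R u + t *\<^sub>R v)"
        by (simp add: dist_norm algebra_simps)
      also have "\<dots> \<le> norm (s *\<^sub>R u) + norm (t *\<^sub>R v)" by (rule norm_triangle_ineq)
      also have "\<dots> \<le> h * norm u + h * norm v"
        using that by (intro add_mono) (auto intro: mult_right_mono)
      also have "\<dots> < h * (2 * (norm u + norm v + 1))"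
      proof -
        have "0 \<le> h * norm u" "0 \<le> h * norm v" using h by simp_all
        moreover have "h * (2 * (norm u + norm v + 1)) = 2 * (h * norm u) + 2 * (h * norm v) + 2 * h"
          by (simp add: algebra_simps)
        ultimately show ?thesis using h by linarith
      qed
      also have "\<dots> = d" 
      proof -
        have "norm u + norm v + 1 \<noteq> 0" using norm_ge_zero[of u] norm_ge_zero[of v] by linarith
        then show ?thesis unfolding h_def by (simp add: field_simps)
      qed
      finally show ?thesis .
    qed
    have inS: "x + s *\<^sub>R u + t *\<^sub>R v \<in> S" if "0 \<le> s" "s \<le> h" "0 \<le> t" "t \<le> h" for s t
      using near[OF that] d3 by (auto simp: d_def dist_commute)
    have der: "((\<lambda>s. k (p + s *\<^sub>R w + q) \<bullet> b) has_real_derivative (fd k (p + s *\<^sub>R w + q) w \<bullet> b)) (at s)"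
      if k: "(k has_derivative fd k (p + s *\<^sub>R w + q)) (at (p + s *\<^sub>R w + q))"
      for k :: "'a \<Rightarrow> 'b" and s w p q
    proof -
      have "((\<lambda>s. p + s *\<^sub>R w + q) has_derivative (\<lambda>r. r *\<^sub>R w)) (at s)"
        by (auto intro!: derivative_eq_intros)
      from has_derivative_compose[OF this k]
      have "((\<lambda>s. k (p + s *\<^sub>R w + q) \<bullet> b) has_derivative (\<lambda>r. fd k (p + s *\<^sub>R w + q) (r *\<^sub>R w) \<bullet> b)) (at s)"
        by (rule has_derivative_inner_left)
      moreover have "linear (fd k (p + s *\<^sub>R w + q))" using k has_derivative_linear by blast
      then have "(\<lambda>r. fd k (p + s *\<^sub>R w + q) (r *\<^sub>R w) \<bullet> b) = (*) (fd k (p + s *\<^sub>R w + q) w \<bullet> b)"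
        by (auto simp: linear_cmul)
      ultimately show ?thesis by (simp only: has_field_derivative_def)
    qed
    have der0: "((\<lambda>s. k (p + s *\<^sub>R w) \<bullet> b) has_real_derivative (fd k (p + s *\<^sub>R w) w \<bullet> b)) (at s)"
      if k: "(k has_derivative fd k (p + s *\<^sub>R w)) (at (p + s *\<^sub>R w))"
      for k :: "'a \<Rightarrow> 'b" and s w p
      using der[of k p s w 0] k by simp
    define g where "g = (\<lambda>s t. f (x + s *\<^sub>R u + t *\<^sub>R v) \<bullet> b)"
    have "\<exists>s t. 0 < s \<and> s < h \<and> 0 < t \<and> t < h \<and>
        g h h - g h 0 - g 0 h + g 0 0 = h * h * H u v (x + s *\<^sub>R u + t *\<^sub>R v)"
      unfolding g_def H_def
      by (intro second_difference_mvt[OF h, where gs="\<lambda>s t. fd f (x + s *\<^sub>R u + t *\<^sub>R v) u \<bullet> b"]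
          der der0 Cn_on_Suc_derivative[OF f2 inS] Cn_on_Suc_derivative[OF f1 inS])
    then obtain y1 where y1: "dist y1 x < d" "g h h - g h 0 - g 0 h + g 0 0 = h * h * H u v y1"
      using near by (meson less_imp_le)
    have "\<exists>s t. 0 < s \<and> s < h \<and> 0 < t \<and> t < h \<and>
        g h h - g 0 h - g h 0 + g 0 0 = h * h * H v u (x + t *\<^sub>R u + s *\<^sub>R v)"
      unfolding g_def H_def
      by (intro second_difference_mvt[OF h, where g="\<lambda>t s. f (x + s *\<^sub>R u + t *\<^sub>R v) \<bullet> b"
          and gs="\<lambda>t s. fd f (x + s *\<^sub>R u + t *\<^sub>R v) v \<bullet> b"]
          der der0 Cn_on_Suc_derivative[OF f2 inS] Cn_on_Suc_derivative[OF f1 inS])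
    then obtain y2 where y2: "dist y2 x < d" "g h h - g 0 h - g h 0 + g 0 0 = h * h * H v u y2"
      using near by (meson less_imp_le)
    have "h * h * H u v y1 = h * h * H v u y2" using y1 y2 by linarith
    then have "H u v y1 = H v u y2" using h by simp
    moreover have "dist (H u v y1) (H u v x) < e/2" "dist (H v u y2) (H v u x) < e/2"
      using d1(2)[of y1] d2(2)[of y2] y1(1) y2(1) by (simp_all add: d_def)
    ultimately show ?thesis unfolding dist_real_def by linarith
  qed
  then have "H u v x = H v u x" by (meson dense_ge dist_le_zero_iff)
  then show "fd (\<lambda>y. fd f y u) x v \<bullet> b = fd (\<lambda>y. fd f y v) x u \<bullet> b" by (simp add: H_def)
qed

section \<open>Finite-dimensional spaces of functions\<close>

definition spanned_on :: "'i set \<Rightarrow> ('i \<Rightarrow> 'x \<Rightarrow> 'v::real_vector) \<Rightarrow> 'x set \<Rightarrow> ('x \<Rightarrow> 'v) \<Rightarrow> bool" where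
  "spanned_on I Y N f \<longleftrightarrow> (\<exists>r. \<forall>x\<in>N. f x = (\<Sum>i\<in>I. r i *\<^sub>R Y i x))"

lemma spanned_on_lincomb:
  assumes "spanned_on I Y N f" "spanned_on I Y N h"
  shows "spanned_on I Y N (\<lambda>x. a *\<^sub>R f x + b *\<^sub>R h x)"
proof -
  obtain r t where r: "\<And>x. x \<in> N \<Longrightarrow> f x = (\<Sum>i\<in>I. r i *\<^sub>R Y i x)" "\<And>x. x \<in> N \<Longrightarrow> h x = (\<Sum>i\<in>I. t i *\<^sub>R Y i x)"
    using assms unfolding spanned_on_def by blast
  have "a *\<^sub>R f x + b *\<^sub>R h x = (\<Sum>i\<in>I. (a * r i + b * t i) *\<^sub>R Y i x)" if "x \<in> N" for x
    using r[OF that] by (simp add: scaleR_sum_right scaleR_add_left sum.distrib)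
  then show ?thesis unfolding spanned_on_def by (intro exI[of _ "\<lambda>i. a * r i + b * t i"]) blast
qed

lemma spanned_on_cong:
  "spanned_on I Y N f \<Longrightarrow> (\<And>x. x \<in> N \<Longrightarrow> f x = g x) \<Longrightarrow> spanned_on I Y N g"
  unfolding spanned_on_def by metis

text \<open>A finite-dimensional space of functions on \<open>N\<close> is closed under pointwise
  convergence. \<open>P\<close> stands for membership, so a property such as solving an equation
  passes to the limit although pointwise convergence alone would not preserve it. The induction
  removes one spanning function at a time; as \<open>Y i\<close> need not satisfy \<open>P\<close>,
  a member \<open>p\<close> with nonzero \<open>i\<close>-th coefficient takes its place.\<close>

lemma pointwise_limit_in_span:
  fixes P :: "('x \<Rightarrow> 'v::real_normed_vector) \<Rightarrow> bool" and Y :: "'i \<Rightarrow> 'x \<Rightarrow> 'v"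
  assumes "finite I"
    and lin: "\<And>f g a b. P f \<Longrightarrow> P g \<Longrightarrow> P (\<lambda>x. a *\<^sub>R f x + b *\<^sub>R g x)"
    and cong: "\<And>f g. P f \<Longrightarrow> (\<And>x. x \<in> N \<Longrightarrow> f x = g x) \<Longrightarrow> P g"
    and "\<And>f. P f \<Longrightarrow> spanned_on I Y N f"
    and "\<And>n::nat. P (g n)" and "\<And>x. x \<in> N \<Longrightarrow> (\<lambda>n. g n x) \<longlonglongrightarrow> G x"
  shows "P G"
  using assms
proof (induction I arbitrary: P g G rule: finite_induct)
  case empty
  note lin = empty.prems(1) and cong = empty.prems(2) and span = empty.prems(3)
    and Pg = empty.prems(4) and lim = empty.prems(5)
  have g0: "g n x = 0" if "x \<in> N" for n x using span[OF Pg[of n]] that by (simp add: spanned_on_def)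
  show ?case
  proof (rule cong[OF Pg[of 0]])
    fix x assume x: "x \<in> N"
    then have "(\<lambda>n. g n x) \<longlonglongrightarrow> 0" using g0 by simp
    then show "g 0 x = G x" using lim[OF x] g0[OF x] LIMSEQ_unique by metis
  qed
next
  case (insert i I)
  note lin = insert.prems(1) and cong = insert.prems(2) and span = insert.prems(3)
    and Pg = insert.prems(4) and lim = insert.prems(5)
  \<comment> \<open>The members that already lie in the span of the smaller family; the induction
    hypothesis is applied to this subspace.\<close>
  define Q where "Q = (\<lambda>f. P f \<and> spanned_on I Y N f)"
  have Q_lin: "Q (\<lambda>x. a *\<^sub>R f x + b *\<^sub>R h x)" if "Q f" "Q h" for f h a b
    using that lin[of f h a b] spanned_on_lincomb[of I Y N f h a b] unfolding Q_def by blast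
  have Q_cong: "Q h" if "Q f" "\<And>x. x \<in> N \<Longrightarrow> f x = h x" for f h
    using that cong[of f h] spanned_on_cong[of I Y N f h] unfolding Q_def by blast
  have Q_lim: "Q H" if "\<And>n. Q (h n)" "\<And>x. x \<in> N \<Longrightarrow> (\<lambda>n. h n x) \<longlonglongrightarrow> H x" for h H
  proof (rule insert.IH[of Q h H])
    show "spanned_on I Y N f" if "Q f" for f
      using that by (simp add: Q_def)
  qed (fact Q_lin, erule Q_cong, blast, fact that(1), erule that(2))
  show ?case
  proof (cases "\<forall>f. P f \<longrightarrow> Q f")
    case True
    then show ?thesis using Q_lim[of g G] Pg lim unfolding Q_def by blast
  next
    case False
    then obtain p where p: "P p" "\<not> Q p" by blast
    obtain rp where rp: "\<And>x. x \<in> N \<Longrightarrow> p x = rp i *\<^sub>R Y i x + (\<Sum>j\<in>I. rp j *\<^sub>R Y j x)"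
      using span[OF p(1)] insert.hyps by (auto simp: spanned_on_def)
    have rpi: "rp i \<noteq> 0"
    proof
      assume "rp i = 0"
      then have "\<forall>x\<in>N. p x = (\<Sum>j\<in>I. rp j *\<^sub>R Y j x)" using rp by simp
      then have "Q p" using p(1) unfolding Q_def spanned_on_def by blast
      then show False using p(2) by blast
    qed
    have "\<exists>c. Q (\<lambda>x. 1 *\<^sub>R f x + (- c) *\<^sub>R p x)" if f: "P f" for f
    proof -
      obtain r where r: "\<And>x. x \<in> N \<Longrightarrow> f x = r i *\<^sub>R Y i x + (\<Sum>j\<in>I. r j *\<^sub>R Y j x)"
        using span[OF f] insert.hyps by (auto simp: spanned_on_def)
      define c where "c = r i / rp i"
      have "1 *\<^sub>R f x + (- c) *\<^sub>R p x = (\<Sum>j\<in>I. (r j - c * rp j) *\<^sub>R Y j x)" if "x \<in> N" for x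
        using r[OF that] rp[OF that] rpi
        by (simp add: c_def algebra_simps scaleR_sum_right sum_subtractf sum_negf)
      then have "spanned_on I Y N (\<lambda>x. 1 *\<^sub>R f x + (- c) *\<^sub>R p x)"
        unfolding spanned_on_def by (intro exI[of _ "\<lambda>i. r i - c * rp i"]) blast
      then show ?thesis using lin[OF f p(1), of 1 "- c"] unfolding Q_def by blast
    qed
    then have "\<exists>c. \<forall>n. Q (\<lambda>x. 1 *\<^sub>R g n x + (- c n) *\<^sub>R p x)"
      using Pg by (intro choice) blast
    then obtain c where c: "\<And>n. Q (\<lambda>x. 1 *\<^sub>R g n x + (- c n) *\<^sub>R p x)" by blast
    \<comment> \<open>Normalising the coefficients makes them bounded; if the weight of \<open>g\<close> disappears in the limit,
      then \<open>p\<close> itself lies in the smaller space.\<close>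
    define A where "A = (\<lambda>n. (1 / (1 + \<bar>c n\<bar>), c n / (1 + \<bar>c n\<bar>)))"
    have "A n \<in> cbox (-1, -1) (1, 1)" for n
      by (auto simp: A_def cbox_Pair_eq field_simps abs_if)
    then obtain l s where s: "strict_mono s" and l: "(\<lambda>n. A (s n)) \<longlonglongrightarrow> l"
      using compact_cbox[of "(-1::real, -1::real)" "(1, 1)"]
      unfolding compact_eq_seq_compact_metric seq_compact_def comp_def by blast
    define a b where "a = fst l" and "b = snd l"
    have lab: "(\<lambda>n. 1 / (1 + \<bar>c (s n)\<bar>)) \<longlonglongrightarrow> a" "(\<lambda>n. c (s n) / (1 + \<bar>c (s n)\<bar>)) \<longlonglongrightarrow> b"
      using tendsto_fst[OF l] tendsto_snd[OF l] by (simp_all add: A_def a_def b_def)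
    have "(\<lambda>n. 1 / (1 + \<bar>c (s n)\<bar>) + \<bar>c (s n) / (1 + \<bar>c (s n)\<bar>)\<bar>) \<longlonglongrightarrow> a + \<bar>b\<bar>"
      by (intro tendsto_intros lab)
    moreover have "1 / (1 + \<bar>c (s n)\<bar>) + \<bar>c (s n) / (1 + \<bar>c (s n)\<bar>)\<bar> = 1" for n
      by (simp add: field_simps)
    ultimately have ab: "a + \<bar>b\<bar> = 1" by (simp add: LIMSEQ_const_iff)
    have Qab: "Q (\<lambda>x. a *\<^sub>R G x - b *\<^sub>R p x)"
    proof (rule Q_lim)
      fix n
      have "Q (\<lambda>x. (1 / (1 + \<bar>c (s n)\<bar>)) *\<^sub>R (1 *\<^sub>R g (s n) x + (- c (s n)) *\<^sub>R p x) + 0 *\<^sub>R (1 *\<^sub>R g (s n) x + (- c (s n)) *\<^sub>R p x))"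
        by (rule Q_lin[OF c c])
      then show "Q (\<lambda>x. (1 / (1 + \<bar>c (s n)\<bar>)) *\<^sub>R g (s n) x - (c (s n) / (1 + \<bar>c (s n)\<bar>)) *\<^sub>R p x)"
        by (rule Q_cong) (simp add: scaleR_diff_right)
    next
      fix x assume "x \<in> N"
      then have "(\<lambda>n. g (s n) x) \<longlonglongrightarrow> G x"
        using LIMSEQ_subseq_LIMSEQ[OF lim s] by (simp add: comp_def)
      then show "(\<lambda>n. (1 / (1 + \<bar>c (s n)\<bar>)) *\<^sub>R g (s n) x - (c (s n) / (1 + \<bar>c (s n)\<bar>)) *\<^sub>R p x)
          \<longlonglongrightarrow> a *\<^sub>R G x - b *\<^sub>R p x"
        by (intro tendsto_intros lab)
    qed
    show ?thesis
    proof (cases "a = 0")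
      case True
      then have b: "b \<noteq> 0" using ab by auto
      have "Q p"
        by (rule Q_cong[OF Q_lin[OF Qab Qab, of "- 1 / b" 0]]) (use True b in simp)
      then show ?thesis using p by blast
    next
      case False
      have "P (\<lambda>x. a *\<^sub>R G x - b *\<^sub>R p x)" using Qab by (simp add: Q_def)
      from lin[OF this p(1), of "1/a" "b/a"] show ?thesis
        by (rule cong) (use False in \<open>simp add: scaleR_diff_right\<close>)
    qed
  qed
qed

section \<open>Limits of C^1 maps, integration by parts and bump functions\<close>

lemma C1_limit:
  fixes g :: "nat \<Rightarrow> 'a::euclidean_space \<Rightarrow> 'b::euclidean_space"
  assumes S: "open S" "convex S"
    and g: "\<And>n. Cn_on 1 S (g n)"
    and lim: "\<And>x. x \<in> S \<Longrightarrow> (\<lambda>n. g n x) \<longlonglongrightarrow> G x"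
    and ul: "\<And>v. uniform_limit S (\<lambda>n x. fd (g n) x v) (\<lambda>x. A x v) sequentially"
  shows "Cn_on 1 S G" and "\<And>x v. x \<in> S \<Longrightarrow> fd G x v = A x v"
proof -
  have g1: "Cn_on (Suc 0) S (g n)" for n using g[of n] by simp
  have lin: "linear (A x)" if "x \<in> S" for x
  proof -
    have l: "(\<lambda>n. fd (g n) x v) \<longlonglongrightarrow> A x v" for v
      using tendsto_uniform_limitI[OF ul that] .
    have fl: "linear (fd (g n) x)" for n using Cn_on_Suc_linear[OF g1 that] .
    show ?thesis
    proof (rule linearI)
      show "A x (u + v) = A x u + A x v" for u v
        by (rule LIMSEQ_unique[OF l]) (use tendsto_add[OF l[of u] l[of v]] in \<open>simp add: linear_add[OF fl]\<close>)
      show "A x (r *\<^sub>R v) = r *\<^sub>R A x v" for r v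
        by (rule LIMSEQ_unique[OF l])
          (use tendsto_scaleR[OF tendsto_const l[of v], of r] in \<open>simp add: linear_cmul[OF fl]\<close>)
    qed
  qed
  have est: "\<forall>\<^sub>F n in sequentially. \<forall>x\<in>S. \<forall>h. norm (fd (g n) x h - A x h) \<le> e * norm h"
    if e: "e > 0" for e
  proof -
    \<comment> \<open>Each of the \<open>DIM('a)\<close> basis directions contributes at most
      \<open>d * norm h\<close>. This upgrades uniformity for fixed directions to uniformity in
      \<open>h\<close>.\<close>
    define d where "d = e / real DIM('a)"
    have d: "d > 0" using e by (simp add: d_def)
    have "\<forall>\<^sub>F n in sequentially. \<forall>b\<in>Basis. \<forall>x\<in>S. dist (fd (g n) x b) (A x b) < d"
      using uniform_limitD[OF ul d] by (intro eventually_ball_finite) auto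
    then show ?thesis
    proof eventually_elim
      case (elim n)
      show ?case
      proof (intro ballI allI)
        fix x h assume x: "x \<in> S"
        define L where "L = (\<lambda>h. fd (g n) x h - A x h)"
        have "linear L" unfolding L_def
          using lin[OF x] Cn_on_Suc_linear[OF g1 x] by (intro linear_compose_sub)
        then have "norm (L h) = norm (\<Sum>b\<in>Basis. (h \<bullet> b) *\<^sub>R L b)" using linear_sum_Basis by metis
        also have "\<dots> \<le> (\<Sum>b\<in>(Basis::'a set). norm h * d)"
        proof (rule sum_norm_le)
          fix b :: 'a assume b: "b \<in> Basis"
          have "norm (L b) \<le> d" using elim b x by (auto simp: L_def dist_norm intro: less_imp_le)
          then show "norm ((h \<bullet> b) *\<^sub>R L b) \<le> norm h * d"
            using Basis_le_norm[OF b] by (auto intro!: mult_mono)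
        qed
        also have "\<dots> = e * norm h" by (simp add: d_def)
        finally show "norm (fd (g n) x h - A x h) \<le> e * norm h" by (simp add: L_def)
      qed
    qed
  qed
  have der: "(G has_derivative A x) (at x)" if x: "x \<in> S" for x
  proof -
    have "\<exists>k. \<forall>x\<in>S. (\<lambda>n. g n x) \<longlonglongrightarrow> k x \<and> (k has_derivative A x) (at x within S)"
      by (rule has_derivative_sequence[where f=g and f'="\<lambda>n. fd (g n)" and g'=A, OF S(2) _ est x lim[OF x]])
        (auto intro: has_derivative_at_withinI Cn_on_Suc_derivative[OF g1])
    then obtain k where k: "\<And>x. x \<in> S \<Longrightarrow> (\<lambda>n. g n x) \<longlonglongrightarrow> k x"
      "\<And>x. x \<in> S \<Longrightarrow> (k has_derivative A x) (at x within S)" by blast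
    have "k y = G y" if "y \<in> S" for y using k(1)[OF that] lim[OF that] LIMSEQ_unique by blast
    then show ?thesis
      using has_derivative_transform_within_open[OF _ S(1) x, of k "A x" UNIV G] k(2)[OF x] at_within_open[OF x S(1)]
      by simp
  qed
  show "fd G x v = A x v" if "x \<in> S" for x v
    using fd_eqI[OF der[OF that]] by simp
  have "Cn_on (Suc 0) S G"
  proof (rule Cn_on_SucI[OF S(1) der])
    show "Cn_on 0 S (\<lambda>x. A x v)" for v
      using uniform_limit_theorem[OF _ ul[of v]] g1 by simp
  qed
  then show "Cn_on 1 S G" by simp
qed

text \<open>Translating the variable moves the box; since \<open>g\<close> vanishes outside either
  box, it can be moved back.\<close>

lemma integral_translate_supp:
  fixes g :: "'a::euclidean_space \<Rightarrow> 'b::euclidean_space"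
  assumes "\<And>x. x \<notin> cbox a b \<Longrightarrow> g x = 0" "\<And>x. x \<notin> cbox (a + c) (b + c) \<Longrightarrow> g x = 0"
  shows "integral (cbox a b) (\<lambda>x. g (x + c)) = integral (cbox a b) g"
proof -
  have "integral (cbox a b) (\<lambda>x. g (x + c)) = integral (cbox (a + c) (b + c)) g"
    using integral_shift_cbox_plus[where f=g and c=c] by (simp add: add.commute comp_def)
  also have "\<dots> = integral UNIV (\<lambda>x. if x \<in> cbox (a + c) (b + c) then g x else 0)"
    by (simp only: integral_restrict_UNIV)
  also have "(\<lambda>x. if x \<in> cbox (a + c) (b + c) then g x else 0) = (\<lambda>x. if x \<in> cbox a b then g x else 0)"
    using assms by (intro ext) (metis (full_types))
  also have "integral UNIV \<dots> = integral (cbox a b) g"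
    by (simp only: integral_restrict_UNIV)
  finally show ?thesis .
qed

text \<open>For small \<open>t\<close> the translate of \<open>g\<close> by \<open>t e\<close> keeps
  its support in the box, so its integral does not depend on \<open>t\<close>; differentiating under
  the integral at 0 gives the claim.\<close>

lemma integral_fd_eq_0:
  fixes g :: "'a::euclidean_space \<Rightarrow> 'b::euclidean_space"
  assumes g: "Cn_on 1 UNIV g" and "s < c" and supp: "\<And>x. s < norm x \<Longrightarrow> g x = 0"
  shows "integral (cbox (- c *\<^sub>R One) (c *\<^sub>R One)) (\<lambda>x. fd g x e) = 0"
proof -
  let ?Q = "cbox (- c *\<^sub>R One) (c *\<^sub>R (One::'a))"
  \<comment> \<open>For |t| < \<open>d\<close> the box moved by \<open>t e\<close> still contains
    the ball of radius \<open>s\<close>.\<close>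
  define d where "d = (c - s) / (1 + norm e)"
  have d: "d > 0" using assms(2) by (simp add: d_def add_pos_nonneg)
  have g1: "Cn_on (Suc 0) UNIV g" using g by simp
  have contg: "continuous_on UNIV g" using Cn_on_continuous_on[OF g] .
  have contd: "continuous_on UNIV (\<lambda>x. fd g x e)" using g1 by simp
  have small: "\<bar>t\<bar> * norm e < c - s" if "\<bar>t\<bar> < d" for t
  proof -
    have "\<bar>t\<bar> * (1 + norm e) < c - s" using that by (simp add: d_def pos_less_divide_eq add_pos_nonneg)
    then show ?thesis by (simp add: distrib_left)
  qed
  have out: "g x = 0" if "x \<notin> cbox (- c *\<^sub>R One + t *\<^sub>R e) (c *\<^sub>R One + t *\<^sub>R e)" "\<bar>t\<bar> < d" for x t
  proof (rule supp, rule ccontr)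
    assume "\<not> s < norm x"
    then have "norm (x - t *\<^sub>R e) \<le> c"
      using small[OF that(2)] norm_triangle_ineq4[of x "t *\<^sub>R e"] by simp
    then have "\<bar>(x - t *\<^sub>R e) \<bullet> i\<bar> \<le> c" if "i \<in> Basis" for i
      using Basis_le_norm[OF that] order_trans by blast
    then have "x \<in> cbox (- c *\<^sub>R One + t *\<^sub>R e) (c *\<^sub>R One + t *\<^sub>R e)"
      by (auto simp: mem_box inner_diff_left inner_add_left abs_le_iff algebra_simps)
    then show False using that by blast
  qed
  define H where "H = (\<lambda>t. integral ?Q (\<lambda>x. g (x + t *\<^sub>R e)))"
  have "H t = integral ?Q g" if "\<bar>t\<bar> < d" for t
    unfolding H_def using out[of _ 0] out[OF _ that] d by (intro integral_translate_supp) auto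
  then have "(H has_vector_derivative 0) (at 0)"
    using d by (intro has_vector_derivative_transform_within_open[of "\<lambda>t. integral ?Q g" 0 0 "{-d<..<d}" H])
      (auto simp: abs_less_iff)
  moreover have "(H has_vector_derivative integral ?Q (\<lambda>x. fd g (x + 0 *\<^sub>R e) e)) (at 0 within UNIV)"
    unfolding H_def
  proof (rule leibniz_rule_vector_derivative)
    show "((\<lambda>t. g (x + t *\<^sub>R e)) has_vector_derivative fd g (x + t *\<^sub>R e) e) (at t within UNIV)" for t x
    proof -
      have "((\<lambda>t. x + t *\<^sub>R e) has_derivative (\<lambda>r. r *\<^sub>R e)) (at t)"
        by (auto intro!: derivative_eq_intros)
      from has_derivative_compose[OF this Cn_on_Suc_derivative[OF g1]]
      show ?thesis
        using linear_cmul[OF Cn_on_Suc_linear[OF g1, of "x + t *\<^sub>R e"]] by (simp add: has_vector_derivative_def)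
    qed
    show "(\<lambda>x. g (x + t *\<^sub>R e)) integrable_on ?Q" for t
      by (intro integrable_continuous continuous_on_compose2[OF contg] continuous_intros) auto
    show "continuous_on (UNIV \<times> ?Q) (\<lambda>(t, x). fd g (x + t *\<^sub>R e) e)"
      unfolding split_beta
      by (intro continuous_on_compose2[OF contd] continuous_intros) auto
  qed auto
  ultimately show ?thesis using vector_derivative_unique_at by fastforce
qed

text \<open>A truncated quadratic, squared to make it C^1: this is the regularity that one
  integration by parts consumes.\<close>

definition bump :: "real \<Rightarrow> 'a::euclidean_space \<Rightarrow> real" where
  "bump s u = (max 0 (s\<^sup>2 - u \<bullet> u))\<^sup>2"

lemma bump_nonneg: "0 \<le> bump s u" by (simp add: bump_def)

lemma bump_eq_0: "0 \<le> s \<Longrightarrow> s \<le> norm u \<Longrightarrow> bump s u = 0"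
  using power_mono[of s "norm u" 2] by (simp add: bump_def power2_norm_eq_inner)

lemma DERIV_max_square: "((\<lambda>t::real. (max 0 t)\<^sup>2) has_real_derivative 2 * max 0 t) (at t)"
proof -
  consider "t > 0" | "t < 0" | "t = 0" by linarith
  then show ?thesis
  proof cases
    case 1
    then have "((\<lambda>t::real. t\<^sup>2) has_real_derivative 2 * max 0 t) (at t)"
      by (auto intro!: derivative_eq_intros)
    moreover have "\<forall>\<^sub>F t in nhds t. (max 0 t)\<^sup>2 = t\<^sup>2"
      using eventually_nhds_in_open[of "{0<..}" t] 1 by (auto elim: eventually_mono)
    ultimately show ?thesis
      using DERIV_cong_ev[of t t "\<lambda>t. (max 0 t)\<^sup>2" "\<lambda>t. t\<^sup>2" "2 * max 0 t" "2 * max 0 t"] by auto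
  next
    case 2
    then have "((\<lambda>t::real. 0) has_real_derivative 2 * max 0 t) (at t)" by auto
    moreover have "\<forall>\<^sub>F t in nhds t. (max 0 t)\<^sup>2 = 0"
      using eventually_nhds_in_open[of "{..<0}" t] 2 by (auto elim: eventually_mono)
    ultimately show ?thesis
      using DERIV_cong_ev[of t t "\<lambda>t. (max 0 t)\<^sup>2" "\<lambda>t. 0" "2 * max 0 t" "2 * max 0 t"] by auto
  next
    case 3
    have "(\<lambda>h::real. max 0 h) \<midarrow>0\<rightarrow> max 0 0" by (intro tendsto_intros)
    moreover have "\<forall>\<^sub>F h in at (0::real). max 0 h = ((max 0 (0 + h))\<^sup>2 - (max 0 0)\<^sup>2) / h"
      by (auto simp: eventually_at_filter max_def power2_eq_square)
    ultimately have "(\<lambda>h::real. ((max 0 (0 + h))\<^sup>2 - (max 0 0)\<^sup>2) / h) \<midarrow>0\<rightarrow> 2 * max 0 0"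
      using tendsto_cong by fastforce
    then show ?thesis unfolding 3 DERIV_def .
  qed
qed

lemma Cn_on_bump: "Cn_on 1 S (bump s :: 'a::euclidean_space \<Rightarrow> real)"
proof -
  have "Cn_on (Suc 0) UNIV (bump s :: 'a \<Rightarrow> real)"
  proof (rule Cn_on_SucI)
    fix u :: 'a
    have "((\<lambda>u. s\<^sup>2 - u \<bullet> u) has_derivative (\<lambda>v. - 2 * (u \<bullet> v))) (at u)"
      by (auto intro!: derivative_eq_intros simp: inner_commute)
    from has_derivative_compose[OF this DERIV_max_square[unfolded has_field_derivative_def]]
    show "(bump s has_derivative (\<lambda>v. 2 * max 0 (s\<^sup>2 - u \<bullet> u) * (- 2 * (u \<bullet> v)))) (at u)"
      by (simp add: bump_def[abs_def])
  next
    show "Cn_on 0 UNIV (\<lambda>u. 2 * max 0 (s\<^sup>2 - u \<bullet> u) * (- 2 * (u \<bullet> v)))" for v :: 'a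
      by (auto intro!: continuous_intros)
  qed simp
  then show ?thesis using Cn_on_subset by fastforce
qed

lemma integral_bump_pos:
  assumes "0 < s" "0 < c"
  shows "0 < integral (cbox (- c *\<^sub>R One) (c *\<^sub>R (One::'a::euclidean_space))) (bump s)"
proof -
  let ?Q = "cbox (- c *\<^sub>R One) (c *\<^sub>R (One::'a))"
  have cont: "continuous_on ?Q (bump s)" using Cn_on_continuous_on[OF Cn_on_bump] .
  then have int: "(bump s has_integral integral ?Q (bump s)) ?Q"
    using integrable_continuous by blast
  have "integral ?Q (bump s) \<noteq> 0"
  proof
    assume "integral ?Q (bump s) = 0"
    then have "(bump s has_integral 0) ?Q" using int by simp
    moreover have "box (- c *\<^sub>R One) (c *\<^sub>R (One::'a)) \<noteq> {}" using assms(2) by (simp add: box_ne_empty)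
    moreover have "0 \<in> ?Q" using assms(2) by (simp add: mem_box)
    ultimately have "bump s (0::'a) = 0"
      using has_integral_0_cbox_imp_0[OF cont] bump_nonneg by blast
    then show False using assms(1) by (simp add: bump_def)
  qed
  moreover have "0 \<le> integral ?Q (bump s)"
    using integrable_continuous[OF cont] bump_nonneg integral_nonneg by blast
  ultimately show ?thesis by simp
qed

section \<open>Local Lie groups\<close>

declare Cn_on.simps [simp del]

text \<open>The group law read in a chart centred at the identity. It is a partial group: nothing is
  known of \<open>m\<close> and \<open>iv\<close> outside the ball, hence the membership conditions
  in the laws.\<close>

locale local_lie =
  fixes m :: "'e::euclidean_space \<times> 'e \<Rightarrow> 'e" and iv :: "'e \<Rightarrow> 'e" and R :: real
  assumes R_pos: "0 < R"
    and m_smooth: "Cn_on n (ball 0 R \<times> ball 0 R) m"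
    and iv_smooth: "Cn_on n (ball 0 R) iv"
    and m_zero_right: "u \<in> ball 0 R \<Longrightarrow> m (u, 0) = u"
    and m_zero_left: "u \<in> ball 0 R \<Longrightarrow> m (0, u) = u"
    and m_assoc: "\<lbrakk>u \<in> ball 0 R; v \<in> ball 0 R; w \<in> ball 0 R; m (u, v) \<in> ball 0 R; m (v, w) \<in> ball 0 R\<rbrakk>
      \<Longrightarrow> m (m (u, v), w) = m (u, m (v, w))"
    and iv_zero: "iv 0 = 0"
    and m_iv_left: "\<lbrakk>u \<in> ball 0 R; iv u \<in> ball 0 R\<rbrakk> \<Longrightarrow> m (iv u, u) = 0"
    and m_iv_right: "\<lbrakk>u \<in> ball 0 R; iv u \<in> ball 0 R\<rbrakk> \<Longrightarrow> m (u, iv u) = 0"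
begin

lemma shrink:
  assumes "0 < \<rho>"
  shows "\<exists>r>0. r \<le> \<rho> \<and> (\<forall>u\<in>ball 0 r. \<forall>v\<in>ball 0 r. m (u, v) \<in> ball 0 \<rho>) \<and>
    (\<forall>u\<in>ball 0 r. iv u \<in> ball 0 \<rho>)"
proof -
  have o: "open (ball (0::'e) R \<times> ball (0::'e) R)" by (intro open_Times open_ball)
  have "isCont m (0, 0)"
    using Cn_on_continuous_on[OF m_smooth[of 0]] o R_pos by (auto simp: continuous_on_eq_continuous_at)
  then obtain d1 where d1: "d1 > 0" "\<And>p. dist p (0, 0) < d1 \<Longrightarrow> dist (m p) (m (0, 0)) < \<rho>"
    using assms unfolding continuous_at_eps_delta by blast
  have "isCont iv 0"
    using Cn_on_continuous_on[OF iv_smooth[of 0]] R_pos by (auto simp: continuous_on_eq_continuous_at)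
  then obtain d2 where d2: "d2 > 0" "\<And>u. dist u 0 < d2 \<Longrightarrow> dist (iv u) (iv 0) < \<rho>"
    using assms unfolding continuous_at_eps_delta by blast
  define r where "r = Min {d1/2, d2, \<rho>}"
  have r: "r > 0" "r \<le> d1/2" "r \<le> d2" "r \<le> \<rho>"
    using d1 d2 assms by (auto simp: r_def)
  have "m (u, v) \<in> ball 0 \<rho>" if uv: "u \<in> ball 0 r" "v \<in> ball 0 r" for u v
  proof -
    have "dist (u, v) (0, 0) \<le> norm u + norm v"
      unfolding dist_norm using sqrt_sum_squares_le_sum[of "norm u" "norm v"] by (simp add: norm_Pair)
    also have "\<dots> < d1" using uv r by (simp add: dist_norm)
    finally show ?thesis using d1(2)[of "(u, v)"] m_zero_left[of 0] R_pos by (simp add: dist_commute)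
  qed
  moreover have "iv u \<in> ball 0 \<rho>" if "u \<in> ball 0 r" for u
    using d2(2)[of u] that r iv_zero by (simp add: dist_commute)
  ultimately show ?thesis using r by blast
qed

definition rad :: "real \<Rightarrow> real" where
  "rad \<rho> = (SOME r. 0 < r \<and> r \<le> \<rho> \<and> (\<forall>u\<in>ball 0 r. \<forall>v\<in>ball 0 r. m (u, v) \<in> ball 0 \<rho>) \<and>
    (\<forall>u\<in>ball 0 r. iv u \<in> ball 0 \<rho>))"

lemma rad:
  assumes "0 < \<rho>"
  shows "0 < rad \<rho>" "rad \<rho> \<le> \<rho>"
    "u \<in> ball 0 (rad \<rho>) \<Longrightarrow> v \<in> ball 0 (rad \<rho>) \<Longrightarrow> m (u, v) \<in> ball 0 \<rho>"
    "u \<in> ball 0 (rad \<rho>) \<Longrightarrow> iv u \<in> ball 0 \<rho>"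
  using someI_ex[OF shrink[OF assms]] unfolding rad_def[symmetric] by blast+

text \<open>Each product or inversion costs one level: from \<open>B2\<close> it leads into
  \<open>B1\<close>, from \<open>B1\<close> into \<open>B0\<close>, where the group laws hold. Two
  spare levels are enough for the identities with three factors below.\<close>

definition "B0 = ball (0::'e) R"
definition "B1 = ball (0::'e) (rad R)"
definition "B2 = ball (0::'e) (rad (rad R))"

lemmas B_defs = B0_def B1_def B2_def

lemma open_B [simp]: "open B0" "open B1" "open B2"
  by (simp_all add: B_defs)

lemma rad_pos: "0 < rad R" "0 < rad (rad R)"
  using rad(1) R_pos by auto

lemma B_mono: "u \<in> B1 \<Longrightarrow> u \<in> B0" "u \<in> B2 \<Longrightarrow> u \<in> B1"
  using rad(2)[OF R_pos] rad(2)[OF rad_pos(1)] by (auto simp: B_defs)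

lemma B_m: "u \<in> B1 \<Longrightarrow> v \<in> B1 \<Longrightarrow> m (u, v) \<in> B0" "u \<in> B2 \<Longrightarrow> v \<in> B2 \<Longrightarrow> m (u, v) \<in> B1"
  using rad(3)[OF R_pos] rad(3)[OF rad_pos(1)] unfolding B_defs by blast+

lemma B_iv: "u \<in> B1 \<Longrightarrow> iv u \<in> B0" "u \<in> B2 \<Longrightarrow> iv u \<in> B1"
  using rad(4)[OF R_pos] rad(4)[OF rad_pos(1)] unfolding B_defs by blast+

lemma zero_in_B [simp]: "0 \<in> B0" "0 \<in> B1" "0 \<in> B2"
  using R_pos rad_pos by (auto simp: B_defs)

lemma group_laws:
  "u \<in> B0 \<Longrightarrow> m (u, 0) = u" "u \<in> B0 \<Longrightarrow> m (0, u) = u"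
  "\<lbrakk>u \<in> B0; v \<in> B0; w \<in> B0; m (u, v) \<in> B0; m (v, w) \<in> B0\<rbrakk> \<Longrightarrow> m (m (u, v), w) = m (u, m (v, w))"
  "\<lbrakk>u \<in> B0; iv u \<in> B0\<rbrakk> \<Longrightarrow> m (iv u, u) = 0" "\<lbrakk>u \<in> B0; iv u \<in> B0\<rbrakk> \<Longrightarrow> m (u, iv u) = 0"
  unfolding B_defs using m_zero_right m_zero_left m_assoc m_iv_left m_iv_right by blast+

lemma smooth_on_B: "Cn_on n (B0 \<times> B0) m" "Cn_on n B0 iv"
  unfolding B_defs using m_smooth iv_smooth by auto

lemma open_BB: "open (B0 \<times> B0)" by (intro open_Times open_B)

section \<open>Invariant fields and the adjoint action\<close>

definition d1 :: "'e \<Rightarrow> 'e \<Rightarrow> 'e \<Rightarrow> 'e" where "d1 x y v = fd m (x, y) (v, 0)"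
definition d2 :: "'e \<Rightarrow> 'e \<Rightarrow> 'e \<Rightarrow> 'e" where "d2 x y v = fd m (x, y) (0, v)"

lemma m_has_derivative:
  "x \<in> B0 \<Longrightarrow> y \<in> B0 \<Longrightarrow> (m has_derivative fd m (x, y)) (at (x, y))"
  using Cn_on_Suc_derivative[OF smooth_on_B(1)] by blast

lemma m_has_derivative_pair:
  assumes "(f has_derivative f') (at x)" "(g has_derivative g') (at x)" "f x \<in> B0" "g x \<in> B0"
  shows "((\<lambda>x. m (f x, g x)) has_derivative (\<lambda>v. d1 (f x) (g x) (f' v) + d2 (f x) (g x) (g' v))) (at x)"
proof -
  have "((\<lambda>x. (f x, g x)) has_derivative (\<lambda>v. (f' v, g' v))) (at x)"
    using assms by (intro has_derivative_Pair)
  from has_derivative_compose[OF this m_has_derivative[OF assms(3,4)]]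
  have "((\<lambda>x. m (f x, g x)) has_derivative (\<lambda>v. fd m (f x, g x) (f' v, g' v))) (at x)" .
  moreover have "fd m (f x, g x) (f' v, g' v) = d1 (f x) (g x) (f' v) + d2 (f x) (g x) (g' v)" for v
    using linear_add[OF has_derivative_linear[OF m_has_derivative[OF assms(3,4)]], of "(f' v, 0)" "(0, g' v)"]
    by (simp add: d1_def d2_def)
  ultimately show ?thesis by simp
qed

lemma linear_d:
  assumes "x \<in> B0" "y \<in> B0"
  shows "linear (d1 x y)" "linear (d2 x y)"
proof -
  have l: "linear (fd m (x, y))" using has_derivative_linear[OF m_has_derivative[OF assms]] .
  show "linear (d1 x y)" "linear (d2 x y)"
    using linear_compose[OF bounded_linear.linear[OF bounded_linear_Pair_left] l]
      linear_compose[OF bounded_linear.linear[OF bounded_linear_Pair_right] l]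
    by (simp_all add: d1_def[abs_def] d2_def[abs_def] comp_def)
qed

lemma m_has_derivative_right:
  assumes "(g has_derivative g') (at x)" "a \<in> B0" "g x \<in> B0"
  shows "((\<lambda>x. m (a, g x)) has_derivative (\<lambda>v. d2 a (g x) (g' v))) (at x)"
  using m_has_derivative_pair[OF has_derivative_const assms(1), of a] assms linear_0[OF linear_d(1)[OF assms(2,3)]]
  by simp

lemma m_has_derivative_left:
  assumes "(f has_derivative f') (at x)" "f x \<in> B0" "b \<in> B0"
  shows "((\<lambda>x. m (f x, b)) has_derivative (\<lambda>v. d1 (f x) b (f' v))) (at x)"
  using m_has_derivative_pair[OF assms(1) has_derivative_const, of b] assms linear_0[OF linear_d(2)[OF assms(2,3)]]
  by simp

lemma Cn_on_m:
  assumes "open S" "Cn_on n S f" "Cn_on n S g" "\<And>x. x \<in> S \<Longrightarrow> f x \<in> B0" "\<And>x. x \<in> S \<Longrightarrow> g x \<in> B0"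
  shows "Cn_on n S (\<lambda>x. m (f x, g x))"
  using Cn_on_compose[OF assms(1) Cn_on_Pair[OF assms(1-3)] smooth_on_B(1)] assms(4,5) by simp

lemma Cn_on_iv:
  assumes "open S" "Cn_on n S f" "\<And>x. x \<in> S \<Longrightarrow> f x \<in> B0"
  shows "Cn_on n S (\<lambda>x. iv (f x))"
  using Cn_on_compose[OF assms(1) assms(2) smooth_on_B(2)] assms(3) by simp

lemma Cn_on_d:
  assumes "open S" "Cn_on n S f" "Cn_on n S g" "Cn_on n S h"
    "\<And>x. x \<in> S \<Longrightarrow> f x \<in> B0" "\<And>x. x \<in> S \<Longrightarrow> g x \<in> B0"
  shows "Cn_on n S (\<lambda>x. d1 (f x) (g x) (h x))" "Cn_on n S (\<lambda>x. d2 (f x) (g x) (h x))"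
  unfolding d1_def d2_def
  using assms(5,6)
  by (auto intro!: Cn_on_fd_compose[OF assms(1) smooth_on_B(1)] Cn_on_Pair assms(1-4) Cn_on_const)

lemma iv_has_derivative: "x \<in> B0 \<Longrightarrow> (iv has_derivative fd iv x) (at x)"
  using Cn_on_Suc_derivative[OF smooth_on_B(2)] by blast

text \<open>\<open>LL x v\<close> and \<open>RR x v\<close> are the values at \<open>x\<close> of the left- and right-invariant fields with
  value \<open>v\<close> at the identity; \<open>IL x\<close> and \<open>IR x\<close> are their inverses in \<open>v\<close>.\<close>

definition LL :: "'e \<Rightarrow> 'e \<Rightarrow> 'e" where "LL x v = d2 x 0 v"
definition RR :: "'e \<Rightarrow> 'e \<Rightarrow> 'e" where "RR x v = d1 0 x v"
definition IL :: "'e \<Rightarrow> 'e \<Rightarrow> 'e" where "IL x v = d2 (iv x) x v"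
definition IR :: "'e \<Rightarrow> 'e \<Rightarrow> 'e" where "IR x v = d1 x (iv x) v"

lemma linear_LR:
  "x \<in> B0 \<Longrightarrow> linear (LL x)" "x \<in> B0 \<Longrightarrow> linear (RR x)"
  "x \<in> B1 \<Longrightarrow> linear (IL x)" "x \<in> B1 \<Longrightarrow> linear (IR x)"
  using linear_d B_mono(1) B_iv(1) zero_in_B(1) by (auto simp: LL_def[abs_def] RR_def[abs_def] IL_def[abs_def] IR_def[abs_def])

lemma Cn_on_LR:
  assumes "open S" "Cn_on n S f" "Cn_on n S h"
  shows "(\<And>x. x \<in> S \<Longrightarrow> f x \<in> B0) \<Longrightarrow> Cn_on n S (\<lambda>x. LL (f x) (h x))"
    "(\<And>x. x \<in> S \<Longrightarrow> f x \<in> B0) \<Longrightarrow> Cn_on n S (\<lambda>x. RR (f x) (h x))"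
    "(\<And>x. x \<in> S \<Longrightarrow> f x \<in> B1) \<Longrightarrow> Cn_on n S (\<lambda>x. IL (f x) (h x))"
    "(\<And>x. x \<in> S \<Longrightarrow> f x \<in> B1) \<Longrightarrow> Cn_on n S (\<lambda>x. IR (f x) (h x))"
proof -
  have c: "Cn_on n S (\<lambda>x. 0)" by (rule Cn_on_const)
  show "Cn_on n S (\<lambda>x. LL (f x) (h x))" if "\<And>x. x \<in> S \<Longrightarrow> f x \<in> B0"
    unfolding LL_def by (rule Cn_on_d(2)[OF assms(1,2) c assms(3) that zero_in_B(1)])
  show "Cn_on n S (\<lambda>x. RR (f x) (h x))" if "\<And>x. x \<in> S \<Longrightarrow> f x \<in> B0"
    unfolding RR_def by (rule Cn_on_d(1)[OF assms(1) c assms(2,3) zero_in_B(1) that])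
  have i: "Cn_on n S (\<lambda>x. iv (f x))" if "\<And>x. x \<in> S \<Longrightarrow> f x \<in> B1"
    by (rule Cn_on_iv[OF assms(1,2) B_mono(1)[OF that]])
  show "Cn_on n S (\<lambda>x. IL (f x) (h x))" if "\<And>x. x \<in> S \<Longrightarrow> f x \<in> B1"
    unfolding IL_def by (rule Cn_on_d(2)[OF assms(1) i[OF that] assms(2,3) B_iv(1)[OF that] B_mono(1)[OF that]])
  show "Cn_on n S (\<lambda>x. IR (f x) (h x))" if "\<And>x. x \<in> S \<Longrightarrow> f x \<in> B1"
    unfolding IR_def by (rule Cn_on_d(1)[OF assms(1,2) i[OF that] assms(3) B_mono(1)[OF that] B_iv(1)[OF that]])
qed

text \<open>Differentiate \<open>m (a, m (x, s)) = m (m (a, x), s)\<close> in \<open>s\<close> at 0.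
  Translation and averaging of solutions rest on this left invariance.\<close>

lemma LL_translate:
  assumes "a \<in> B1" "x \<in> B1"
  shows "d2 a x (LL x v) = LL (m (a, x)) v"
proof -
  have "((\<lambda>s. m (a, m (x, s))) has_derivative (\<lambda>v. d2 a (m (x, 0)) (d2 x 0 v))) (at 0)"
    using assms B_mono(1) B_m(1) by (intro m_has_derivative_right) auto
  moreover have "((\<lambda>s. m (m (a, x), s)) has_derivative (\<lambda>v. d2 (m (a, x)) 0 v)) (at 0)"
    using assms B_mono(1) B_m(1) by (intro m_has_derivative_right) auto
  moreover have "m (a, m (x, s)) = m (m (a, x), s)" if "s \<in> B1" for s
    using assms B_mono(1) B_m(1) that by (intro group_laws(3)[symmetric]) auto
  ultimately have "d2 a (m (x, 0)) (d2 x 0 v) = d2 (m (a, x)) 0 v"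
    by (intro fd_unique_on[of B1 0]) auto
  then show ?thesis using assms B_mono(1) by (simp add: LL_def group_laws(1))
qed

text \<open>Differentiate \<open>m (m (y, s), g) = m (y, m (s, g))\<close> in \<open>s\<close> at 0.
  A variation of the left factor becomes one of the right factor, so that both terms of a product
  rule can be read in one frame.\<close>

lemma d1_LL:
  assumes "y \<in> B1" "g \<in> B1"
  shows "d1 y g (LL y v) = d2 y g (RR g v)"
proof -
  have "((\<lambda>s. m (m (y, s), g)) has_derivative (\<lambda>v. d1 (m (y, 0)) g (d2 y 0 v))) (at 0)"
    using assms B_mono(1) B_m(1) by (intro m_has_derivative_right m_has_derivative_left) auto
  moreover have "((\<lambda>s. m (y, m (s, g))) has_derivative (\<lambda>v. d2 y (m (0, g)) (d1 0 g v))) (at 0)"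
    using assms B_mono(1) B_m(1) by (intro m_has_derivative_right m_has_derivative_left) auto
  moreover have "m (m (y, s), g) = m (y, m (s, g))" if "s \<in> B1" for s
    using assms B_mono(1) B_m(1) that by (intro group_laws(3)) auto
  ultimately have "d1 (m (y, 0)) g (d2 y 0 v) = d2 y (m (0, g)) (d1 0 g v)"
    by (intro fd_unique_on[of B1 0]) auto
  then show ?thesis using assms B_mono(1) by (simp add: LL_def RR_def group_laws(1) group_laws(2))
qed

lemma LL_zero: "LL 0 v = v"
proof -
  have "((\<lambda>s. m (0, s)) has_derivative (\<lambda>v. d2 0 0 v)) (at 0)"
    by (intro m_has_derivative_right) auto
  moreover have "((\<lambda>s::'e. s) has_derivative (\<lambda>v. v)) (at 0)" by simp
  ultimately have "d2 0 0 v = v"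
    by (intro fd_unique_on[of B0 0 "\<lambda>s. m (0, s)" "\<lambda>s. s" "\<lambda>v. d2 0 0 v" "\<lambda>v. v"]) (auto simp: group_laws)
  then show ?thesis by (simp add: LL_def)
qed

lemma RR_zero: "RR 0 v = v"
proof -
  have "((\<lambda>s. m (s, 0)) has_derivative (\<lambda>v. d1 0 0 v)) (at 0)"
    by (intro m_has_derivative_left) auto
  moreover have "((\<lambda>s::'e. s) has_derivative (\<lambda>v. v)) (at 0)" by simp
  ultimately have "d1 0 0 v = v"
    by (intro fd_unique_on[of B0 0 "\<lambda>s. m (s, 0)" "\<lambda>s. s" "\<lambda>v. d1 0 0 v" "\<lambda>v. v"]) (auto simp: group_laws)
  then show ?thesis by (simp add: RR_def)
qed

lemma IL_LL: "x \<in> B2 \<Longrightarrow> IL x (LL x v) = v"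
  using LL_translate[of "iv x" x v] B_iv(1,2) B_mono(1,2) by (simp add: IL_def group_laws(4) LL_zero)

lemma IR_RR:
  assumes "x \<in> B2"
  shows "IR x (RR x v) = v"
proof -
  have x: "x \<in> B0" "x \<in> B1" "iv x \<in> B0" "iv x \<in> B1" using assms B_iv(1,2) B_mono(1,2) by auto
  have "((\<lambda>s. m (m (s, x), iv x)) has_derivative (\<lambda>v. d1 (m (0, x)) (iv x) (d1 0 x v))) (at 0)"
    using x B_mono(1) B_m(1) by (intro m_has_derivative_left) auto
  moreover have "((\<lambda>s::'e. s) has_derivative (\<lambda>v. v)) (at 0)" by simp
  moreover have "m (m (s, x), iv x) = s" if "s \<in> B1" for s
    using group_laws(3)[of s x "iv x"] x that B_mono(1) B_m(1) by (simp add: group_laws(5) group_laws(1))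
  ultimately have "d1 (m (0, x)) (iv x) (d1 0 x v) = v"
    by (intro fd_unique_on[of B1 0 "\<lambda>s. m (m (s, x), iv x)" "\<lambda>s. s"
          "\<lambda>v. d1 (m (0, x)) (iv x) (d1 0 x v)" "\<lambda>v. v"]) auto
  then show ?thesis using x by (simp add: IR_def RR_def group_laws(2))
qed

text \<open>In finite dimension a left inverse of a linear endomorphism is a right inverse.\<close>

lemma LL_IL: "x \<in> B2 \<Longrightarrow> LL x (IL x v) = v"
  using linear_inverse_left[OF linear_LR(1)[of x] linear_LR(3)[of x]] IL_LL[of x] B_mono(1,2)
  by (auto simp: fun_eq_iff)

lemma RR_IR: "x \<in> B2 \<Longrightarrow> RR x (IR x v) = v"
  using linear_inverse_left[OF linear_LR(2)[of x] linear_LR(4)[of x]] IR_RR[of x] B_mono(1,2)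
  by (auto simp: fun_eq_iff)

lemma m_iv_cancel: "y \<in> B2 \<Longrightarrow> g \<in> B2 \<Longrightarrow> m (iv y, m (y, g)) = g"
  using group_laws(3)[of "iv y" y g] B_iv(1,2) B_mono(1,2) B_m(1,2) by (simp add: group_laws(4) group_laws(2))

lemma m_cancel_iv: "y \<in> B2 \<Longrightarrow> g \<in> B2 \<Longrightarrow> m (y, m (iv y, g)) = g"
  using group_laws(3)[of y "iv y" g] B_iv(1,2) B_mono(1,2) B_m(1,2) by (simp add: group_laws(5) group_laws(2))

lemma d2_inj:
  assumes "y \<in> B2" "g \<in> B2" "d2 y g u = d2 y g v"
  shows "u = v"
proof -
  have yg: "y \<in> B0" "iv y \<in> B0" "g \<in> B0" "m (y, g) \<in> B0" using assms B_iv(1,2) B_mono(1,2) B_m(1,2) by auto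
  have "((\<lambda>s. m (iv y, m (y, s))) has_derivative (\<lambda>v. d2 (iv y) (m (y, g)) (d2 y g v))) (at g)"
    using yg by (intro m_has_derivative_right) auto
  moreover have "((\<lambda>s::'e. s) has_derivative (\<lambda>v. v)) (at g)" by simp
  ultimately have "d2 (iv y) (m (y, g)) (d2 y g w) = w" for w
    using assms m_iv_cancel
    by (intro fd_unique_on[of B2 g "\<lambda>s. m (iv y, m (y, s))" "\<lambda>s. s"
          "\<lambda>v. d2 (iv y) (m (y, g)) (d2 y g v)" "\<lambda>v. v"]) auto
  then show ?thesis using assms(3) by metis
qed

text \<open>The Lie bracket of \<open>a\<close> and \<open>b\<close>: the coordinate formula DY(X) -
  DX(Y) at the identity, with X and Y the left-invariant fields of \<open>a\<close> and
  \<open>b\<close>.\<close>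

definition beta :: "'e \<Rightarrow> 'e \<Rightarrow> 'e" where
  "beta a b = fd (\<lambda>x. LL x b) 0 a - fd (\<lambda>x. LL x a) 0 b"

lemma LL_has_derivative: "x \<in> B0 \<Longrightarrow> ((\<lambda>x. LL x v) has_derivative fd (\<lambda>x. LL x v) x) (at x)"
  by (rule Cn_on_Suc_derivative[of 0 B0], rule Cn_on_LR(1)[OF _ Cn_on_ident Cn_on_const]) auto

lemma linear_beta: "linear (\<lambda>a. beta a b)"
proof (rule linearI)
  have l: "linear (fd (\<lambda>x. LL x v) 0)" for v
    using has_derivative_linear[OF LL_has_derivative[OF zero_in_B(1)]] .
  have "fd (\<lambda>x. LL x (u + v)) 0 w = fd (\<lambda>x. LL x u) 0 w + fd (\<lambda>x. LL x v) 0 w" for u v w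
    using fd_unique_on[of B0 0 "\<lambda>x. LL x (u + v)" "\<lambda>x. LL x u + LL x v",
        OF _ _ _ LL_has_derivative has_derivative_add[OF LL_has_derivative LL_has_derivative]]
    by (simp add: linear_add[OF linear_LR(1)])
  then show "beta (u + v) b = beta u b + beta v b" for u v
    by (simp add: beta_def linear_add[OF l])
  have "fd (\<lambda>x. LL x (r *\<^sub>R v)) 0 w = r *\<^sub>R fd (\<lambda>x. LL x v) 0 w" for r v w
    using fd_unique_on[of B0 0 "\<lambda>x. LL x (r *\<^sub>R v)" "\<lambda>x. r *\<^sub>R LL x v",
        OF _ _ _ LL_has_derivative has_derivative_scaleR_right[OF LL_has_derivative]]
    by (simp add: linear_cmul[OF linear_LR(1)])
  then show "beta (r *\<^sub>R v) b = r *\<^sub>R beta v b" for r v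
    by (simp add: beta_def linear_cmul[OF l] scaleR_diff_right)
qed

text \<open>\<open>IL x (RR x v)\<close> is the adjoint action of the inverse of \<open>x\<close> on \<open>v\<close>.\<close>

lemma adjoint_has_derivative: "((\<lambda>x. IL x (RR x v)) has_derivative (\<lambda>h. - beta h v)) (at 0)"
proof -
  define N where "N = (\<lambda>x. IL x (RR x v))"
  have "Cn_on (Suc 0) B1 N" unfolding N_def
    by (rule Cn_on_LR(3)[OF _ Cn_on_ident Cn_on_LR(2)[OF _ Cn_on_ident Cn_on_const]]) (auto intro: B_mono)
  then have N: "(N has_derivative fd N 0) (at 0)" by (rule Cn_on_Suc_derivative) simp
  have N0: "N 0 = v" using IL_LL[of 0 v] by (simp add: N_def RR_zero LL_zero)
  have LN: "LL x (N x) = RR x v" if "x \<in> B2" for x using LL_IL[OF that] by (simp add: N_def)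
  have L1: "Cn_on (Suc 0) (B0 \<times> UNIV) (\<lambda>p. LL (fst p) (snd p))"
    by (rule Cn_on_LR(1)[OF _ Cn_on_fst[OF _ Cn_on_ident] Cn_on_snd[OF _ Cn_on_ident]]) (auto intro: open_Times)
  \<comment> \<open>Product rule at 0: the derivative in the vector argument is the identity,
    because \<open>LL 0\<close> is.\<close>
  have LNd: "((\<lambda>x. LL x (N x)) has_derivative (\<lambda>h. fd (\<lambda>x. LL x v) 0 h + fd N 0 h)) (at 0)"
  proof -
    let ?F = "\<lambda>p. LL (fst p) (snd p)"
    have F: "(?F has_derivative fd ?F (0, v)) (at (0, v))" using Cn_on_Suc_derivative[OF L1] by simp
    have p1: "((\<lambda>x. (x, v)) has_derivative (\<lambda>h. (h, 0))) (at 0)"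
      and p2: "((\<lambda>w. (0::'e, w)) has_derivative (\<lambda>h. (0, h))) (at v)"
      by (auto intro!: derivative_eq_intros)
    have fx: "fd (\<lambda>x. LL x v) 0 h = fd ?F (0, v) (h, 0)" for h
      using fd_compose[OF p1 F, of h] by simp
    have "fd (\<lambda>w. LL 0 w) v h = fd ?F (0, v) (0, h)" for h
      using fd_compose[OF p2 F, of h] by simp
    then have fw: "fd ?F (0, v) (0, h) = h" for h
      using fd_eqI[OF has_derivative_ident, of v] by (simp add: LL_zero)
    have "((\<lambda>x. ?F (x, N x)) has_derivative (\<lambda>h. fd ?F (0, v) (h, fd N 0 h))) (at 0)"
      by (rule has_derivative_compose[where g="?F", OF has_derivative_Pair[OF has_derivative_ident N]])
        (simp add: N0 F)
    moreover have "fd ?F (0, v) (h, fd N 0 h) = fd (\<lambda>x. LL x v) 0 h + fd N 0 h" for h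
      using linear_add[OF has_derivative_linear[OF F], of "(h, 0)" "(0, fd N 0 h)"] fx[of h] fw[of "fd N 0 h"] by simp
    ultimately show ?thesis by simp
  qed
  have "Cn_on (Suc 0) B0 (\<lambda>x. RR x v)"
    by (rule Cn_on_LR(2)[OF _ Cn_on_ident Cn_on_const]) auto
  then have RRd: "((\<lambda>x. RR x v) has_derivative fd (\<lambda>x. RR x v) 0) (at 0)"
    by (rule Cn_on_Suc_derivative) simp
  have "fd (\<lambda>x. LL x v) 0 h + fd N 0 h = fd (\<lambda>x. RR x v) 0 h" for h
    using fd_unique_on[OF open_B(3) zero_in_B(3) LN LNd RRd] .
  \<comment> \<open>Both sides are the mixed second derivative of \<open>m\<close> at the origin
    with \<open>v\<close> in the left and \<open>h\<close> in the right factor, taken in opposite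
    orders.\<close>
  moreover have "fd (\<lambda>x. RR x v) 0 h = fd (\<lambda>x. LL x h) 0 v" for h
  proof -
    have D: "((\<lambda>p. fd m p u) has_derivative fd (\<lambda>p. fd m p u) (0, 0)) (at (0, 0))" for u
      using Cn_on_Suc_derivative[of 0 "B0 \<times> B0" "\<lambda>p. fd m p u" "(0, 0)"] smooth_on_B(1)[of "Suc (Suc 0)"]
      unfolding Cn_on.simps(2)[of "Suc 0"] by simp
    have "fd (\<lambda>x. RR x v) 0 h = fd (\<lambda>p. fd m p (v, 0)) (0, 0) (0, h)"
      unfolding RR_def d1_def
      by (rule fd_compose[where f="\<lambda>x. (0::'e, x)" and g="\<lambda>p. fd m p (v, 0)", OF _ D]) (auto intro!: derivative_eq_intros)
    also have "\<dots> = fd (\<lambda>p. fd m p (0, h)) (0, 0) (v, 0)"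
      by (rule symmetric_fd[OF open_BB _ smooth_on_B(1)]) simp
    also have "\<dots> = fd (\<lambda>x. LL x h) 0 v"
      unfolding LL_def d2_def
      by (rule fd_compose[where f="\<lambda>x. (x, 0::'e)" and g="\<lambda>p. fd m p (0, h)", symmetric, OF _ D]) (auto intro!: derivative_eq_intros)
    finally show ?thesis .
  qed
  ultimately have "fd N 0 h = - beta h v" for h
    by (simp add: beta_def algebra_simps)
  then have "fd N 0 = (\<lambda>h. - beta h v)" by blast
  then show ?thesis using N by (simp add: N_def)
qed

end

section \<open>Contact fields in a local Lie group\<close>

lemma Baire_interior_nonempty:
  fixes C :: "nat \<Rightarrow> 'a::complete_space set"
  assumes "\<And>k. closed (C k)" "(\<Union>k. C k) = UNIV"
  shows "\<exists>k. interior (C k) \<noteq> {}"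
proof (rule ccontr)
  assume "\<not> ?thesis"
  then have "Met_TC.mtopology interior_of \<Union>(range C) = {}"
    using assms(1) complete_UNIV
    by (intro Met_TC.metric_Baire_category_alt) auto
  then show False using assms(2) by simp
qed

text \<open>Bounded sequences are represented by the values of bounded continuous functions at the natural
  numbers, since \<open>real \<Rightarrow>\<^sub>C real\<close> is complete.\<close>

lemma series_in_span_uniform:
  fixes T :: "nat \<Rightarrow> 'x \<Rightarrow> 'v::banach" and Y :: "'i \<Rightarrow> 'x \<Rightarrow> 'v"
  assumes I: "finite I"
    and bd: "\<And>n k y. y \<in> N k \<Longrightarrow> norm (T n y) \<le> (1/2) ^ n"
    and span: "\<And>a :: real \<Rightarrow>\<^sub>C real. \<exists>k::nat. spanned_on I Y (N k) (\<lambda>y. \<Sum>n. a (real n) *\<^sub>R T n y)"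
  shows "\<exists>k. \<forall>n. spanned_on I Y (N k) (T n)"
proof -
  define F where "F = (\<lambda>(a :: real \<Rightarrow>\<^sub>C real) y. \<Sum>n. a (real n) *\<^sub>R T n y)"
  \<comment> \<open>The coefficient sequences whose series expands in \<open>Y\<close> on
    \<open>N k\<close>. By \<open>span\<close> these sets cover the space, and each is closed
    because a finite span is closed under pointwise limits.\<close>
  define C where "C = (\<lambda>k. {a. spanned_on I Y (N k) (F a)})"
  have nb: "norm (a (real n) *\<^sub>R T n y) \<le> norm a * (1/2) ^ n" if "y \<in> N k" for a :: "real \<Rightarrow>\<^sub>C real" and n k y
    using norm_bounded[of a "real n"] bd[OF that, of n] by (auto intro!: mult_mono)
  have sumb: "summable (\<lambda>n. norm a * (1/2) ^ n)" for a :: "real \<Rightarrow>\<^sub>C real"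
    by (intro summable_mult summable_geometric) simp
  have summ: "summable (\<lambda>n. a (real n) *\<^sub>R T n y)" if "y \<in> N k" for a :: "real \<Rightarrow>\<^sub>C real" and k y
    by (rule summable_comparison_test'[OF sumb nb[OF that]])
  have F_diff: "F a y - F b y = F (a - b) y" if "y \<in> N k" for a b k y
    unfolding F_def using suminf_diff[OF summ[OF that, of a] summ[OF that, of b]]
    by (simp add: scaleR_diff_left)
  have F_norm: "norm (F a y) \<le> norm a * 2" if "y \<in> N k" for a k y
  proof -
    have sn: "summable (\<lambda>n. norm (a (real n) *\<^sub>R T n y))"
      using nb[OF that, of a] by (intro summable_comparison_test'[OF sumb[of a], where N=0]) simp
    have "norm (F a y) \<le> (\<Sum>n. norm (a (real n) *\<^sub>R T n y))"
      unfolding F_def by (rule summable_norm[OF sn])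
    also have "\<dots> \<le> (\<Sum>n. norm a * (1/2) ^ n)"
      by (rule suminf_le[OF nb[OF that] sn sumb])
    also have "\<dots> = norm a * 2"
      by (simp add: suminf_mult suminf_geometric)
    finally show ?thesis .
  qed
  have "closed (C k)" for k
    unfolding closed_sequential_limits
  proof (intro allI impI, elim conjE)
    fix x l assume x: "\<forall>n. x n \<in> C k" and l: "x \<longlonglongrightarrow> l"
    have "spanned_on I Y (N k) (F l)"
    proof (rule pointwise_limit_in_span[OF I, of "spanned_on I Y (N k)" "N k" Y "\<lambda>n. F (x n)"])
      show "(\<lambda>n. F (x n) y) \<longlonglongrightarrow> F l y" if y: "y \<in> N k" for y
      proof (rule LIM_zero_cancel, rule Lim_null_comparison)
        show "\<forall>\<^sub>F n in sequentially. norm (F (x n) y - F l y) \<le> norm (x n - l) * 2"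
          using F_diff[OF y] F_norm[OF y] by simp
      next
        show "(\<lambda>n. norm (x n - l) * 2) \<longlonglongrightarrow> 0"
          using tendsto_mult_left_zero[OF tendsto_norm_zero[OF LIM_zero[OF l]]] by simp
      qed
      show "spanned_on I Y (N k) (F (x n))" for n using x by (simp add: C_def)
    qed (erule (1) spanned_on_lincomb, erule spanned_on_cong, blast)
    then show "l \<in> C k" by (simp add: C_def)
  qed
  moreover have "a \<in> (\<Union>k. C k)" for a
    using span[of a] by (simp add: C_def F_def)
  then have "(\<Union>k. C k) = UNIV" by blast
  ultimately obtain k where "interior (C k) \<noteq> {}"
    using Baire_interior_nonempty[of C] by auto
  then obtain a where "a \<in> interior (C k)" by blast
  then obtain e where e: "e > 0" and ball: "ball a e \<subseteq> C k"
    unfolding mem_interior by blast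
  have "spanned_on I Y (N k) (T n)" for n
  proof -
    \<comment> \<open>A tent of height one at \<open>n\<close> that vanishes at the other naturals:
      as a coefficient sequence it selects \<open>T n\<close>. Moving from \<open>a\<close> by a
      multiple of \<open>u\<close> inside the ball changes the series by a multiple of
      \<open>T n\<close>.\<close>
    define u :: "real \<Rightarrow>\<^sub>C real" where "u = Bcontfun (\<lambda>x. max 0 (1 - \<bar>x - real n\<bar>))"
    have u': "apply_bcontfun u = (\<lambda>x. max 0 (1 - \<bar>x - real n\<bar>))"
      unfolding u_def
      by (rule Bcontfun_inverse, rule bcontfun_normI[where b=1]) (auto intro!: continuous_intros)
    have u: "apply_bcontfun u (real j) = (if j = n then 1 else 0)" for j
    proof (cases "j = n")
      case False
      then have "1 \<le> \<bar>real j - real n\<bar>" by linarith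
      then show ?thesis using False by (simp add: u')
    qed (simp add: u')
    have "norm u \<le> 1" by (rule norm_bound) (simp add: u')
    then have "a + (e/2) *\<^sub>R u \<in> ball a e" using e by (simp add: dist_norm)
    then have "a + (e/2) *\<^sub>R u \<in> C k" "a \<in> C k" using ball e by auto
    then have s: "spanned_on I Y (N k) (F (a + (e/2) *\<^sub>R u))" "spanned_on I Y (N k) (F a)" by (auto simp: C_def)
    have "F (a + (e/2) *\<^sub>R u) y - F a y = (e/2) *\<^sub>R T n y" if "y \<in> N k" for y
    proof -
      have "F (a + (e/2) *\<^sub>R u) y - F a y = (\<Sum>j. (if j = n then (e/2) *\<^sub>R T n y else 0))"
        unfolding F_diff[OF that] by (auto simp: F_def u intro!: suminf_cong)
      then show ?thesis by (simp add: suminf_split_head sums_unique[OF sums_single[of n "\<lambda>_. (e/2) *\<^sub>R T n y"], symmetric])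
    qed
    then have "(2/e) *\<^sub>R F (a + (e/2) *\<^sub>R u) y + (- (2/e)) *\<^sub>R F a y = T n y" if "y \<in> N k" for y
      using e that by (simp add: scaleR_diff_right[symmetric])
    then show ?thesis
      by (rule spanned_on_cong[OF spanned_on_lincomb[OF s, of "2/e" "- (2/e)"]])
  qed
  then show ?thesis by blast
qed

lemma C1_derivative: "Cn_on 1 S f \<Longrightarrow> x \<in> S \<Longrightarrow> (f has_derivative fd f x) (at x)"
  using Cn_on_Suc_derivative[of 0] by simp

lemma C1_linear: "Cn_on 1 S f \<Longrightarrow> x \<in> S \<Longrightarrow> linear (fd f x)"
  using C1_derivative has_derivative_linear by blast

lemma C1_fd_continuous_on: "Cn_on 1 S f \<Longrightarrow> continuous_on S (\<lambda>x. fd f x v)"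
  using Cn_on.simps by (metis One_nat_def)

lemma fd_lincomb:
  assumes "Cn_on 1 S f" "Cn_on 1 S g" "x \<in> S"
  shows "fd (\<lambda>x. a *\<^sub>R f x + b *\<^sub>R g x) x v = a *\<^sub>R fd f x v + b *\<^sub>R fd g x v"
  using fd_eqI[OF has_derivative_add[OF
        has_derivative_scaleR_right[OF C1_derivative[OF assms(1,3)], of a]
        has_derivative_scaleR_right[OF C1_derivative[OF assms(2,3)], of b]]]
  by simp

locale contact_structure = local_lie m iv R
  for m :: "'e::euclidean_space \<times> 'e \<Rightarrow> 'e" and iv R +
  fixes pr :: "'e \<Rightarrow> 'e"
  assumes linear_pr: "linear pr"
begin

lemma tendsto_pr: "(f \<longlongrightarrow> l) F \<Longrightarrow> ((\<lambda>x. pr (f x)) \<longlongrightarrow> pr l) F"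
  using bounded_linear.tendsto[OF linear_conv_bounded_linear[THEN iffD1, OF linear_pr]] .

lemma tendsto_beta: "(f \<longlongrightarrow> l) F \<Longrightarrow> ((\<lambda>x. beta (f x) b) \<longlongrightarrow> beta l b) F"
  using bounded_linear.tendsto[OF linear_conv_bounded_linear[THEN iffD1, OF linear_beta]] .

text \<open>The horizontal space at the identity is the kernel of \<open>pr\<close>. The function \<open>z\<close> stands for the field \<open>y \<mapsto> LL y (z y)\<close>; the condition says that its bracket
  with the left-invariant field of \<open>v\<close> is horizontal.\<close>

definition contact_on :: "'e set \<Rightarrow> ('e \<Rightarrow> 'e) \<Rightarrow> bool" where
  "contact_on N z \<longleftrightarrow> Cn_on 1 N z \<and>
     (\<forall>y\<in>N. \<forall>v. pr v = 0 \<longrightarrow> pr (fd z y (LL y v)) = pr (beta (z y) v))"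

lemma contact_onD:
  assumes "contact_on N z"
  shows "Cn_on 1 N z" "y \<in> N \<Longrightarrow> pr v = 0 \<Longrightarrow> pr (fd z y (LL y v)) = pr (beta (z y) v)"
  using assms by (auto simp: contact_on_def)

lemma contact_on_subset: "contact_on N z \<Longrightarrow> N' \<subseteq> N \<Longrightarrow> contact_on N' z"
  by (auto simp: contact_on_def intro: Cn_on_subset)

lemma contact_on_cong:
  assumes "contact_on N z" "open N" "\<And>y. y \<in> N \<Longrightarrow> z y = z' y"
  shows "contact_on N z'"
  using assms Cn_on_cong[of 1 N z z'] fd_cong_open[of N _ z z'] unfolding contact_on_def by metis

lemma contact_on_lincomb:
  assumes "open N" "contact_on N z" "contact_on N z'"
  shows "contact_on N (\<lambda>y. a *\<^sub>R z y + b *\<^sub>R z' y)"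
  using assms unfolding contact_on_def
  by (auto intro!: Cn_on_add Cn_on_scaleR Cn_on_const simp: fd_lincomb linear_add[OF linear_pr] linear_cmul[OF linear_pr]
      linear_add[OF linear_beta] linear_cmul[OF linear_beta] simp del: One_nat_def)

lemma contact_on_sum:
  assumes "open N" "\<And>n. contact_on N (T n)"
  shows "contact_on N (\<lambda>y. \<Sum>n<k::nat. a n *\<^sub>R T n y)"
proof (induction k)
  case 0
  then show ?case
    using contact_on_lincomb[OF assms(1) assms(2) assms(2), of 0 0 0 0] by simp
next
  case (Suc k)
  from contact_on_lincomb[OF assms(1) Suc assms(2)[of k], of 1 "a k"] show ?case by simp
qed

text \<open>Formulated with a defect that tends to zero, so that it serves both the partial sums of
  exact solutions and the averages of approximate ones.\<close>

lemma contact_limit: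
  assumes S: "open S" "convex S"
    and g: "\<And>n. Cn_on 1 S (g n)"
    and lim: "\<And>x. x \<in> S \<Longrightarrow> (\<lambda>n. g n x) \<longlonglongrightarrow> G x"
    and ul: "\<And>v. uniform_limit S (\<lambda>n x. fd (g n) x v) (\<lambda>x. A x v) sequentially"
    and defect: "\<And>y v. y \<in> S \<Longrightarrow> pr v = 0 \<Longrightarrow>
      (\<lambda>n. pr (fd (g n) y (LL y v)) - pr (beta (g n y) v)) \<longlonglongrightarrow> 0"
  shows "contact_on S G"
proof -
  have C1: "Cn_on 1 S G" "\<And>x v. x \<in> S \<Longrightarrow> fd G x v = A x v"
    by (rule C1_limit[OF S g lim ul], assumption+)+
  have "pr (fd G y (LL y v)) = pr (beta (G y) v)" if y: "y \<in> S" and v: "pr v = 0" for y v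
  proof -
    have "(\<lambda>n. pr (fd (g n) y (LL y v)) - pr (beta (g n y) v)) \<longlonglongrightarrow> pr (A y (LL y v)) - pr (beta (G y) v)"
      by (intro tendsto_diff tendsto_pr tendsto_beta lim[OF y] tendsto_uniform_limitI[OF ul y])
    then have "pr (A y (LL y v)) - pr (beta (G y) v) = 0"
      using defect[OF y v] LIMSEQ_unique by blast
    then show ?thesis using C1(2)[OF y] by simp
  qed
  then show ?thesis using C1(1) by (simp add: contact_on_def)
qed

text \<open>The factor \<open>K v\<close> separates the dependence on the direction, so one summable
  \<open>M\<close> drives Weierstrass's test for the values and for the derivatives in each fixed
  direction.\<close>

lemma contact_series:
  assumes S: "open S" "convex S"
    and T: "\<And>n. contact_on S (T n)"
    and bd: "\<And>n y. y \<in> S \<Longrightarrow> norm (T n y) \<le> M n"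
    and bd': "\<And>n y v. y \<in> S \<Longrightarrow> norm (fd (T n) y v) \<le> M n * K v"
    and M: "summable M" and a: "\<And>n. \<bar>a n\<bar> \<le> B"
  shows "contact_on S (\<lambda>y. \<Sum>n. a n *\<^sub>R T n y)"
proof (rule contact_limit[OF S, where g="\<lambda>k y. \<Sum>n<k. a n *\<^sub>R T n y" and A="\<lambda>y v. \<Sum>n. a n *\<^sub>R fd (T n) y v"])
  have B: "0 \<le> B" using a[of 0] by linarith
  note part = contact_on_sum[OF S(1) T, of a]
  show "Cn_on 1 S (\<lambda>y. \<Sum>n<k. a n *\<^sub>R T n y)" for k using contact_onD(1)[OF part] .
  have s: "summable (\<lambda>n. B * M n)" "summable (\<lambda>n. B * M n * K v)" for v
    using M by (auto intro: summable_mult summable_mult2)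
  have "norm (a n *\<^sub>R T n y) \<le> B * M n" if "y \<in> S" for n y
    using bd[OF that, of n] a[of n] B by (auto intro!: mult_mono)
  then have ul: "uniform_limit S (\<lambda>k y. \<Sum>n<k. a n *\<^sub>R T n y) (\<lambda>y. \<Sum>n. a n *\<^sub>R T n y) sequentially"
    by (intro Weierstrass_m_test[OF _ s(1)])
  show "(\<lambda>k. \<Sum>n<k. a n *\<^sub>R T n y) \<longlonglongrightarrow> (\<Sum>n. a n *\<^sub>R T n y)" if "y \<in> S" for y
    by (rule tendsto_uniform_limitI[OF ul that])
  have fd: "fd (\<lambda>y. \<Sum>n<k. a n *\<^sub>R T n y) y v = (\<Sum>n<k. a n *\<^sub>R fd (T n) y v)" if "y \<in> S" for k y v
  proof -
    have "((\<lambda>y. \<Sum>n<k. a n *\<^sub>R T n y) has_derivative (\<lambda>v. \<Sum>n<k. a n *\<^sub>R fd (T n) y v)) (at y)"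
      by (intro has_derivative_sum has_derivative_scaleR_right C1_derivative[OF contact_onD(1)[OF T] that])
    from fd_eqI[OF this] show ?thesis by simp
  qed
  show "uniform_limit S (\<lambda>k y. fd (\<lambda>y. \<Sum>n<k. a n *\<^sub>R T n y) y v) (\<lambda>y. \<Sum>n. a n *\<^sub>R fd (T n) y v) sequentially" for v
  proof -
    have "norm (a n *\<^sub>R fd (T n) y v) \<le> B * M n * K v" if "y \<in> S" for n y
    proof -
      have "norm (a n *\<^sub>R fd (T n) y v) \<le> B * (M n * K v)"
        using bd'[OF that, of n v] a[of n] B by (auto intro!: mult_mono)
      then show ?thesis by (simp add: mult.assoc)
    qed
    then have "uniform_limit S (\<lambda>k y. \<Sum>n<k. a n *\<^sub>R fd (T n) y v) (\<lambda>y. \<Sum>n. a n *\<^sub>R fd (T n) y v) sequentially"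
      by (intro Weierstrass_m_test[OF _ s(2)])
    then show ?thesis
      by (rule uniform_limit_cong[THEN iffD1, rotated 2]) (auto simp: fd)
  qed
  show "(\<lambda>k. pr (fd (\<lambda>y. \<Sum>n<k. a n *\<^sub>R T n y) y (LL y v)) - pr (beta (\<Sum>n<k. a n *\<^sub>R T n y) v)) \<longlonglongrightarrow> 0"
    if "y \<in> S" "pr v = 0" for y v
    using contact_onD(2)[OF part that] by simp
qed

end

context contact_structure
begin

text \<open>The differential of the left translation carries \<open>LL y v\<close> to
  \<open>LL (m (a, y)) v\<close>, and the term with \<open>beta\<close> depends on the value of
  \<open>z\<close> alone.\<close>

lemma contact_on_translate:
  assumes "contact_on N z" "open N" "a \<in> B1" "open S" "S \<subseteq> B1" "\<And>y. y \<in> S \<Longrightarrow> m (a, y) \<in> N"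
  shows "contact_on S (\<lambda>y. z (m (a, y)))"
  unfolding contact_on_def
proof (intro conjI ballI allI impI)
  have "Cn_on 1 S (\<lambda>y. m (a, y))"
    using assms(3,5) B_mono(1) by (intro Cn_on_m assms Cn_on_const Cn_on_ident) auto
  then show "Cn_on 1 S (\<lambda>y. z (m (a, y)))"
    by (rule Cn_on_compose[OF assms(4) _ contact_onD(1)[OF assms(1)] assms(6)])
  fix y v assume y: "y \<in> S" and v: "pr v = 0"
  have yB: "y \<in> B1" "y \<in> B0" "a \<in> B0" using y assms(3,5) B_mono(1) by auto
  have "fd (\<lambda>y. z (m (a, y))) y (LL y v) = fd z (m (a, y)) (d2 a y (LL y v))"
    using fd_compose[OF m_has_derivative_right[OF has_derivative_ident yB(3,2)]
        C1_derivative[OF contact_onD(1)[OF assms(1)] assms(6)[OF y]]] by simp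
  then show "pr (fd (\<lambda>y. z (m (a, y))) y (LL y v)) = pr (beta (z (m (a, y))) v)"
    using contact_onD(2)[OF assms(1) assms(6)[OF y] v] LL_translate[OF assms(3) yB(1)] by simp
qed

end

section \<open>Consequences of rigidity\<close>

lemma difference_quotient_tendsto:
  fixes g :: "real \<Rightarrow> 'a::real_normed_vector"
  assumes g: "(g has_derivative g') (at 0)" and t: "t \<longlonglongrightarrow> 0" "\<And>n. t n \<noteq> 0"
  shows "(\<lambda>n. (1 / t n) *\<^sub>R (g (t n) - g 0)) \<longlonglongrightarrow> g' 1"
proof -
  have l: "linear g'" using has_derivative_linear[OF g] .
  have "((\<lambda>h. norm (g (0 + h) - g 0 - g' h) / norm h) \<longlongrightarrow> 0) (at 0)"
    using g unfolding has_derivative_at by blast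
  moreover have "filterlim t (at 0) sequentially"
    using t by (auto simp: filterlim_at)
  ultimately have *: "(\<lambda>n. norm (g (0 + t n) - g 0 - g' (t n)) / norm (t n)) \<longlonglongrightarrow> 0"
    by (rule filterlim_compose)
  have "norm ((1 / t n) *\<^sub>R (g (t n) - g 0) - g' 1) = norm (g (0 + t n) - g 0 - g' (t n)) / norm (t n)" for n
  proof -
    have "(1 / t n) *\<^sub>R (g (t n) - g 0) - g' 1 = (1 / t n) *\<^sub>R (g (t n) - g 0 - g' (t n))"
      using linear_cmul[OF l, of "t n" 1] t(2)[of n] by (simp add: scaleR_diff_right)
    then show ?thesis by simp
  qed
  then have "(\<lambda>n. norm ((1 / t n) *\<^sub>R (g (t n) - g 0) - g' 1)) \<longlonglongrightarrow> 0" using * by presburger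
  then have "(\<lambda>n. (1 / t n) *\<^sub>R (g (t n) - g 0) - g' 1) \<longlonglongrightarrow> 0" by (rule tendsto_norm_zero_cancel)
  then show ?thesis by (rule LIM_zero_cancel)
qed

text \<open>\<open>Psi\<close> lists spanning germs read in the left-invariant frame. The
  neighbourhood in \<open>rigid\<close> depends on \<open>z\<close>; removing this dependence along
  a sequence is the work of \<open>contact_pointwise_limit\<close>.\<close>

locale rigid_contact = contact_structure m iv R pr
  for m :: "'e::euclidean_space \<times> 'e \<Rightarrow> 'e" and iv R pr +
  fixes I :: "'i set" and Psi :: "'i \<Rightarrow> 'e \<Rightarrow> 'e"
  assumes finite_I: "finite I"
    and rigid: "\<lbrakk>open N; 0 \<in> N; contact_on N z\<rbrakk> \<Longrightarrow>
      \<exists>r. \<forall>\<^sub>F y in nhds 0. z y = (\<Sum>i\<in>I. r i *\<^sub>R Psi i y)"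
begin

proposition contact_pointwise_limit:
  assumes "0 < \<rho>" and T: "\<And>n. contact_on (ball 0 \<rho>) (T n)"
    and lim: "\<And>y. y \<in> ball 0 \<rho> \<Longrightarrow> (\<lambda>n. T n y) \<longlonglongrightarrow> G y"
  shows "\<exists>\<rho>'>0. \<rho>' \<le> \<rho> \<and> contact_on (ball 0 \<rho>') G"
proof -
  \<comment> \<open>Half the radius leaves a compact ball between \<open>S\<close> and the domain,
    on which each \<open>T n\<close> and its derivative are bounded.\<close>
  define S where "S = ball (0::'e) (\<rho>/2)"
  have S: "open S" "convex S" "0 \<in> S" "S \<subseteq> cball 0 (\<rho>/2)" "cball 0 (\<rho>/2) \<subseteq> ball (0::'e) \<rho>" "S \<subseteq> ball 0 \<rho>"
    using assms(1) by (auto simp: S_def)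
  have "\<exists>M\<ge>0. \<forall>y\<in>S. norm (T n y) \<le> M \<and> (\<forall>v. norm (fd (T n) y v) \<le> M * (\<Sum>b\<in>Basis. \<bar>v \<bullet> b\<bar>))" for n
  proof -
    have c: "continuous_on (cball 0 (\<rho>/2)) (T n)" "\<And>b. continuous_on (cball 0 (\<rho>/2)) (\<lambda>y. fd (T n) y b)"
      using Cn_on_continuous_on[OF contact_onD(1)[OF T]] C1_fd_continuous_on[OF contact_onD(1)[OF T]]
        continuous_on_subset S(5) by blast+
    have bdd: "\<exists>B\<ge>0. \<forall>y\<in>cball 0 (\<rho>/2). norm (f y) \<le> B" if "continuous_on (cball (0::'e) (\<rho>/2)) f"
      for f :: "'e \<Rightarrow> 'e"
      using compact_imp_bounded[OF compact_continuous_image[OF that compact_cball]]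
      by (metis (no_types, lifting) bounded_pos image_eqI less_imp_le)
    obtain M0 where M0: "M0 \<ge> 0" "\<And>y. y \<in> cball 0 (\<rho>/2) \<Longrightarrow> norm (T n y) \<le> M0"
      using bdd[OF c(1)] by blast
    have "\<exists>M1. \<forall>b. M1 b \<ge> 0 \<and> (\<forall>y\<in>cball 0 (\<rho>/2). norm (fd (T n) y b) \<le> M1 b)"
      by (intro choice allI) (use bdd[OF c(2)] in blast)
    then obtain M1 where M1: "\<And>b. M1 b \<ge> 0" "\<And>y b. y \<in> cball 0 (\<rho>/2) \<Longrightarrow> norm (fd (T n) y b) \<le> M1 b"
      by blast
    define M where "M = M0 + (\<Sum>b\<in>Basis. M1 b)"
    have Mb: "M1 b \<le> M" if "b \<in> Basis" for b
      using member_le_sum[OF that, of M1] M1(1) M0(1) by (simp add: M_def)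
    have "norm (T n y) \<le> M" if "y \<in> S" for y
      using M0(2)[of y] that S(4) sum_nonneg[of Basis M1] M1(1) unfolding M_def by fastforce
    moreover have "norm (fd (T n) y v) \<le> M * (\<Sum>b\<in>Basis. \<bar>v \<bullet> b\<bar>)" if y: "y \<in> S" for y v
    proof -
      have "linear (fd (T n) y)" using C1_linear[OF contact_onD(1)[OF T]] y S(6) by blast
      then have "norm (fd (T n) y v) = norm (\<Sum>b\<in>Basis. (v \<bullet> b) *\<^sub>R fd (T n) y b)"
        using linear_sum_Basis by metis
      also have "\<dots> \<le> (\<Sum>b\<in>(Basis::'e set). \<bar>v \<bullet> b\<bar> * M)"
      proof (rule sum_norm_le)
        fix b :: 'e assume b: "b \<in> Basis"
        have "norm (fd (T n) y b) \<le> M1 b" by (rule M1(2)) (use y S(4) in blast)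
        then have "norm (fd (T n) y b) \<le> M" using Mb[OF b] by linarith
        then show "norm ((v \<bullet> b) *\<^sub>R fd (T n) y b) \<le> \<bar>v \<bullet> b\<bar> * M" by (simp add: mult_left_mono)
      qed
      also have "\<dots> = M * (\<Sum>b\<in>Basis. \<bar>v \<bullet> b\<bar>)" by (simp add: sum_distrib_left mult.commute)
      finally show ?thesis .
    qed
    ultimately show ?thesis
      using M0(1) M1(1) by (intro exI[of _ M]) (auto simp: M_def sum_nonneg)
  qed
  then obtain M where M: "\<And>n. M n \<ge> 0" "\<And>n y. y \<in> S \<Longrightarrow> norm (T n y) \<le> M n"
    "\<And>n y v. y \<in> S \<Longrightarrow> norm (fd (T n) y v) \<le> M n * (\<Sum>b\<in>Basis. \<bar>v \<bullet> b\<bar>)"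
    by metis
  \<comment> \<open>This scaling makes the bounds for values and derivatives of the scaled
    \<open>T n\<close> summable, so that every bounded coefficient sequence yields a solution on
    \<open>S\<close>.\<close>
  define c where "c = (\<lambda>n. (1/2) ^ n / (1 + M n))"
  define T' where "T' = (\<lambda>n y. c n *\<^sub>R T n y)"
  have c: "c n > 0" "c n * M n \<le> (1/2) ^ n" for n
  proof -
    have "1 + M n > 0" using M(1)[of n] by linarith
    then show "c n > 0" by (simp add: c_def)
    have "M n / (1 + M n) \<le> 1" using M(1)[of n] by simp
    then have "(1/2) ^ n * (M n / (1 + M n)) \<le> (1/2) ^ n * 1" by (intro mult_left_mono) simp_all
    then show "c n * M n \<le> (1/2) ^ n" by (simp add: c_def)
  qed
  have T'_contact: "contact_on S (T' n)" for n
    using contact_on_lincomb[OF S(1) contact_on_subset[OF T[of n] S(6)] contact_on_subset[OF T[of n] S(6)], of "c n" 0]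
    by (simp add: T'_def)
  have bd: "norm (T' n y) \<le> (1/2) ^ n" if "y \<in> S" for n y
  proof -
    have "norm (T' n y) \<le> c n * M n" using c(1)[of n] M(2)[OF that, of n] by (simp add: T'_def)
    then show ?thesis using c(2) order_trans by blast
  qed
  have bd': "norm (fd (T' n) y v) \<le> (1/2) ^ n * (\<Sum>b\<in>Basis. \<bar>v \<bullet> b\<bar>)" if "y \<in> S" for n y v
  proof -
    have "fd (T' n) y v = c n *\<^sub>R fd (T n) y v"
      using fd_lincomb[OF contact_onD(1)[OF T[of n]] contact_onD(1)[OF T[of n]], of y "c n" 0 v] that S(6)
      by (auto simp: T'_def)
    then have "norm (fd (T' n) y v) \<le> c n * M n * (\<Sum>b\<in>Basis. \<bar>v \<bullet> b\<bar>)"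
      using c(1)[of n] M(3)[OF that, of n v] by (simp add: mult.assoc)
    also have "\<dots> \<le> (1/2) ^ n * (\<Sum>b\<in>Basis. \<bar>v \<bullet> b\<bar>)"
      using c(2)[of n] by (intro mult_right_mono) (auto intro: sum_nonneg)
    finally show ?thesis .
  qed
  define N where "N = (\<lambda>k::nat. ball (0::'e) (min (\<rho>/2) (1 / (real k + 1))))"
  have N: "N k \<subseteq> S" "open (N k)" for k by (auto simp: N_def S_def)
  have "\<exists>k. \<forall>n. spanned_on I Psi (N k) (T' n)"
  proof (rule series_in_span_uniform[OF finite_I])
    show "norm (T' n y) \<le> (1/2) ^ n" if "y \<in> N k" for n k y using bd that N by blast
    fix a :: "real \<Rightarrow>\<^sub>C real"
    have "contact_on S (\<lambda>y. \<Sum>n::nat. a (real n) *\<^sub>R T' n y)"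
      by (rule contact_series[OF S(1,2) T'_contact bd bd', where B="norm a" and a="\<lambda>n. a (real n)"])
        (use norm_bounded[of a] in \<open>auto intro: summable_geometric\<close>)
    from rigid[OF S(1,3) this] obtain r where
      "\<forall>\<^sub>F y in nhds 0. (\<Sum>n::nat. a (real n) *\<^sub>R T' n y) = (\<Sum>i\<in>I. r i *\<^sub>R Psi i y)" by blast
    then obtain d where d: "d > 0" "\<And>y. dist y 0 < d \<Longrightarrow> (\<Sum>n::nat. a (real n) *\<^sub>R T' n y) = (\<Sum>i\<in>I. r i *\<^sub>R Psi i y)"
      unfolding eventually_nhds_metric by blast
    obtain k :: nat where k: "1 / (real k + 1) < d"
      using d(1) reals_Archimedean[of d] by (auto simp: inverse_eq_divide add.commute)
    have "\<forall>y\<in>N k. (\<Sum>n::nat. a (real n) *\<^sub>R T' n y) = (\<Sum>i\<in>I. r i *\<^sub>R Psi i y)"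
      using d(2) k by (auto simp: N_def)
    then show "\<exists>k. spanned_on I Psi (N k) (\<lambda>y. \<Sum>n::nat. a (real n) *\<^sub>R T' n y)"
      unfolding spanned_on_def by blast
  qed
  then obtain k where k: "\<And>n. spanned_on I Psi (N k) (T' n)" by blast
  \<comment> \<open>Both conditions at once: the span provides the finite dimension, and the limit
    then inherits the contact equation as well.\<close>
  define sp where "sp = (\<lambda>f. contact_on (N k) f \<and> spanned_on I Psi (N k) f)"
  have sp_lin: "sp (\<lambda>x. a *\<^sub>R f x + b *\<^sub>R h x)" if "sp f" "sp h" for f h a b
    using that contact_on_lincomb[OF N(2)] spanned_on_lincomb unfolding sp_def by blast
  have sp_cong: "sp g" if "sp f" "\<And>y. y \<in> N k \<Longrightarrow> f y = g y" for f g
    using that contact_on_cong[OF _ N(2), of k f g] spanned_on_cong[of I Psi "N k" f g] unfolding sp_def by blast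
  have "sp G"
  proof (rule pointwise_limit_in_span[where P=sp and N="N k" and I=I and Y=Psi and g=T])
    show "finite I" by (rule finite_I)
    show "spanned_on I Psi (N k) f" if "sp f" for f
      using that by (simp add: sp_def)
    show "sp (T n)" for n
    proof -
      have "sp (T' n)" using k contact_on_subset[OF T'_contact N(1)] by (simp add: sp_def)
      from sp_lin[OF this this, of "1 / c n" 0] show ?thesis
        using c(1)[of n] by (simp add: T'_def)
    qed
    show "(\<lambda>n. T n y) \<longlonglongrightarrow> G y" if "y \<in> N k" for y
      using lim that N(1) S(6) by blast
  qed (fact sp_lin, fact sp_cong)
  then show ?thesis
    using assms(1) unfolding sp_def N_def by (intro exI[of _ "min (\<rho>/2) (1 / (real k + 1))"]) auto
qed


text \<open>Difference quotients of \<open>z\<close> along left translations by small multiples of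
  \<open>v\<close> are solutions, and such translations move \<open>y\<close> to first order along
  the right-invariant field of \<open>v\<close>. As \<open>z\<close> is only C^1, pointwise
  convergence is what is at hand, and \<open>contact_pointwise_limit\<close> accepts it.\<close>

lemma contact_right_invariant_derivative:
  assumes "0 < \<rho>" and z: "contact_on (ball 0 \<rho>) z"
  shows "\<exists>\<rho>'>0. \<rho>' \<le> \<rho> \<and> contact_on (ball 0 \<rho>') (\<lambda>y. fd z y (RR y v))"
proof -
  define \<rho>0 where "\<rho>0 = min \<rho> (rad (rad R))"
  define r where "r = rad \<rho>0"
  have \<rho>0: "0 < \<rho>0" "ball 0 \<rho>0 \<subseteq> B2" "ball 0 \<rho>0 \<subseteq> ball (0::'e) \<rho>"
    using assms(1) rad_pos by (auto simp: \<rho>0_def B2_def)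
  have r: "0 < r" "r \<le> \<rho>0" "\<And>u v. u \<in> ball 0 r \<Longrightarrow> v \<in> ball 0 r \<Longrightarrow> m (u, v) \<in> ball 0 \<rho>0"
    unfolding r_def using rad[OF \<rho>0(1)] by blast+
  have rB: "y \<in> B1" "y \<in> B0" "y \<in> ball 0 \<rho>" if "y \<in> ball 0 r" for y
  proof -
    have "y \<in> ball 0 \<rho>0" using that subset_ball[OF r(2)] by blast
    then show "y \<in> B1" "y \<in> B0" "y \<in> ball 0 \<rho>" using \<rho>0 B_mono(1,2) by blast+
  qed
  \<comment> \<open>Tends to infinity, while the offset keeps \<open>v\<close> divided by
    \<open>c n\<close> in the ball of radius \<open>r\<close> from \<open>n = 0\<close> on.\<close>
  define c where "c = (\<lambda>n. (norm v + 1) / r + real n)"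
  have c: "c n > 0" for n using r(1) by (simp add: c_def add_pos_nonneg add_nonneg_pos)
  have cv: "(1 / c n) *\<^sub>R v \<in> ball 0 r" for n
  proof -
    have "(norm v + 1) / r * r = norm v + 1" using r(1) by simp
    then have "c n * r = (norm v + 1) + real n * r" by (simp add: c_def ring_distribs(2))
    moreover have "0 \<le> real n * r" using r(1) by simp
    ultimately have "norm v < c n * r" by linarith
    then show ?thesis using c[of n] by (simp add: divide_less_eq mult.commute)
  qed
  define T where "T = (\<lambda>n y. c n *\<^sub>R z (m ((1 / c n) *\<^sub>R v, y)) + (- c n) *\<^sub>R z y)"
  have "\<exists>\<rho>'>0. \<rho>' \<le> r \<and> contact_on (ball 0 \<rho>') (\<lambda>y. fd z y (RR y v))"
  proof (rule contact_pointwise_limit[OF r(1)])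
    show "contact_on (ball 0 r) (T n)" for n
      unfolding T_def
    proof (rule contact_on_lincomb)
      show "contact_on (ball 0 r) (\<lambda>y. z (m ((1 / c n) *\<^sub>R v, y)))"
        using r(3)[OF cv] \<rho>0(3) rB(1) cv by (intro contact_on_translate[OF z]) blast+
      show "contact_on (ball 0 r) z"
        using r(2) \<rho>0(3) by (intro contact_on_subset[OF z]) auto
    qed simp
    fix y :: 'e assume y: "y \<in> ball 0 r"
    have "((\<lambda>t. m (t *\<^sub>R v, y)) has_derivative (\<lambda>h. d1 (0 *\<^sub>R v) y (h *\<^sub>R v))) (at 0)"
      using rB(2)[OF y] by (intro m_has_derivative_left) (auto intro!: derivative_eq_intros)
    then have m: "((\<lambda>t. m (t *\<^sub>R v, y)) has_derivative (\<lambda>h. d1 0 y (h *\<^sub>R v))) (at 0)" by simp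
    have "m (0 *\<^sub>R v, y) = y" using rB(2)[OF y] by (simp add: group_laws)
    then have "(z has_derivative fd z y) (at (m (0 *\<^sub>R v, y)))"
      using C1_derivative[OF contact_onD(1)[OF z] rB(3)[OF y]] by simp
    from has_derivative_compose[OF m this]
    have "((\<lambda>t. z (m (t *\<^sub>R v, y))) has_derivative (\<lambda>h. fd z y (d1 0 y (h *\<^sub>R v)))) (at 0)" .
    moreover have "filterlim c at_top sequentially"
      unfolding c_def by (rule filterlim_tendsto_add_at_top[OF tendsto_const filterlim_real_sequentially])
    then have "(\<lambda>n. 1 / c n) \<longlonglongrightarrow> 0"
      using tendsto_inverse_0_at_top[of c sequentially] by (simp add: inverse_eq_divide)
    ultimately have "(\<lambda>n. (1 / (1 / c n)) *\<^sub>R (z (m ((1 / c n) *\<^sub>R v, y)) - z (m (0 *\<^sub>R v, y)))) \<longlonglongrightarrow> fd z y (d1 0 y (1 *\<^sub>R v))"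
      using c by (intro difference_quotient_tendsto) (auto simp: less_imp_neq[symmetric])
    then show "(\<lambda>n. T n y) \<longlonglongrightarrow> fd z y (RR y v)"
      using \<open>m (0 *\<^sub>R v, y) = y\<close> by (simp add: T_def RR_def scaleR_diff_right)
  qed
  then show ?thesis using r(2) by (auto simp: \<rho>0_def intro: order_trans)
qed

text \<open>The induction hypothesis is applied to the right-invariant derivatives of
  \<open>z\<close>, which are solutions again. They determine \<open>fd z\<close>, since
  \<open>IR\<close> writes every direction in the right-invariant frame. The radius may shrink with
  \<open>k\<close>.\<close>

proposition contact_smooth:
  assumes "0 < \<rho>" "contact_on (ball 0 \<rho>) z"
  shows "\<exists>\<rho>'>0. \<rho>' \<le> \<rho> \<and> Cn_on k (ball 0 \<rho>') z"
  using assms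
proof (induction k arbitrary: z \<rho>)
  case 0
  then show ?case using Cn_on_le[OF contact_onD(1)] by blast
next
  case (Suc k)
  have "\<exists>r>0. r \<le> \<rho> \<and> Cn_on k (ball 0 r) (\<lambda>y. fd z y (RR y b))" for b
  proof -
    obtain r1 where "r1 > 0" "r1 \<le> \<rho>" "contact_on (ball 0 r1) (\<lambda>y. fd z y (RR y b))"
      using contact_right_invariant_derivative[OF Suc.prems, of b] by blast
    moreover from this(1,3) obtain r2 where "r2 > 0" "r2 \<le> r1" "Cn_on k (ball 0 r2) (\<lambda>y. fd z y (RR y b))"
      using Suc.IH by blast
    ultimately show ?thesis by (intro exI[of _ r2]) simp
  qed
  then have "\<exists>r. \<forall>b. r b > 0 \<and> r b \<le> \<rho> \<and> Cn_on k (ball 0 (r b)) (\<lambda>y. fd z y (RR y b))"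
    by (intro choice) blast
  then obtain r where r: "\<And>b. r b > 0" "\<And>b. r b \<le> \<rho>"
    "\<And>b. Cn_on k (ball 0 (r b)) (\<lambda>y. fd z y (RR y b))" by blast
  define \<rho>' where "\<rho>' = Min (insert (rad (rad R)) (r ` (Basis::'e set)))"
  have \<rho>': "\<rho>' > 0" "\<rho>' \<le> rad (rad R)"
    using r(1) rad_pos by (auto simp: \<rho>'_def)
  have \<rho>'_le: "\<rho>' \<le> r b" if "b \<in> Basis" for b
    unfolding \<rho>'_def by (rule Min_le) (use that in auto)
  have "\<rho>' \<le> \<rho>"
    using \<rho>'_le[OF SOME_Basis] r(2) order_trans by blast
  define S where "S = ball (0::'e) \<rho>'"
  have S: "open S" "S \<subseteq> B2" "S \<subseteq> ball 0 \<rho>" "\<And>b. b \<in> Basis \<Longrightarrow> S \<subseteq> ball 0 (r b)"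
    using \<rho>' \<rho>'_le \<open>\<rho>' \<le> \<rho>\<close> by (simp_all add: S_def B2_def subset_ball)
  have z: "Cn_on 1 S z" using Cn_on_subset[OF contact_onD(1)[OF Suc.prems(2)] S(3)] .
  have "Cn_on (Suc k) S z"
  proof (rule Cn_on_SucI[OF S(1)])
    show "(z has_derivative (\<lambda>w. \<Sum>b\<in>Basis. (IR y w \<bullet> b) *\<^sub>R fd z y (RR y b))) (at y)" if y: "y \<in> S" for y
    proof -
      have yB: "y \<in> B2" "y \<in> B1" "y \<in> B0" using y S(2) B_mono by auto
      have "fd z y w = (\<Sum>b\<in>Basis. (IR y w \<bullet> b) *\<^sub>R fd z y (RR y b))" for w
      proof -
        have "linear (\<lambda>v. fd z y (RR y v))"
          using linear_compose[OF linear_LR(2)[OF yB(3)] C1_linear[OF z y]] by (simp add: comp_def)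
        from linear_sum_Basis[OF this, of "IR y w"] show ?thesis using RR_IR[OF yB(1)] by simp
      qed
      then show ?thesis by (intro has_derivative_eq_rhs[OF C1_derivative[OF z y]] ext)
    qed
    show "Cn_on k S (\<lambda>y. \<Sum>b\<in>Basis. (IR y w \<bullet> b) *\<^sub>R fd z y (RR y b))" for w
    proof (intro Cn_on_sum Cn_on_scaleR Cn_on_inner_left S(1))
      show "Cn_on k S (\<lambda>y. IR y w)"
        using S(2) B_mono(2) by (intro Cn_on_LR(4)[OF S(1) Cn_on_ident[OF S(1)] Cn_on_const]) auto
      show "Cn_on k S (\<lambda>y. fd z y (RR y b))" if "b \<in> Basis" for b
        using Cn_on_subset[OF r(3) S(4)[OF that]] .
    qed
  qed
  then show ?case using \<rho>'(1) \<open>\<rho>' \<le> \<rho>\<close> unfolding S_def by blast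
qed

end

section \<open>Mollification along left translations\<close>

text \<open>One estimate for three uses: convergence of the averages, of their derivatives (weight
  \<open>kern\<close>) and of their defects.\<close>

lemma weighted_integral_uniform_limit:
  fixes V :: "nat \<Rightarrow> 'e::euclidean_space \<Rightarrow> 'c::euclidean_space" and k :: "'x \<Rightarrow> 'q::euclidean_space \<Rightarrow> real"
  assumes k: "\<And>x. x \<in> S \<Longrightarrow> continuous_on (cbox a b) (k x)"
      "\<And>x u. x \<in> S \<Longrightarrow> u \<in> cbox a b \<Longrightarrow> \<bar>k x u\<bar> \<le> K"
    and p: "\<And>x. x \<in> S \<Longrightarrow> continuous_on (cbox a b) (p x)" "\<And>x u. x \<in> S \<Longrightarrow> u \<in> cbox a b \<Longrightarrow> p x u \<in> N"
    and V: "\<And>n. continuous_on N (V n)" "uniform_limit N V W sequentially"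
  shows "uniform_limit S (\<lambda>n x. integral (cbox a b) (\<lambda>u. k x u *\<^sub>R V n (p x u)))
    (\<lambda>x. integral (cbox a b) (\<lambda>u. k x u *\<^sub>R W (p x u))) sequentially"
proof (rule uniform_limitI)
  fix e :: real assume e: "e > 0"
  have W: "continuous_on N W" using uniform_limit_theorem[OF _ V(2)] V(1) by simp
  define C where "C = measure lborel (cbox a b)"
  define d where "d = e / (\<bar>K\<bar> * C + 1)"
  have C: "C \<ge> 0" by (simp add: C_def)
  have pos: "\<bar>K\<bar> * C + 1 > 0" using C by (simp add: add_nonneg_pos)
  have d: "d > 0" using e pos by (simp add: d_def)
  show "\<forall>\<^sub>F n in sequentially. \<forall>x\<in>S. dist (integral (cbox a b) (\<lambda>u. k x u *\<^sub>R V n (p x u)))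
      (integral (cbox a b) (\<lambda>u. k x u *\<^sub>R W (p x u))) < e"
    using uniform_limitD[OF V(2) d]
  proof eventually_elim
    case (elim n)
    show ?case
    proof
      fix x assume x: "x \<in> S"
      have c: "continuous_on (cbox a b) (\<lambda>u. k x u *\<^sub>R V n (p x u))"
        "continuous_on (cbox a b) (\<lambda>u. k x u *\<^sub>R W (p x u))"
        using k(1)[OF x] p(1)[OF x] p(2)[OF x]
        by (auto intro!: continuous_intros continuous_on_compose2[OF V(1)] continuous_on_compose2[OF W])
      have "norm (integral (cbox a b) (\<lambda>u. k x u *\<^sub>R V n (p x u) - k x u *\<^sub>R W (p x u)))
          \<le> integral (cbox a b) (\<lambda>u. \<bar>K\<bar> * d)"
      proof (rule integral_norm_bound_integral)
        show "(\<lambda>u. k x u *\<^sub>R V n (p x u) - k x u *\<^sub>R W (p x u)) integrable_on cbox a b"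
          by (intro integrable_continuous continuous_on_diff c)
        fix u assume u: "u \<in> cbox a b"
        have "norm (V n (p x u) - W (p x u)) \<le> d" "\<bar>k x u\<bar> \<le> \<bar>K\<bar>"
          using elim p(2)[OF x u] k(2)[OF x u] by (auto simp: dist_norm less_imp_le)
        then have "\<bar>k x u\<bar> * norm (V n (p x u) - W (p x u)) \<le> \<bar>K\<bar> * d" by (intro mult_mono) auto
        then show "norm (k x u *\<^sub>R V n (p x u) - k x u *\<^sub>R W (p x u)) \<le> \<bar>K\<bar> * d"
          by (simp add: scaleR_diff_right[symmetric])
      qed auto
      also have "\<dots> = d * (\<bar>K\<bar> * C)" by (simp add: C_def)
      also have "\<dots> < d * (\<bar>K\<bar> * C + 1)" using d by simp
      also have "\<dots> = e" using pos by (simp add: d_def)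
      finally show "dist (integral (cbox a b) (\<lambda>u. k x u *\<^sub>R V n (p x u)))
          (integral (cbox a b) (\<lambda>u. k x u *\<^sub>R W (p x u))) < e"
        using c by (simp add: dist_norm integral_diff integrable_continuous)
    qed
  qed
qed

lemma Cn_on_0: "Cn_on 0 S f \<longleftrightarrow> continuous_on S f"
  by (simp add: Cn_on.simps)

context local_lie
begin

text \<open>Moving \<open>x\<close> in direction \<open>\<xi>\<close> changes \<open>m (u, x)\<close> in the same way as moving \<open>u\<close> in direction
  \<open>shift \<xi> (u, x)\<close>; this turns derivatives in \<open>x\<close> into derivatives in the variable of integration.\<close>

definition shift :: "'e \<Rightarrow> 'e \<times> 'e \<Rightarrow> 'e" where
  "shift \<xi> p = - d2 (m p) (iv (snd p)) (fd iv (snd p) \<xi>)"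

lemma d1_shift:
  assumes "u \<in> B2" "x \<in> B2"
  shows "d1 u x (shift \<xi> (u, x)) = d2 u x \<xi>"
proof -
  have B: "u \<in> B0" "x \<in> B0" "iv x \<in> B0" "m (u, x) \<in> B0" "m (u, x) \<in> B1" "iv x \<in> B1" "u \<in> B1" "x \<in> B1"
    using assms B_mono B_m B_iv by auto
  have ux: "m (m (u, x), iv x) = u"
    using group_laws(3)[of u x "iv x"] B by (simp add: group_laws)
  \<comment> \<open>The expression \<open>m (m (m (u, x), iv x'), x')\<close> does not depend on
    \<open>x'\<close>, because the two occurrences cancel. Its derivative at \<open>x' = x\<close>
    is zero, which is the claim up to the sign in \<open>shift\<close>.\<close>
  have D: "((\<lambda>x'. m (m (m (u, x), iv x'), x')) has_derivative
      (\<lambda>\<xi>. d1 (m (m (u, x), iv x)) x (d2 (m (u, x)) (iv x) (fd iv x \<xi>)) + d2 (m (m (u, x), iv x)) x \<xi>)) (at x)"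
    using B by (intro m_has_derivative_pair m_has_derivative_right iv_has_derivative has_derivative_ident) (auto simp: ux)
  have eq: "m (m (m (u, x), iv x'), x') = m (u, x)" if "x' \<in> B2" for x'
  proof -
    have x': "x' \<in> B0" "iv x' \<in> B0" "iv x' \<in> B1" using that B_mono B_iv by auto
    then have "m (m (m (u, x), iv x'), x') = m (m (u, x), m (iv x', x'))"
      using B B_m(1) by (intro group_laws(3)) (auto simp: group_laws(4))
    then show ?thesis using x' B by (simp add: group_laws(1,4))
  qed
  have D0: "((\<lambda>x'. m (u, x)) has_derivative (\<lambda>\<xi>. 0)) (at x)" by simp
  have "d1 (m (m (u, x), iv x)) x (d2 (m (u, x)) (iv x) (fd iv x \<xi>)) + d2 (m (m (u, x), iv x)) x \<xi> = 0"
    using fd_unique_on[OF open_B(3) assms(2) eq D D0] .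
  then show ?thesis
    unfolding shift_def ux by (simp add: linear_neg[OF linear_d(1)[OF B(1,2)]] add_eq_0_iff)
qed

lemma open_B22: "open (B2 \<times> B2)" by (intro open_Times open_B)

lemma Cn_on_shift: "Cn_on n (B2 \<times> B2) (shift \<xi>)"
proof -
  have id: "Cn_on n (B2 \<times> B2) (\<lambda>p. p)" using Cn_on_ident[OF open_B22] .
  have "Cn_on n (B2 \<times> B2) (\<lambda>p. fd iv (snd p) \<xi>)"
    by (rule Cn_on_fd_compose[OF open_B22 smooth_on_B(2) Cn_on_snd[OF open_B22 id] Cn_on_const])
      (use B_mono in auto)
  moreover have "Cn_on n (B2 \<times> B2) m"
    by (rule Cn_on_subset[OF smooth_on_B(1)]) (use B_mono in auto)
  moreover have "Cn_on n (B2 \<times> B2) (\<lambda>p. iv (snd p))"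
    by (rule Cn_on_iv[OF open_B22 Cn_on_snd[OF open_B22 id]]) (use B_mono in auto)
  ultimately have "Cn_on n (B2 \<times> B2) (\<lambda>p. d2 (m p) (iv (snd p)) (fd iv (snd p) \<xi>))"
    by (intro Cn_on_d(2)[OF open_B22]) (use B_mono B_m B_iv in auto)
  then show ?thesis unfolding shift_def[abs_def] by (rule Cn_on_minus[OF open_B22])
qed

end

text \<open>Functions live on \<open>N\<close>, their averages on \<open>W\<close>, and products of
  two points of \<open>W\<close> lie in \<open>N\<close>. The weight \<open>b\<close> is supported
  in a ball strictly inside the cube of half-side \<open>c\<close>, so that integration by parts
  leaves no boundary term.\<close>

locale mollifier = contact_structure m iv R pr
  for m :: "'e::euclidean_space \<times> 'e \<Rightarrow> 'e" and iv R pr +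
  fixes N W :: "'e set" and b :: "'e \<Rightarrow> real" and s c r :: real
  assumes N: "open N" "N \<subseteq> B0"
    and W_eq: "W = ball 0 r" and W: "W \<subseteq> B2" "\<And>u x. u \<in> W \<Longrightarrow> x \<in> W \<Longrightarrow> m (u, x) \<in> N"
    and Q_W: "cbox (- (c *\<^sub>R One)) (c *\<^sub>R One) \<subseteq> W" and s_c: "0 < s" "s < c"
    and b_C1: "Cn_on 1 UNIV b" and b_supp: "\<And>u. s < norm u \<Longrightarrow> b u = 0"
begin

abbreviation "Q \<equiv> cbox (- (c *\<^sub>R One)) (c *\<^sub>R (One::'e))"

text \<open>The variable of integration is the left factor, so the integrand is built from left
  translates of \<open>w\<close>, and these solve the contact equation whenever \<open>w\<close>
  does.\<close>

definition moll :: "('e \<Rightarrow> 'e) \<Rightarrow> 'e \<Rightarrow> 'e" where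
  "moll w x = integral Q (\<lambda>u. b u *\<^sub>R w (m (u, x)))"

text \<open>The divergence in the first variable of the field \<open>b\<close> times
  \<open>shift \<xi>\<close>: the weight that integration by parts leaves on
  \<open>w\<close>.\<close>

definition kern :: "'e \<Rightarrow> 'e \<times> 'e \<Rightarrow> real" where
  "kern \<xi> p = (\<Sum>e\<in>Basis. fd b (fst p) e * (shift \<xi> p \<bullet> e) + b (fst p) * (fd (shift \<xi>) p (e, 0) \<bullet> e))"

lemma open_W: "open W" "open (W \<times> W)" and convex_W: "convex W"
  by (auto simp: W_eq intro: open_Times)

lemma W_B: "u \<in> W \<Longrightarrow> u \<in> B2" "u \<in> W \<Longrightarrow> u \<in> B1" "u \<in> W \<Longrightarrow> u \<in> B0"
  using W(1) B_mono by auto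

lemma WW_B: "W \<times> W \<subseteq> B2 \<times> B2" using W(1) by auto

lemma Cn_on_m_WW: "Cn_on n (W \<times> W) m"
  by (rule Cn_on_subset[OF smooth_on_B(1)]) (use W_B in auto)

lemma Cn_on_m_W:
  "x \<in> W \<Longrightarrow> Cn_on n W (\<lambda>u. m (u, x))" "u \<in> W \<Longrightarrow> Cn_on n W (\<lambda>x. m (u, x))"
  using W_B by (auto intro!: Cn_on_m Cn_on_ident Cn_on_const open_W)

lemma continuous_on_w: "Cn_on 1 N w \<Longrightarrow> x \<in> W \<Longrightarrow> continuous_on W (\<lambda>u. w (m (u, x)))"
  using Cn_on_continuous_on[OF Cn_on_compose[OF open_W(1) Cn_on_m_W(1)]] W(2) by blast

lemma continuous_on_kern: "continuous_on (W \<times> W) (kern \<xi>)"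
proof -
  have 1: "continuous_on (W \<times> W) (\<lambda>p. fd b (fst p) e)" for e
    using continuous_on_compose2[OF C1_fd_continuous_on[OF b_C1] continuous_on_fst[OF continuous_on_id]] by auto
  have 2: "continuous_on (W \<times> W) (\<lambda>p. b (fst p))"
    using continuous_on_compose2[OF Cn_on_continuous_on[OF b_C1] continuous_on_fst[OF continuous_on_id]] by auto
  have 3: "continuous_on (W \<times> W) (shift \<xi>)"
    using Cn_on_continuous_on[OF Cn_on_shift] WW_B continuous_on_subset by blast
  have 4: "continuous_on (W \<times> W) (\<lambda>p. fd (shift \<xi>) p v)" for v
    using C1_fd_continuous_on[OF Cn_on_shift] WW_B continuous_on_subset by blast
  show ?thesis unfolding kern_def[abs_def] by (intro continuous_intros 1 2 3 4)
qed

lemma moll_has_derivative: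
  assumes w: "Cn_on 1 N w" and x: "x \<in> W"
  shows "(moll w has_derivative (\<lambda>\<xi>. integral Q (\<lambda>u. b u *\<^sub>R fd w (m (u, x)) (d2 u x \<xi>)))) (at x)"
proof -
  define D where "D = (\<lambda>x u \<xi>. b u *\<^sub>R fd w (m (u, x)) (d2 u x \<xi>))"
  have der: "((\<lambda>x. b u *\<^sub>R w (m (u, x))) has_derivative D x u) (at x)" if "x \<in> W" "u \<in> W" for x u
    unfolding D_def
    using has_derivative_compose[OF m_has_derivative_right[OF has_derivative_ident] C1_derivative[OF w W(2)]] that W_B
    by (intro has_derivative_scaleR_right) simp
  have bl: "bounded_linear (D x u)" if "x \<in> W" "u \<in> W" for x u
    using der[OF that] has_derivative_bounded_linear by blast
  have app: "blinfun_apply (Blinfun (D x u)) = D x u" if "x \<in> W" "u \<in> W" for x u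
    using bounded_linear_Blinfun_apply[OF bl[OF that]] .
  have cont: "continuous_on (W \<times> W) (\<lambda>p. D (fst p) (snd p) \<xi>)" for \<xi>
  proof -
    have id: "Cn_on 0 (W \<times> W) (\<lambda>p. p)" using Cn_on_ident[OF open_W(2)] .
    have "Cn_on 0 (W \<times> W) (\<lambda>p. d2 (snd p) (fst p) \<xi>)"
      using W_B by (intro Cn_on_d(2) open_W Cn_on_fst Cn_on_snd id Cn_on_const) auto
    moreover have "Cn_on 0 (W \<times> W) (\<lambda>p. m (snd p, fst p))"
      using W_B by (intro Cn_on_m open_W Cn_on_fst Cn_on_snd id) auto
    ultimately have "Cn_on 0 (W \<times> W) (\<lambda>p. fd w (m (snd p, fst p)) (d2 (snd p) (fst p) \<xi>))"
      using w W(2) by (intro Cn_on_fd_compose[OF open_W(2)]) auto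
    moreover have "continuous_on (W \<times> W) (\<lambda>p. b (snd p))"
      using continuous_on_compose2[OF Cn_on_continuous_on[OF b_C1] continuous_on_snd[OF continuous_on_id]] by auto
    ultimately show ?thesis unfolding D_def Cn_on_0 by (intro continuous_intros)
  qed
  \<comment> \<open>\<open>leibniz_rule\<close> wants the derivative as a continuous map into the
    bounded linear operators; in finite dimension this is checked on each fixed vector, hence the
    detour through \<open>Blinfun\<close>.\<close>
  have leib: "((\<lambda>x. integral Q (\<lambda>u. b u *\<^sub>R w (m (u, x)))) has_derivative
      blinfun_apply (integral Q (\<lambda>u. Blinfun (D x u)))) (at x within W)"
  proof (rule leibniz_rule[OF _ _ _ x convex_W])
    show "((\<lambda>x. b u *\<^sub>R w (m (u, x))) has_derivative blinfun_apply (Blinfun (D y u))) (at y within W)"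
      if y: "y \<in> W" and u: "u \<in> Q" for y u
    proof -
      have "u \<in> W" using u Q_W by blast
      then show ?thesis using has_derivative_at_withinI[OF der[OF y]] app[OF y] by simp
    qed
    show "(\<lambda>u. b u *\<^sub>R w (m (u, y))) integrable_on Q" if "y \<in> W" for y
      using continuous_on_subset[OF continuous_on_w[OF w that] Q_W]
        continuous_on_subset[OF Cn_on_continuous_on[OF b_C1]]
      by (intro integrable_continuous continuous_on_scaleR) auto
    show "continuous_on (W \<times> Q) (\<lambda>(x, u). Blinfun (D x u))"
    proof (rule continuous_on_blinfun_componentwise)
      fix \<xi> :: 'e
      have "continuous_on (W \<times> Q) (\<lambda>p. D (fst p) (snd p) \<xi>)"
        by (rule continuous_on_subset[OF cont]) (use Q_W in auto)
      then show "continuous_on (W \<times> Q) (\<lambda>p. blinfun_apply (case p of (x, u) \<Rightarrow> Blinfun (D x u)) \<xi>)"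
        by (rule continuous_on_eq) (use app Q_W in auto)
    qed
  qed
  have app_int: "blinfun_apply (integral Q (\<lambda>u. Blinfun (D x u))) \<xi> = integral Q (\<lambda>u. D x u \<xi>)" for \<xi>
  proof -
    have cB: "continuous_on Q (\<lambda>u. Blinfun (D x u))"
    proof (rule continuous_on_blinfun_componentwise)
      fix \<xi> :: 'e
      have "continuous_on Q (\<lambda>u. D (fst (x, u)) (snd (x, u)) \<xi>)"
        using Q_W x by (intro continuous_on_compose2[OF cont] continuous_intros) auto
      then show "continuous_on Q (\<lambda>u. blinfun_apply (Blinfun (D x u)) \<xi>)"
        by (rule continuous_on_eq) (use app x Q_W in auto)
    qed
    have "blinfun_apply (integral Q (\<lambda>u. Blinfun (D x u))) \<xi> = integral Q (\<lambda>u. blinfun_apply (Blinfun (D x u)) \<xi>)"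
      by (rule blinfun_apply_integral[OF integrable_continuous[OF cB]])
    also have "\<dots> = integral Q (\<lambda>u. D x u \<xi>)"
      by (rule integral_cong) (use app x Q_W in auto)
    finally show ?thesis .
  qed
  have "((\<lambda>x. integral Q (\<lambda>u. b u *\<^sub>R w (m (u, x)))) has_derivative (\<lambda>\<xi>. integral Q (\<lambda>u. D x u \<xi>))) (at x within W)"
    by (rule has_derivative_eq_rhs[OF leib]) (simp add: app_int fun_eq_iff)
  then show ?thesis
    unfolding moll_def[abs_def] using at_within_open[OF x open_W(1)] by (simp add: D_def)
qed


text \<open>By \<open>d1_shift\<close> the integrand is \<open>b u\<close> times the derivative of
  \<open>w (m (u, x))\<close> in \<open>u\<close> along \<open>shift\<close>. Adding the term with
  \<open>kern\<close> completes it to the divergence of a compactly supported field, whose integral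
  is zero.\<close>

lemma moll_ibp:
  assumes w: "Cn_on 1 N w" and x: "x \<in> W"
  shows "integral Q (\<lambda>u. b u *\<^sub>R fd w (m (u, x)) (d2 u x \<xi>)) = - integral Q (\<lambda>u. kern \<xi> (u, x) *\<^sub>R w (m (u, x)))"
proof -
  define g where "g = (\<lambda>e u. (b u * (shift \<xi> (u, x) \<bullet> e)) *\<^sub>R w (m (u, x)))"
  have b1: "Cn_on 1 W b" using Cn_on_subset[OF b_C1] by blast
  have sh: "Cn_on 1 W (\<lambda>u. shift \<xi> (u, x))"
    using W_B(1) x
    by (intro Cn_on_compose[OF open_W(1) Cn_on_Pair[OF open_W(1) Cn_on_ident[OF open_W(1)] Cn_on_const] Cn_on_shift]) auto
  have wm: "Cn_on 1 W (\<lambda>u. w (m (u, x)))"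
    by (rule Cn_on_compose[OF open_W(1) Cn_on_m_W(1)[OF x] w]) (use W(2) x in blast)
  have g_W: "Cn_on 1 W (g e)" for e
    unfolding g_def by (intro Cn_on_scaleR Cn_on_mult Cn_on_inner_left open_W b1 sh wm)
  \<comment> \<open>Where the norm exceeds \<open>s\<close> the factor \<open>b\<close> makes
    \<open>g e\<close> vanish, whatever \<open>m\<close> and \<open>shift\<close> are there; the
    remaining points lie in the open set \<open>W\<close>. The two open sets cover the
    space.\<close>
  have g_UNIV: "Cn_on 1 UNIV (g e)" for e
  proof (rule Cn_on_open_cover)
    fix u :: 'e
    show "\<exists>T. open T \<and> u \<in> T \<and> Cn_on 1 (UNIV \<inter> T) (g e)"
    proof (cases "s < norm u")
      case True
      have o: "open {u::'e. s < norm u}" by (intro open_Collect_less continuous_intros)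
      have "Cn_on 1 {u::'e. s < norm u} (g e)"
        by (rule Cn_on_cong[OF Cn_on_const[of 1 _ 0] o]) (simp add: g_def b_supp)
      then show ?thesis using True o by (intro exI[of _ "{u. s < norm u}"]) simp
    next
      case False
      have "\<bar>u \<bullet> i\<bar> \<le> c" if "i \<in> Basis" for i
        using Basis_le_norm[OF that, of u] False s_c by linarith
      then have "u \<in> Q" by (auto simp: mem_box abs_le_iff) (metis minus_le_iff)
      then have "u \<in> W" using Q_W by blast
      then show ?thesis using g_W open_W(1) by (intro exI[of _ W]) simp
    qed
  qed
  have fd_g: "(\<Sum>e\<in>Basis. fd (g e) u e) = kern \<xi> (u, x) *\<^sub>R w (m (u, x)) + b u *\<^sub>R fd w (m (u, x)) (d2 u x \<xi>)"
    if u: "u \<in> W" for u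
  proof -
    have ux: "(u, x) \<in> B2 \<times> B2" "u \<in> B0" "x \<in> B0" "m (u, x) \<in> N" using u x W_B W(2) by auto
    let ?S = "shift \<xi> (u, x)"
    have "((\<lambda>u. (u, x)) has_derivative (\<lambda>h. (h, 0))) (at u)" by (auto intro!: derivative_eq_intros)
    from has_derivative_compose[OF this C1_derivative[OF Cn_on_shift ux(1)]]
    have dS: "((\<lambda>u. shift \<xi> (u, x)) has_derivative (\<lambda>h. fd (shift \<xi>) (u, x) (h, 0))) (at u)" .
    have dw: "((\<lambda>u. w (m (u, x))) has_derivative (\<lambda>h. fd w (m (u, x)) (d1 u x h))) (at u)"
      using has_derivative_compose[OF m_has_derivative_left[OF has_derivative_ident ux(2,3)] C1_derivative[OF w ux(4)]]
      by simp
    have "fd (g e) u e = (fd b u e * (?S \<bullet> e) + b u * (fd (shift \<xi>) (u, x) (e, 0) \<bullet> e)) *\<^sub>R w (m (u, x))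
        + b u *\<^sub>R ((?S \<bullet> e) *\<^sub>R fd w (m (u, x)) (d1 u x e))" for e
    proof -
      have "(g e has_derivative (\<lambda>h. (b u * (?S \<bullet> e)) *\<^sub>R fd w (m (u, x)) (d1 u x h) +
          (b u * (fd (shift \<xi>) (u, x) (h, 0) \<bullet> e) + fd b u h * (?S \<bullet> e)) *\<^sub>R w (m (u, x)))) (at u)"
        unfolding g_def
        by (intro has_derivative_scaleR has_derivative_mult has_derivative_inner_left dS dw C1_derivative[OF b_C1] UNIV_I)
      from fd_eqI[OF this] show ?thesis by (simp add: add.commute)
    qed
    then have "(\<Sum>e\<in>Basis. fd (g e) u e) = kern \<xi> (u, x) *\<^sub>R w (m (u, x)) +
        b u *\<^sub>R (\<Sum>e\<in>Basis. (?S \<bullet> e) *\<^sub>R fd w (m (u, x)) (d1 u x e))"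
      by (simp add: kern_def sum.distrib scaleR_sum_left scaleR_sum_right scaleR_add_left)
    also have "(\<Sum>e\<in>Basis. (?S \<bullet> e) *\<^sub>R fd w (m (u, x)) (d1 u x e)) = fd w (m (u, x)) (d1 u x ?S)"
    proof -
      have "linear (\<lambda>h. fd w (m (u, x)) (d1 u x h))" using has_derivative_linear[OF dw] .
      from linear_sum_Basis[OF this, of ?S] show ?thesis by simp
    qed
    also have "d1 u x ?S = d2 u x \<xi>" using d1_shift W_B(1) u x by blast
    finally show ?thesis .
  qed
  have c1: "continuous_on Q (\<lambda>u. kern \<xi> (u, x) *\<^sub>R w (m (u, x)))"
    using Q_W x continuous_on_subset[OF continuous_on_w[OF w x] Q_W]
    by (intro continuous_on_scaleR continuous_on_compose2[OF continuous_on_kern] continuous_intros) blast+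
  have c2: "continuous_on Q (\<lambda>u. fd (g e) u e)" for e
    using continuous_on_subset[OF C1_fd_continuous_on[OF g_UNIV]] by blast
  have "0 = (\<Sum>e\<in>Basis. integral Q (\<lambda>u. fd (g e) u e))"
  proof -
    have "integral Q (\<lambda>u. fd (g e) u e) = 0" for e
      using integral_fd_eq_0[OF g_UNIV s_c(2), of e e] by (simp add: g_def b_supp)
    then show ?thesis by simp
  qed
  also have "\<dots> = integral Q (\<lambda>u. \<Sum>e\<in>Basis. fd (g e) u e)"
    by (rule integral_sum[symmetric]) (auto intro: integrable_continuous c2)
  finally have sum0: "integral Q (\<lambda>u. \<Sum>e\<in>Basis. fd (g e) u e) = 0" by simp
  have "integral Q (\<lambda>u. b u *\<^sub>R fd w (m (u, x)) (d2 u x \<xi>)) =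
      integral Q (\<lambda>u. (\<Sum>e\<in>Basis. fd (g e) u e) - kern \<xi> (u, x) *\<^sub>R w (m (u, x)))"
  proof (rule integral_cong)
    fix u assume "u \<in> Q"
    then have "u \<in> W" using Q_W by blast
    then show "b u *\<^sub>R fd w (m (u, x)) (d2 u x \<xi>) = (\<Sum>e\<in>Basis. fd (g e) u e) - kern \<xi> (u, x) *\<^sub>R w (m (u, x))"
      using fd_g by simp
  qed
  also have "\<dots> = integral Q (\<lambda>u. \<Sum>e\<in>Basis. fd (g e) u e) - integral Q (\<lambda>u. kern \<xi> (u, x) *\<^sub>R w (m (u, x)))"
    by (rule integral_diff) (intro integrable_continuous continuous_on_sum c1 c2)+
  finally show ?thesis using sum0 by simp
qed

text \<open>No derivative of \<open>w\<close> is left on the right: this is how uniform convergence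
  of functions becomes C^1 convergence of their averages.\<close>

lemma fd_moll:
  assumes "Cn_on 1 N w" "x \<in> W"
  shows "fd (moll w) x \<xi> = - integral Q (\<lambda>u. kern \<xi> (u, x) *\<^sub>R w (m (u, x)))"
  using fd_eqI[OF moll_has_derivative[OF assms]] moll_ibp[OF assms] by simp

lemma moll_C1:
  assumes w: "Cn_on 1 N w"
  shows "Cn_on 1 W (moll w)"
proof -
  have "Cn_on (Suc 0) W (moll w)"
  proof (rule Cn_on_SucI[OF open_W(1) moll_has_derivative[OF w]])
    fix \<xi>
    have "continuous_on W (\<lambda>x. integral Q (\<lambda>u. kern \<xi> (u, x) *\<^sub>R w (m (u, x))))"
    proof (rule integral_continuous_on_param)
      have "continuous_on (W \<times> Q) (\<lambda>p. (snd p, fst p))" by (intro continuous_intros)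
      moreover have sub: "\<And>p. p \<in> W \<times> Q \<Longrightarrow> (snd p, fst p) \<in> W \<times> W" using Q_W by auto
      ultimately have "continuous_on (W \<times> Q) (\<lambda>p. kern \<xi> (snd p, fst p))"
        "continuous_on (W \<times> Q) (\<lambda>p. m (snd p, fst p))"
        using continuous_on_compose2[OF continuous_on_kern] continuous_on_compose2[OF Cn_on_continuous_on[OF Cn_on_m_WW]]
        by blast+
      moreover have "m (snd p, fst p) \<in> N" if "p \<in> W \<times> Q" for p
        using W(2) sub[OF that] by auto
      ultimately show "continuous_on (W \<times> Q) (\<lambda>(x, u). kern \<xi> (u, x) *\<^sub>R w (m (u, x)))"
        unfolding split_beta
        by (intro continuous_on_scaleR continuous_on_compose2[OF Cn_on_continuous_on[OF w]]) auto
    qed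
    then have "continuous_on W (\<lambda>x. - integral Q (\<lambda>u. kern \<xi> (u, x) *\<^sub>R w (m (u, x))))"
      by (rule continuous_on_minus)
    then show "Cn_on 0 W (\<lambda>x. integral Q (\<lambda>u. b u *\<^sub>R fd w (m (u, x)) (d2 u x \<xi>)))"
      unfolding Cn_on_0 by (rule continuous_on_eq) (simp add: moll_ibp[OF w])
  qed
  then show ?thesis by simp
qed

definition defect :: "('e \<Rightarrow> 'e) \<Rightarrow> 'e \<Rightarrow> 'e \<Rightarrow> 'e" where
  "defect w v y = pr (fd w y (LL y v)) - pr (beta (w y) v)"

lemma continuous_on_pr: "continuous_on S f \<Longrightarrow> continuous_on S (\<lambda>x. pr (f x))"
  unfolding continuous_on_def using tendsto_pr by blast

lemma continuous_on_beta: "continuous_on S f \<Longrightarrow> continuous_on S (\<lambda>x. beta (f x) v)"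
  unfolding continuous_on_def using tendsto_beta by blast

lemma continuous_on_fd_LL:
  assumes w: "Cn_on 1 N w"
  shows "continuous_on N (\<lambda>y. fd w y (LL y v))"
proof -
  have "Cn_on 0 N (\<lambda>y. LL y v)"
    using N(2) by (intro Cn_on_LR(1)[OF N(1) Cn_on_ident[OF N(1)] Cn_on_const]) auto
  then have "Cn_on 0 N (\<lambda>y. fd w y (LL y v))"
    using w by (intro Cn_on_fd_compose[OF N(1) _ Cn_on_ident[OF N(1)]]) auto
  then show ?thesis by (simp add: Cn_on_0)
qed

lemma continuous_on_defect: "Cn_on 1 N w \<Longrightarrow> continuous_on N (defect w v)"
  unfolding defect_def[abs_def]
  by (intro continuous_on_diff continuous_on_pr continuous_on_beta continuous_on_fd_LL Cn_on_continuous_on)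

text \<open>Averaging commutes with the contact operator: \<open>LL_translate\<close> turns
  \<open>d2 u x (LL x v)\<close> into the invariant field at \<open>m (u, x)\<close>, and
  \<open>pr\<close> and \<open>beta\<close> pass through the integral by linearity.\<close>

lemma defect_moll:
  assumes w: "Cn_on 1 N w" and x: "x \<in> W"
  shows "defect (moll w) v x = integral Q (\<lambda>u. b u *\<^sub>R defect w v (m (u, x)))"
proof -
  have blpr: "bounded_linear pr" using linear_pr linear_conv_bounded_linear by blast
  have blbeta: "bounded_linear (\<lambda>a. beta a v)" using linear_beta linear_conv_bounded_linear by blast
  have mc: "continuous_on Q (\<lambda>u. m (u, x))"
    using continuous_on_subset[OF Cn_on_continuous_on[OF Cn_on_m_W(1)[OF x]] Q_W] .
  have mN: "m (u, x) \<in> N" if "u \<in> Q" for u using that Q_W W(2) x by blast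
  have bc: "continuous_on Q b" using continuous_on_subset[OF Cn_on_continuous_on[OF b_C1]] by blast
  have cw: "continuous_on Q (\<lambda>u. b u *\<^sub>R w (m (u, x)))"
    by (intro continuous_on_scaleR bc continuous_on_compose2[OF Cn_on_continuous_on[OF w] mc]) (use mN in auto)
  have cf: "continuous_on Q (\<lambda>u. b u *\<^sub>R fd w (m (u, x)) (LL (m (u, x)) v))"
    by (intro continuous_on_scaleR bc continuous_on_compose2[OF continuous_on_fd_LL[OF w] mc]) (use mN in auto)
  have "fd (moll w) x (LL x v) = integral Q (\<lambda>u. b u *\<^sub>R fd w (m (u, x)) (d2 u x (LL x v)))"
    using fd_eqI[OF moll_has_derivative[OF w x]] by simp
  also have "\<dots> = integral Q (\<lambda>u. b u *\<^sub>R fd w (m (u, x)) (LL (m (u, x)) v))"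
  proof (rule integral_cong)
    fix u assume "u \<in> Q"
    then have "u \<in> W" using Q_W by blast
    then show "b u *\<^sub>R fd w (m (u, x)) (d2 u x (LL x v)) = b u *\<^sub>R fd w (m (u, x)) (LL (m (u, x)) v)"
      using LL_translate[of u x v] W_B(2) x by simp
  qed
  finally have "pr (fd (moll w) x (LL x v)) = integral Q (\<lambda>u. pr (b u *\<^sub>R fd w (m (u, x)) (LL (m (u, x)) v)))"
    using integral_linear[OF integrable_continuous[OF cf] blpr] by (simp add: comp_def)
  moreover have "pr (beta (moll w x) v) = integral Q (\<lambda>u. pr (beta (b u *\<^sub>R w (m (u, x))) v))"
    using integral_linear[OF integrable_continuous[OF cw] bounded_linear_compose[OF blpr blbeta]]
    by (simp add: comp_def moll_def)
  ultimately have "defect (moll w) v x = integral Q (\<lambda>u. pr (b u *\<^sub>R fd w (m (u, x)) (LL (m (u, x)) v)) - pr (beta (b u *\<^sub>R w (m (u, x))) v))"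
    unfolding defect_def
    by (subst integral_diff) (auto intro!: integrable_continuous continuous_on_pr continuous_on_beta cf cw)
  also have "\<dots> = integral Q (\<lambda>u. b u *\<^sub>R defect w v (m (u, x)))"
    by (simp add: defect_def linear_cmul[OF linear_pr] linear_cmul[OF linear_beta] scaleR_diff_right)
  finally show ?thesis .
qed

text \<open>\<open>w0\<close> is merely a continuous limit of approximate solutions, yet its average
  is an exact solution, because the averaged defects tend to zero and the averages converge in
  C^1.\<close>

lemma moll_contact:
  assumes w: "\<And>n. Cn_on 1 N (w n)" and ul: "uniform_limit N w w0 sequentially"
    and def0: "\<And>v. pr v = 0 \<Longrightarrow> uniform_limit N (\<lambda>n. defect (w n) v) (\<lambda>y. 0) sequentially"
    and r': "r' < r"
  shows "contact_on (ball 0 r') (moll w0)"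
proof -
  \<comment> \<open>The smaller ball has its closure in \<open>W\<close>, so compactness bounds
    \<open>kern\<close> uniformly.\<close>
  define S where "S = ball (0::'e) r'"
  have S: "open S" "convex S" "S \<subseteq> W" "cball 0 r' \<subseteq> W" "S \<subseteq> cball 0 r'"
    using r' by (auto simp: S_def W_eq)
  have SW: "x \<in> W" if "x \<in> S" for x using that S(3) by blast
  have mc: "continuous_on Q (\<lambda>u. m (u, x))" if "x \<in> S" for x
    using continuous_on_subset[OF Cn_on_continuous_on[OF Cn_on_m_W(1)[OF SW[OF that]]] Q_W] .
  have mN: "m (u, x) \<in> N" if "x \<in> S" "u \<in> Q" for u x using that Q_W W(2) SW by blast
  have bdd: "\<exists>K. \<forall>x\<in>S. \<forall>u\<in>Q. \<bar>k (u, x)\<bar> \<le> K" if "continuous_on (W \<times> W) k" for k :: "'e \<times> 'e \<Rightarrow> real"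
  proof -
    have "compact (k ` (Q \<times> cball 0 r'))"
      using Q_W S(4) by (intro compact_continuous_image continuous_on_subset[OF that] compact_Times) auto
    then obtain K where "\<forall>y\<in>k ` (Q \<times> cball 0 r'). norm y \<le> K"
      using compact_imp_bounded bounded_iff by metis
    then show ?thesis using S(5) by (intro exI[of _ K]) auto
  qed
  have bcW: "continuous_on (W \<times> W) (\<lambda>p. b (fst p))"
    using continuous_on_compose2[OF Cn_on_continuous_on[OF b_C1] continuous_on_fst[OF continuous_on_id]] by auto
  have bc: "continuous_on Q b" using continuous_on_subset[OF Cn_on_continuous_on[OF b_C1]] by blast
  obtain Kb where Kb: "\<And>x u. x \<in> S \<Longrightarrow> u \<in> Q \<Longrightarrow> \<bar>b u\<bar> \<le> Kb"
    using bdd[OF bcW] by auto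
  have kc: "continuous_on Q (\<lambda>u. kern \<xi> (u, x))" if "x \<in> S" for x \<xi>
    using SW[OF that] Q_W by (intro continuous_on_compose2[OF continuous_on_kern] continuous_intros) blast+
  show ?thesis
    unfolding S_def[symmetric]
  proof (rule contact_limit[OF S(1,2), where g="\<lambda>n. moll (w n)" and
        A="\<lambda>x \<xi>. - integral Q (\<lambda>u. kern \<xi> (u, x) *\<^sub>R w0 (m (u, x)))"])
    show "Cn_on 1 S (moll (w n))" for n using Cn_on_subset[OF moll_C1[OF w] S(3)] .
    show "(\<lambda>n. moll (w n) x) \<longlonglongrightarrow> moll w0 x" if "x \<in> S" for x
      unfolding moll_def
      using weighted_integral_uniform_limit[where S=S and k="\<lambda>x. b" and p="\<lambda>x u. m (u, x)",
          OF bc Kb mc mN Cn_on_continuous_on[OF w] ul] that tendsto_uniform_limitI by fast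
    show "uniform_limit S (\<lambda>n x. fd (moll (w n)) x \<xi>) (\<lambda>x. - integral Q (\<lambda>u. kern \<xi> (u, x) *\<^sub>R w0 (m (u, x)))) sequentially" for \<xi>
    proof -
      obtain K where K: "\<And>x u. x \<in> S \<Longrightarrow> u \<in> Q \<Longrightarrow> \<bar>kern \<xi> (u, x)\<bar> \<le> K"
        using bdd[OF continuous_on_kern[of \<xi>]] by auto
      have "uniform_limit S (\<lambda>n x. - integral Q (\<lambda>u. kern \<xi> (u, x) *\<^sub>R w n (m (u, x))))
          (\<lambda>x. - integral Q (\<lambda>u. kern \<xi> (u, x) *\<^sub>R w0 (m (u, x)))) sequentially"
        by (intro uniform_limit_uminus weighted_integral_uniform_limit[where S=S and k="\<lambda>x u. kern \<xi> (u, x)" and p="\<lambda>x u. m (u, x)",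
          OF kc K mc mN Cn_on_continuous_on[OF w] ul])
      then show ?thesis
        by (rule uniform_limit_cong[THEN iffD1, rotated 2]) (auto simp: fd_moll[OF w] SW)
    qed
    show "(\<lambda>n. pr (fd (moll (w n)) y (LL y v)) - pr (beta (moll (w n) y) v)) \<longlonglongrightarrow> 0"
      if y: "y \<in> S" and v: "pr v = 0" for y v
    proof -
      have "uniform_limit S (\<lambda>n x. integral Q (\<lambda>u. b u *\<^sub>R defect (w n) v (m (u, x))))
          (\<lambda>x. integral Q (\<lambda>u. b u *\<^sub>R 0)) sequentially"
        using weighted_integral_uniform_limit[where S=S and k="\<lambda>x. b" and p="\<lambda>x u. m (u, x)",
          OF bc Kb mc mN continuous_on_defect[OF w] def0[OF v]] .
      from tendsto_uniform_limitI[OF this y]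
      have "(\<lambda>n. defect (moll (w n)) v y) \<longlonglongrightarrow> 0"
        using defect_moll[OF w SW[OF y]] by simp
      then show ?thesis by (simp add: defect_def)
    qed
  qed
qed

end

context rigid_contact
begin

text \<open>The averages of \<open>w0\<close> with shrinking kernels are exact solutions on a common
  ball and tend to \<open>w0\<close> pointwise, so the pointwise limit theorem makes the merely
  continuous \<open>w0\<close> a C^1 solution.\<close>

proposition weakly_contact_imp_contact:
  assumes "0 < \<rho>" and w: "\<And>n. Cn_on 1 (ball 0 \<rho>) (w n)"
    and ul: "uniform_limit (ball 0 \<rho>) w w0 sequentially"
    and def0: "\<And>v. pr v = 0 \<Longrightarrow>
      uniform_limit (ball 0 \<rho>) (\<lambda>n y. pr (fd (w n) y (LL y v)) - pr (beta (w n y) v)) (\<lambda>y. 0) sequentially"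
  shows "\<exists>\<rho>'>0. \<rho>' \<le> \<rho> \<and> contact_on (ball 0 \<rho>') w0"
proof -
  define \<rho>0 where "\<rho>0 = min \<rho> (rad (rad R))"
  define r where "r = rad \<rho>0"
  define N where "N = ball (0::'e) \<rho>0"
  define W where "W = ball (0::'e) r"
  have \<rho>0: "0 < \<rho>0" "N \<subseteq> B2" "N \<subseteq> ball (0::'e) \<rho>" "N \<subseteq> B0"
    using assms(1) rad_pos B_mono by (auto simp: \<rho>0_def B2_def[symmetric] N_def) (auto simp: B2_def)
  have r: "0 < r" "r \<le> \<rho>0" "\<And>u v. u \<in> W \<Longrightarrow> v \<in> W \<Longrightarrow> m (u, v) \<in> N"
    unfolding r_def W_def N_def using rad[OF \<rho>0(1)] by blast+
  have WN: "W \<subseteq> N" using r(2) by (simp add: W_def N_def subset_ball)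
  \<comment> \<open>In the cube of half-side \<open>c\<close> the sum of the absolute coordinates is
    at most \<open>r / 2\<close>, so the cube lies in the ball of radius \<open>r\<close>.\<close>
  define c where "c = r / (2 * real DIM('e))"
  have c: "c > 0" using r(1) by (simp add: c_def)
  let ?Q = "cbox (- (c *\<^sub>R One)) (c *\<^sub>R (One::'e))"
  have QW: "?Q \<subseteq> W"
  proof
    fix u assume u: "u \<in> ?Q"
    have "norm u \<le> (\<Sum>i\<in>Basis. \<bar>u \<bullet> i\<bar>)" by (rule norm_le_l1)
    also have "\<dots> \<le> (\<Sum>i\<in>(Basis::'e set). c)"
    proof (rule sum_mono)
      fix i :: 'e assume "i \<in> Basis"
      then have "- c \<le> u \<bullet> i" "u \<bullet> i \<le> c" using u by (auto simp: mem_box)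
      then show "\<bar>u \<bullet> i\<bar> \<le> c" by linarith
    qed
    also have "\<dots> = r / 2" by (simp add: c_def)
    finally show "u \<in> W" using r(1) by (simp add: W_def)
  qed
  \<comment> \<open>The summand 2 keeps \<open>s j\<close> below \<open>c\<close> already for
    \<open>j = 0\<close>.\<close>
  define s where "s = (\<lambda>j. c / (real j + 2))"
  have s: "0 < s j" "s j < c" for j using c by (simp_all add: s_def field_simps add_pos_nonneg add_nonneg_pos)
  define J where "J = (\<lambda>j. integral ?Q (bump (s j)))"
  have J: "J j > 0" for j
    using integral_bump_pos[OF s(1)[of j] c, where 'a='e] by (simp add: J_def)
  define b where "b = (\<lambda>j u. (1 / J j) *\<^sub>R bump (s j) (u::'e))"
  have b_C1: "Cn_on 1 UNIV (b j)" for j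
    unfolding b_def by (intro Cn_on_scaleR Cn_on_const Cn_on_bump) simp
  have b_pos: "0 \<le> b j u" for j u using J[of j] bump_nonneg[of "s j" u] by (simp add: b_def)
  have b_supp: "b j u = 0" if "s j < norm u" for j u
    using bump_eq_0[of "s j" u] s(1)[of j] that by (simp add: b_def)
  have cb: "continuous_on ?Q (b j)" for j
    using continuous_on_subset[OF Cn_on_continuous_on[OF b_C1]] by blast
  have b_int: "integral ?Q (b j) = 1" for j
    using J[of j] by (simp add: b_def J_def)
  have moll: "mollifier m iv R pr N W (b j) (s j) c r" for j
    using \<rho>0 r QW s b_C1 b_supp WN by unfold_locales (auto simp: N_def W_def)
  have w_N: "Cn_on 1 N (w n)" for n using Cn_on_subset[OF w \<rho>0(3)] .
  have ul_N: "uniform_limit N w w0 sequentially" using uniform_limit_on_subset[OF ul \<rho>0(3)] .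
  have cw0: "continuous_on N w0"
    using uniform_limit_theorem[OF _ ul_N] Cn_on_continuous_on[OF w_N] by simp
  define T where "T = (\<lambda>j x. integral ?Q (\<lambda>u. b j u *\<^sub>R w0 (m (u, x))))"
  have "\<exists>\<rho>'>0. \<rho>' \<le> r / 2 \<and> contact_on (ball 0 \<rho>') w0"
  proof (rule contact_pointwise_limit)
    show "0 < r / 2" using r(1) by simp
    show "contact_on (ball 0 (r / 2)) (T j)" for j
    proof -
      interpret mollifier m iv R pr N W "b j" "s j" c r by (rule moll)
      have "contact_on (ball 0 (r / 2)) (moll w0)"
      proof (rule moll_contact[OF w_N ul_N])
        show "uniform_limit N (\<lambda>n. defect (w n) v) (\<lambda>y. 0) sequentially" if "pr v = 0" for v
          using uniform_limit_on_subset[OF def0[OF that] \<rho>0(3)] by (simp add: defect_def[abs_def])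
      qed (use r(1) in simp)
      then show ?thesis by (simp add: moll_def[abs_def] T_def)
    qed
    fix x :: 'e assume "x \<in> ball 0 (r / 2)"
    then have "x \<in> W" using r(1) by (simp add: W_def)
    then have x: "x \<in> W" "x \<in> N" "x \<in> B0" using WN \<rho>0(4) by blast+
    have cwm: "continuous_on W (\<lambda>u. w0 (m (u, x)))"
    proof (rule continuous_on_compose2[OF cw0])
      show "continuous_on W (\<lambda>u. m (u, x))"
        by (rule Cn_on_continuous_on[of 0], rule Cn_on_m) (use WN \<rho>0(4) x in \<open>auto intro: Cn_on_ident Cn_on_const simp: W_def\<close>)
      show "(\<lambda>u. m (u, x)) ` W \<subseteq> N" using r(3) x(1) by blast
    qed
    show "(\<lambda>j. T j x) \<longlonglongrightarrow> w0 x"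
    proof (rule tendstoI)
      fix e :: real assume e: "e > 0"
      have "0 \<in> W" "open W" using r(1) by (auto simp: W_def)
      then have "isCont (\<lambda>u. w0 (m (u, x))) 0" using cwm by (simp add: continuous_on_eq_continuous_at)
      then obtain d where d: "d > 0" "\<And>u. dist u 0 < d \<Longrightarrow> dist (w0 (m (u, x))) (w0 (m (0, x))) < e/2"
        using half_gt_zero[OF e] unfolding continuous_at_eps_delta by blast
      have m0: "m (0, x) = x" using x(3) by (simp add: group_laws)
      have "s \<longlonglongrightarrow> 0"
        unfolding s_def by (rule real_tendsto_divide_at_top[OF tendsto_const])
          (rule filterlim_at_top_add_at_top filterlim_tendsto_add_at_top[OF tendsto_const filterlim_real_sequentially, of 2, unfolded add.commute[of 2]])
      then have "\<forall>\<^sub>F j in sequentially. s j < d" using d(1) order_tendstoD(2) by blast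
      then show "\<forall>\<^sub>F j in sequentially. dist (T j x) (w0 x) < e"
      proof eventually_elim
        case (elim j)
        have ci: "continuous_on ?Q (\<lambda>u. b j u *\<^sub>R w0 (m (u, x)))" "continuous_on ?Q (\<lambda>u. b j u *\<^sub>R w0 x)"
          by (intro continuous_on_scaleR cb continuous_on_subset[OF cwm QW] continuous_on_const)+
        have "integral ?Q (\<lambda>u. b j u *\<^sub>R w0 x) = w0 x"
          using integral_linear[OF integrable_continuous[OF cb[of j]] bounded_linear_scaleR_left[of "w0 x"]] b_int[of j]
          by (simp add: comp_def)
        then have "T j x - w0 x = integral ?Q (\<lambda>u. b j u *\<^sub>R w0 (m (u, x)) - b j u *\<^sub>R w0 x)"
          unfolding T_def using ci by (simp add: integral_diff integrable_continuous)
        also have "norm \<dots> \<le> integral ?Q (\<lambda>u. b j u * (e/2))"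
        proof (rule integral_norm_bound_integral)
          show "(\<lambda>u. b j u *\<^sub>R w0 (m (u, x)) - b j u *\<^sub>R w0 x) integrable_on ?Q"
            by (intro integrable_continuous continuous_on_diff ci)
          show "(\<lambda>u. b j u * (e/2)) integrable_on ?Q"
            by (intro integrable_continuous continuous_on_mult cb continuous_on_const)
          fix u assume "u \<in> ?Q"
          show "norm (b j u *\<^sub>R w0 (m (u, x)) - b j u *\<^sub>R w0 x) \<le> b j u * (e/2)"
          proof (cases "s j < norm u")
            case True
            then show ?thesis by (simp add: b_supp)
          next
            case False
            then have "norm (w0 (m (u, x)) - w0 x) \<le> e/2"
              using d(2)[of u] elim m0 by (simp add: dist_norm)
            then show ?thesis using b_pos[of j u] mult_left_mono[of "norm (w0 (m (u, x)) - w0 x)" "e/2" "b j u"]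
              by (simp add: scaleR_diff_right[symmetric])
          qed
        qed
        also have "\<dots> = e / 2" using b_int[of j] by simp
        finally show ?case using e by (simp add: dist_norm)
      qed
    qed
  qed
  then show ?thesis using r(1,2) by (auto simp: \<rho>0_def intro: order_trans)
qed

end

section \<open>Germs of contact maps\<close>

lemma uniform_limit_slices:
  fixes H :: "real \<times> 'a::metric_space \<Rightarrow> 'b::metric_space"
  assumes H: "continuous_on (J \<times> K) H" and J: "compact J" and K: "compact K" and "0 \<in> J"
    and t: "t \<longlonglongrightarrow> 0" "\<And>n. t n \<in> J"
  shows "uniform_limit K (\<lambda>n y. H (t n, y)) (\<lambda>y. H (0, y)) sequentially"
proof (rule uniform_limitI)
  fix e :: real assume "e > 0"
  then obtain d where d: "d > 0" "\<And>p q. p \<in> J \<times> K \<Longrightarrow> q \<in> J \<times> K \<Longrightarrow> dist q p < d \<Longrightarrow> dist (H q) (H p) < e"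
    using compact_uniformly_continuous[OF H compact_Times[OF J K]] unfolding uniformly_continuous_on_def by metis
  have "\<forall>\<^sub>F n in sequentially. dist (t n) 0 < d" using tendstoD[OF t(1) d(1)] .
  then show "\<forall>\<^sub>F n in sequentially. \<forall>y\<in>K. dist (H (t n, y)) (H (0, y)) < e"
  proof eventually_elim
    case (elim n)
    then show ?case using d(2) t(2) assms(4) by (auto simp: dist_Pair_Pair)
  qed
qed

lemma has_derivative_imp_lipschitz_at:
  assumes h: "(h has_derivative h') (at 0)"
  shows "\<exists>d>0. \<exists>C\<ge>0. \<forall>g. norm g < d \<longrightarrow> norm (h g - h 0) \<le> C * norm g"
proof -
  obtain K where K: "K > 0" "\<And>x. norm (h' x) \<le> norm x * K"
    using bounded_linear.pos_bounded[OF has_derivative_bounded_linear[OF h]] by auto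
  obtain d where d: "d > 0" "\<And>g. norm (g - 0) < d \<Longrightarrow> norm (h g - h 0 - h' (g - 0)) \<le> 1 * norm (g - 0)"
    using h unfolding has_derivative_at_alt by (metis zero_less_one)
  have "norm (h g - h 0) \<le> (K + 1) * norm g" if "norm g < d" for g
  proof -
    have "norm (h g - h 0) \<le> norm (h g - h 0 - h' g) + norm (h' g)"
      using norm_triangle_ineq[of "h g - h 0 - h' g" "h' g"] by simp
    also have "\<dots> \<le> norm g + norm g * K" using d(2)[of g] K(2)[of g] that by simp
    finally show ?thesis by (simp add: algebra_simps)
  qed
  then show ?thesis using d(1) K(1) by (intro exI[of _ d] conjI exI[of _ "K + 1"]) auto
qed

lemma fd_partial:
  assumes "Cn_on 1 T G" "(t, y) \<in> T"
  shows "((\<lambda>y. G (t, y)) has_derivative (\<lambda>h. fd G (t, y) (0, h))) (at y)"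
    "((\<lambda>t. G (t, y)) has_derivative (\<lambda>h. fd G (t, y) (h, 0))) (at t)"
proof -
  have "((\<lambda>y. (t, y)) has_derivative (\<lambda>h. (0, h))) (at y)" by (auto intro!: derivative_eq_intros)
  from has_derivative_compose[OF this C1_derivative[OF assms]]
  show "((\<lambda>y. G (t, y)) has_derivative (\<lambda>h. fd G (t, y) (0, h))) (at y)" .
  have "((\<lambda>t. (t, y)) has_derivative (\<lambda>h. (h, 0))) (at t)" by (auto intro!: derivative_eq_intros)
  from has_derivative_compose[OF this C1_derivative[OF assms]]
  show "((\<lambda>t. G (t, y)) has_derivative (\<lambda>h. fd G (t, y) (h, 0))) (at t)" .
qed

text \<open>Mean value estimate in \<open>t\<close> alone: the \<open>t\<close>-derivative of
  \<open>G\<close> is uniformly continuous on the compact product, so it stays within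
  \<open>e/2\<close> of its value at \<open>t = 0\<close> for all \<open>y\<close> at once.\<close>

lemma uniform_difference_quotient:
  fixes G :: "real \<times> 'a::euclidean_space \<Rightarrow> 'b::euclidean_space"
  assumes G: "Cn_on 1 T G" and \<tau>: "0 < \<tau>" "{0..\<tau>} \<times> K \<subseteq> T" and K: "compact K"
    and t: "t \<longlonglongrightarrow> 0" "\<And>n. 0 < t n" "\<And>n. t n \<le> \<tau>" and G0: "\<And>y. y \<in> K \<Longrightarrow> G (0, y) = 0"
  shows "uniform_limit K (\<lambda>n y. (1 / t n) *\<^sub>R G (t n, y)) (\<lambda>y. fd G (0, y) (1, 0)) sequentially"
proof (rule uniform_limitI)
  fix e :: real assume e: "e > 0"
  define H where "H = (\<lambda>p. fd G p (1, 0))"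
  have cH: "continuous_on ({0..\<tau>} \<times> K) H"
    unfolding H_def using continuous_on_subset[OF C1_fd_continuous_on[OF G] \<tau>(2)] .
  obtain d where d: "d > 0" "\<And>p q. p \<in> {0..\<tau>} \<times> K \<Longrightarrow> q \<in> {0..\<tau>} \<times> K \<Longrightarrow> dist q p < d \<Longrightarrow> dist (H q) (H p) < e/2"
    using compact_uniformly_continuous[OF cH compact_Times[OF compact_Icc K]] half_gt_zero[OF e]
    unfolding uniformly_continuous_on_def by metis
  have "\<forall>\<^sub>F n in sequentially. dist (t n) 0 < d" using tendstoD[OF t(1) d(1)] .
  then show "\<forall>\<^sub>F n in sequentially. \<forall>y\<in>K. dist ((1 / t n) *\<^sub>R G (t n, y)) (fd G (0, y) (1, 0)) < e"
  proof eventually_elim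
    case (elim n)
    show ?case
    proof
      fix y assume y: "y \<in> K"
      have inT: "(s, y) \<in> T" if "s \<in> {0..t n}" for s using that y \<tau>(2) t(3)[of n] by auto
      define \<phi> where "\<phi> = (\<lambda>s. G (s, y) - s *\<^sub>R H (0, y))"
      have "norm (\<phi> (t n) - \<phi> 0) \<le> (e/2) * norm (t n - 0)"
      proof (rule differentiable_bound[of "{0..t n}"])
        show "(\<phi> has_derivative (\<lambda>h. fd G (s, y) (h, 0) - h *\<^sub>R H (0, y))) (at s within {0..t n})" if "s \<in> {0..t n}" for s
          unfolding \<phi>_def
          by (intro has_derivative_diff has_derivative_at_withinI[OF fd_partial(2)[OF G inT[OF that]]] has_derivative_scaleR_left
              has_derivative_ident)
        show "onorm (\<lambda>h. fd G (s, y) (h, 0) - h *\<^sub>R H (0, y)) \<le> e/2" if s: "s \<in> {0..t n}" for s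
        proof (rule onorm_bound)
          fix h :: real
          have "fd G (s, y) (h, 0) = h *\<^sub>R H (s, y)"
            unfolding H_def using linear_cmul[OF C1_linear[OF G inT[OF s]], of h "(1, 0)"] by simp
          then have "norm (fd G (s, y) (h, 0) - h *\<^sub>R H (0, y)) = \<bar>h\<bar> * dist (H (s, y)) (H (0, y))"
            by (simp add: dist_norm scaleR_diff_right[symmetric])
          also have "\<dots> \<le> \<bar>h\<bar> * (e/2)"
          proof (rule mult_left_mono, rule less_imp_le, rule d(2))
            show "dist (s, y) (0, y) < d" using s elim t(2)[of n] by (simp add: dist_Pair_Pair)
          qed (use s y t(3)[of n] \<tau>(1) in auto)
          finally show "norm (fd G (s, y) (h, 0) - h *\<^sub>R H (0, y)) \<le> e/2 * norm h"
            by (simp add: mult.commute)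
        qed (use e in simp)
      qed (use t(2)[of n] in auto)
      then have le: "norm (G (t n, y) - t n *\<^sub>R H (0, y)) \<le> (e/2) * t n"
        using t(2)[of n] G0[OF y] by (simp add: \<phi>_def)
      have "(1 / t n) *\<^sub>R G (t n, y) - H (0, y) = (1 / t n) *\<^sub>R (G (t n, y) - t n *\<^sub>R H (0, y))"
        using t(2)[of n] by (simp add: scaleR_diff_right)
      then have "norm ((1 / t n) *\<^sub>R G (t n, y) - H (0, y)) = norm (G (t n, y) - t n *\<^sub>R H (0, y)) / t n"
        using t(2)[of n] by simp
      also have "\<dots> \<le> e/2" using le t(2)[of n] by (simp add: divide_le_eq)
      finally show "dist ((1 / t n) *\<^sub>R G (t n, y)) (fd G (0, y) (1, 0)) < e"
        using e by (simp add: dist_norm H_def)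
    qed
  qed
qed

lemma linear_inj_on_subspace_surj:
  fixes A :: "'e::euclidean_space \<Rightarrow> 'e"
  assumes "linear A" "subspace D" "A ` D \<subseteq> D" "inj_on A D" "d \<in> D"
  shows "\<exists>d'\<in>D. A d' = d"
proof -
  have "subspace (A ` D)" using assms linear_subspace_image by blast
  moreover have "inj_on A (span D)"
    by (subst span_eq_iff[THEN iffD2, OF assms(2)]) (rule assms(4))
  then have "dim (A ` D) = dim D"
    by (rule dim_image_eq[OF assms(1)])
  ultimately have "A ` D = D" using assms by (intro subspace_dim_equal) auto
  then have "d \<in> A ` D" using assms(5) by simp
  then show ?thesis by auto
qed

text \<open>A contact map whose base point and value have both been moved to the identity by left
  translations, with local inverse \<open>k\<close>. Horizontality is expressed in the frame
  \<open>LL\<close>, in which every horizontal space becomes the kernel of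
  \<open>pr\<close>.\<close>

locale contact_map_germ = rigid_contact m iv R pr I Psi
  for m :: "'e::euclidean_space \<times> 'e \<Rightarrow> 'e" and iv R pr and I :: "'i set" and Psi +
  fixes f k :: "'e \<Rightarrow> 'e" and \<rho> :: real
  assumes \<rho>: "0 < \<rho>"
    and f_C1: "Cn_on 1 (ball 0 \<rho>) f" and k_C1: "Cn_on 1 (ball 0 \<rho>) k"
    and f_0: "f 0 = 0" and k_0: "k 0 = 0"
    and f_k: "y \<in> ball 0 \<rho> \<Longrightarrow> f (k y) = y" and k_f: "x \<in> ball 0 \<rho> \<Longrightarrow> k (f x) = x"
    and f_contact: "x \<in> ball 0 \<rho> \<Longrightarrow> pr v = 0 \<Longrightarrow> \<exists>v'. pr v' = 0 \<and> fd f x (LL x v) = LL (f x) v'"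
begin

lemma fk_radius:
  assumes "0 < a"
  shows "\<exists>a'>0. a' \<le> a \<and> (\<forall>x\<in>ball 0 a'. f x \<in> ball 0 a \<and> k x \<in> ball 0 a)"
proof -
  have "isCont f 0" "isCont k 0"
    using Cn_on_continuous_on[OF f_C1] Cn_on_continuous_on[OF k_C1] \<rho> by (simp_all add: continuous_on_eq_continuous_at)
  then obtain d1 d2 where d: "d1 > 0" "\<And>x. dist x 0 < d1 \<Longrightarrow> dist (f x) (f 0) < a"
    "d2 > 0" "\<And>x. dist x 0 < d2 \<Longrightarrow> dist (k x) (k 0) < a"
    using assms unfolding continuous_at_eps_delta by metis
  then show ?thesis using assms by (intro exI[of _ "min a (min d1 d2)"]) (auto simp: f_0 k_0)
qed

text \<open>The radii follow the word \<open>m (iv y, f (m (t *\<^sub>R v, k y)))\<close> backwards: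
  from the ball of radius \<open>a4\<close> the map \<open>k\<close> leads into that of
  \<open>a3\<close>, the product with \<open>t *\<^sub>R v\<close> into \<open>a2\<close>,
  \<open>f\<close> into \<open>a1\<close>, and the last product into \<open>a0\<close>. The choice
  of \<open>a4\<close> below \<open>rad a3\<close> also controls \<open>iv y\<close>.\<close>

definition a0 :: real where "a0 = min \<rho> (rad (rad R))"
definition a1 :: real where "a1 = rad a0"
definition a2 :: real where "a2 = (SOME a'. a' > 0 \<and> a' \<le> a1 \<and> (\<forall>x\<in>ball 0 a'. f x \<in> ball 0 a1 \<and> k x \<in> ball 0 a1))"
definition a3 :: real where "a3 = rad a2"
definition a4 :: real where "a4 = (SOME a'. a' > 0 \<and> a' \<le> rad a3 \<and> (\<forall>x\<in>ball 0 a'. f x \<in> ball 0 (rad a3) \<and> k x \<in> ball 0 (rad a3)))"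

lemma a_facts:
  "0 < a0" "0 < a1" "0 < a2" "0 < a3" "0 < a4" "a0 \<le> \<rho>" "a1 \<le> a0" "a2 \<le> a1" "a3 \<le> a2" "a4 \<le> a3"
  "ball 0 a0 \<subseteq> B2"
  "u \<in> ball 0 a1 \<Longrightarrow> v \<in> ball 0 a1 \<Longrightarrow> m (u, v) \<in> ball 0 a0"
  "x \<in> ball 0 a2 \<Longrightarrow> f x \<in> ball 0 a1" "x \<in> ball 0 a2 \<Longrightarrow> k x \<in> ball 0 a1"
  "u \<in> ball 0 a3 \<Longrightarrow> v \<in> ball 0 a3 \<Longrightarrow> m (u, v) \<in> ball 0 a2"
  "y \<in> ball 0 a4 \<Longrightarrow> iv y \<in> ball 0 a1"
  "x \<in> ball 0 a4 \<Longrightarrow> f x \<in> ball 0 a3" "x \<in> ball 0 a4 \<Longrightarrow> k x \<in> ball 0 a3"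
proof -
  show 0: "0 < a0" "a0 \<le> \<rho>" using \<rho> rad_pos by (auto simp: a0_def)
  show "ball 0 a0 \<subseteq> B2" unfolding B2_def a0_def by (intro subset_ball) simp
  show 1: "0 < a1" "a1 \<le> a0" "u \<in> ball 0 a1 \<Longrightarrow> v \<in> ball 0 a1 \<Longrightarrow> m (u, v) \<in> ball 0 a0"
    using rad[OF 0(1)] by (auto simp: a1_def)
  have "a2 > 0 \<and> a2 \<le> a1 \<and> (\<forall>x\<in>ball 0 a2. f x \<in> ball 0 a1 \<and> k x \<in> ball 0 a1)"
    unfolding a2_def by (rule someI_ex[OF fk_radius[OF 1(1)]])
  then show 2: "0 < a2" "a2 \<le> a1" "x \<in> ball 0 a2 \<Longrightarrow> f x \<in> ball 0 a1" "x \<in> ball 0 a2 \<Longrightarrow> k x \<in> ball 0 a1"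
    by blast+
  show 3: "0 < a3" "a3 \<le> a2" "u \<in> ball 0 a3 \<Longrightarrow> v \<in> ball 0 a3 \<Longrightarrow> m (u, v) \<in> ball 0 a2"
    unfolding a3_def using rad[OF 2(1)] by blast+
  note r3 = rad[OF 3(1)]
  have 4: "a4 > 0 \<and> a4 \<le> rad a3 \<and> (\<forall>x\<in>ball 0 a4. f x \<in> ball 0 (rad a3) \<and> k x \<in> ball 0 (rad a3))"
    unfolding a4_def by (rule someI_ex[OF fk_radius[OF r3(1)]])
  then show "0 < a4" "a4 \<le> a3" using r3(2) by auto
  have sub: "ball 0 (rad a3) \<subseteq> ball (0::'e) a3" "ball 0 a3 \<subseteq> ball (0::'e) a1" "ball 0 a4 \<subseteq> ball (0::'e) (rad a3)"
    using r3(2) 3(2) 2(2) 4 by (auto intro!: subset_ball)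
  show "y \<in> ball 0 a4 \<Longrightarrow> iv y \<in> ball 0 a1" using r3(4)[of y] sub by blast
  show "x \<in> ball 0 a4 \<Longrightarrow> f x \<in> ball 0 a3" "x \<in> ball 0 a4 \<Longrightarrow> k x \<in> ball 0 a3" using 4 sub by blast+
qed

lemma a_B:
  "u \<in> ball 0 a1 \<Longrightarrow> u \<in> ball 0 a0" "u \<in> ball 0 a2 \<Longrightarrow> u \<in> ball 0 a1" "u \<in> ball 0 a3 \<Longrightarrow> u \<in> ball 0 a2"
  "u \<in> ball 0 a4 \<Longrightarrow> u \<in> ball 0 a3" "u \<in> ball 0 a0 \<Longrightarrow> u \<in> B2" "u \<in> ball 0 a0 \<Longrightarrow> u \<in> B1" "u \<in> ball 0 a0 \<Longrightarrow> u \<in> B0"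
  "u \<in> ball 0 a0 \<Longrightarrow> u \<in> ball 0 \<rho>"
  using a_facts(6-11) subset_ball[OF a_facts(6)] B_mono by (auto simp: subset_iff)

text \<open>The differential of \<open>f\<close> maps a horizontal space injectively into one of the
  same dimension, hence onto it, so its inverse preserves horizontality too.\<close>

lemma k_contact:
  assumes y: "y \<in> ball 0 a4" and d: "pr d = 0"
  shows "\<exists>d'. pr d' = 0 \<and> fd k y (LL y d) = LL (k y) d'"
proof -
  define x where "x = k y"
  have x: "x \<in> ball 0 a0" using a_facts(18)[OF y] a_B by (simp add: x_def del: mem_ball mem_ball_0)
  have y0: "y \<in> ball 0 a0" using y a_B by blast
  have xB: "x \<in> B2" "x \<in> B0" "x \<in> B1" "x \<in> ball 0 \<rho>" using x a_B by blast+
  have yB: "y \<in> B2" "y \<in> B0" "y \<in> B1" "y \<in> ball 0 \<rho>" using y0 a_B by blast+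
  have fx: "f x = y" using f_k[OF yB(4)] by (simp add: x_def)
  have df: "(f has_derivative fd f x) (at x)" using C1_derivative[OF f_C1 xB(4)] .
  have dk: "(k has_derivative fd k y) (at y)" using C1_derivative[OF k_C1 yB(4)] .
  have kf': "fd k y (fd f x h) = h" for h
  proof -
    have "((\<lambda>x. k (f x)) has_derivative (\<lambda>h. fd k y (fd f x h))) (at x)"
      using has_derivative_compose[OF df] dk fx by simp
    from fd_unique_on[OF open_ball xB(4) k_f this has_derivative_ident] show ?thesis by simp
  qed
  \<comment> \<open>The differential of \<open>f\<close> at \<open>x\<close> in the left-invariant
    frames at \<open>x\<close> and \<open>y\<close>, an endomorphism that maps the kernel of
    \<open>pr\<close> into itself.\<close>
  define A where "A = (\<lambda>v. IL y (fd f x (LL x v)))"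
  have A: "linear A"
    unfolding A_def
    using linear_compose[OF linear_compose[OF linear_LR(1)[OF xB(2)] has_derivative_linear[OF df]] linear_LR(3)[OF yB(3)]]
    by (simp add: comp_def)
  define D where "D = {v. pr v = 0}"
  have D: "subspace D" unfolding D_def using linear_pr by (rule linear_subspace_kernel)
  have "A v \<in> D" if v: "v \<in> D" for v
  proof -
    obtain v' where "pr v' = 0" "fd f x (LL x v) = LL y v'"
      using f_contact[OF xB(4), of v] v fx unfolding D_def by auto
    then show ?thesis by (simp add: A_def D_def IL_LL[OF yB(1)])
  qed
  moreover have "inj_on A D"
  proof (rule inj_onI)
    fix u v assume "A u = A v"
    then have "LL y (A u) = LL y (A v)" by simp
    then have "fd f x (LL x u) = fd f x (LL x v)" by (simp add: A_def LL_IL[OF yB(1)])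
    then have "LL x u = LL x v" using kf' by metis
    then show "u = v" using IL_LL[OF xB(1)] by metis
  qed
  ultimately obtain d' where d': "d' \<in> D" "A d' = d"
    using linear_inj_on_subspace_surj[OF A D, of d] d by (auto simp: D_def)
  have "LL y d = fd f x (LL x d')" using d'(2) LL_IL[OF yB(1)] by (auto simp: A_def)
  then have "fd k y (LL y d) = LL (k y) d'" using kf' by (simp add: x_def)
  then show ?thesis using d'(1) by (auto simp: D_def)
qed

text \<open>\<open>gam v (t, y)\<close> is the increment \<open>y\<^sup>-\<^sup>1 \<phi>(y)\<close> of the contact map \<open>\<phi> = f \<circ> L \<circ> f\<^sup>-\<^sup>1\<close>, where
  \<open>L\<close> is the left translation by \<open>t v\<close>; its \<open>t\<close>-derivative at \<open>0\<close> represents the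
  push-forward by \<open>f\<close> of the right-invariant field of \<open>v\<close>.\<close>

definition gam :: "'e \<Rightarrow> real \<times> 'e \<Rightarrow> 'e" where
  "gam v p = m (iv (snd p), f (m (fst p *\<^sub>R v, k (snd p))))"

definition tau :: "'e \<Rightarrow> real" where "tau v = a3 / (norm v + 1)"

definition dom :: "'e \<Rightarrow> (real \<times> 'e) set" where "dom v = {- tau v<..<tau v} \<times> ball 0 a4"

lemma tau_pos: "0 < tau v"
  using a_facts(4) by (simp add: tau_def add_nonneg_pos)

lemma open_dom: "open (dom v)"
  unfolding dom_def by (intro open_Times) auto

lemma domD:
  assumes "(t, y) \<in> dom v"
  shows "t *\<^sub>R v \<in> ball 0 a3" "y \<in> ball 0 a4" "k y \<in> ball 0 a3" "m (t *\<^sub>R v, k y) \<in> ball 0 a2"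
    "f (m (t *\<^sub>R v, k y)) \<in> ball 0 a1" "iv y \<in> ball 0 a1" "gam v (t, y) \<in> ball 0 a0"
proof -
  have "\<bar>t\<bar> < tau v" using assms by (auto simp: dom_def)
  then have "\<bar>t\<bar> * (norm v + 1) < a3"
    by (simp add: tau_def pos_less_divide_eq add_nonneg_pos)
  moreover have "\<bar>t\<bar> * norm v \<le> \<bar>t\<bar> * (norm v + 1)" by (intro mult_left_mono) auto
  ultimately show 1: "t *\<^sub>R v \<in> ball 0 a3" by simp
  show 2: "y \<in> ball 0 a4" using assms by (simp add: dom_def)
  show 3: "k y \<in> ball 0 a3" using a_facts(18)[OF 2] .
  show 4: "m (t *\<^sub>R v, k y) \<in> ball 0 a2" using a_facts(15)[OF 1 3] .
  show 5: "f (m (t *\<^sub>R v, k y)) \<in> ball 0 a1" using a_facts(13)[OF 4] .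
  show 6: "iv y \<in> ball 0 a1" using a_facts(16)[OF 2] .
  show "gam v (t, y) \<in> ball 0 a0" using a_facts(12)[OF 6 5] by (simp add: gam_def)
qed

lemma gam_C1: "Cn_on 1 (dom v) (gam v)"
proof -
  note o = open_dom[of v]
  have id: "Cn_on 1 (dom v) (\<lambda>p. p)" using Cn_on_ident[OF o] .
  have D: "snd p \<in> ball 0 \<rho>" "fst p *\<^sub>R v \<in> B0" "k (snd p) \<in> B0" "m (fst p *\<^sub>R v, k (snd p)) \<in> ball 0 \<rho>"
    "f (m (fst p *\<^sub>R v, k (snd p))) \<in> B0" "iv (snd p) \<in> B0" "snd p \<in> B0" if "p \<in> dom v" for p
  proof -
    have "(fst p, snd p) \<in> dom v" using that by simp
    note d = domD[OF this]
    show "snd p \<in> ball 0 \<rho>" "fst p *\<^sub>R v \<in> B0" "k (snd p) \<in> B0" "m (fst p *\<^sub>R v, k (snd p)) \<in> ball 0 \<rho>"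
      "f (m (fst p *\<^sub>R v, k (snd p))) \<in> B0" "iv (snd p) \<in> B0" "snd p \<in> B0"
      using d a_B by blast+
  qed
  have 1: "Cn_on 1 (dom v) (\<lambda>p. k (snd p))"
    by (rule Cn_on_compose[OF o Cn_on_snd[OF o id] k_C1 D(1)])
  have 2: "Cn_on 1 (dom v) (\<lambda>p. m (fst p *\<^sub>R v, k (snd p)))"
    by (rule Cn_on_m[OF o Cn_on_scaleR[OF o Cn_on_fst[OF o id] Cn_on_const] 1 D(2,3)])
  have 3: "Cn_on 1 (dom v) (\<lambda>p. f (m (fst p *\<^sub>R v, k (snd p))))"
    by (rule Cn_on_compose[OF o 2 f_C1 D(4)])
  have 4: "Cn_on 1 (dom v) (\<lambda>p. iv (snd p))"
    by (rule Cn_on_iv[OF o Cn_on_snd[OF o id] D(7)])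
  show ?thesis unfolding gam_def[abs_def]
    by (rule Cn_on_m[OF o 4 3 D(6,5)])
qed

lemma zero_dom: "y \<in> ball 0 a4 \<Longrightarrow> (0, y) \<in> dom v"
  using tau_pos[of v] by (simp add: dom_def)

lemma gam_0:
  assumes "y \<in> ball 0 a4"
  shows "gam v (0, y) = 0"
proof -
  note d = domD[OF zero_dom[OF assms, of v]]
  have "k y \<in> B0" "y \<in> B0" "iv y \<in> B0" "y \<in> ball 0 \<rho>" using d a_B by blast+
  then show ?thesis by (simp add: gam_def group_laws f_k del: mem_ball mem_ball_0)
qed

text \<open>Write the contact map as \<open>y\<close> times its increment and differentiate along
  \<open>LL y d\<close>. The result is horizontal; translating it back by \<open>y\<close>
  (\<open>d1_LL\<close>, \<open>d2_inj\<close>) and then by \<open>g\<close> leaves this formula. It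
  is exact and nonlinear in the increment, and linearising at \<open>g = 0\<close> gives the contact
  equation.\<close>

lemma gam_contact:
  assumes p: "(t, y) \<in> dom v" and d: "pr d = 0"
  defines "g \<equiv> gam v (t, y)"
  shows "pr (IL g (RR g d + fd (gam v) (t, y) (0, LL y d))) = 0"
proof -
  note D = domD[OF p]
  let ?x = "m (t *\<^sub>R v, k y)"
  define \<phi> where "\<phi> = (\<lambda>y. f (m (t *\<^sub>R v, k y)))"
  have B: "t *\<^sub>R v \<in> B0" "t *\<^sub>R v \<in> B1" "y \<in> B0" "y \<in> B1" "y \<in> B2" "y \<in> ball 0 \<rho>" "k y \<in> B0" "k y \<in> B1" "?x \<in> ball 0 \<rho>"
    "g \<in> B0" "g \<in> B1" "g \<in> B2"
    using D a_B unfolding g_def by blast+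
  obtain d1' where d1': "pr d1' = 0" "fd k y (LL y d) = LL (k y) d1'" using k_contact[OF D(2) d] by blast
  obtain d2' where d2': "pr d2' = 0" "fd f ?x (LL ?x d1') = LL (f ?x) d2'" using f_contact[OF B(9) d1'(1)] by blast
  have "(\<phi> has_derivative (\<lambda>h. fd f ?x (d2 (t *\<^sub>R v) (k y) (fd k y h)))) (at y)"
    unfolding \<phi>_def
    by (rule has_derivative_compose[OF m_has_derivative_right[OF C1_derivative[OF k_C1 B(6)] B(1) B(7)] C1_derivative[OF f_C1 B(9)]])
  moreover have "((\<lambda>y'. m (y', gam v (t, y'))) has_derivative
      (\<lambda>h. d1 y g h + d2 y g (fd (gam v) (t, y) (0, h)))) (at y)"
    unfolding g_def
    by (rule m_has_derivative_pair[OF has_derivative_ident fd_partial(1)[OF gam_C1 p]])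
      (use B in \<open>auto simp: g_def\<close>)
  moreover have "\<phi> y' = m (y', gam v (t, y'))" if "y' \<in> ball 0 a4" for y'
  proof -
    have "(t, y') \<in> dom v" using p that by (simp add: dom_def)
    note D' = domD[OF this]
    have "y' \<in> B2" "f (m (t *\<^sub>R v, k y')) \<in> B2" using D' a_B by blast+
    from m_cancel_iv[OF this] show ?thesis by (simp add: \<phi>_def gam_def)
  qed
  ultimately have "fd f ?x (d2 (t *\<^sub>R v) (k y) (fd k y (LL y d))) = d1 y g (LL y d) + d2 y g (fd (gam v) (t, y) (0, LL y d))"
    using fd_unique_on[of "ball 0 a4" y \<phi> "\<lambda>y'. m (y', gam v (t, y'))"] D(2) by blast
  also have "\<dots> = d2 y g (RR g d + fd (gam v) (t, y) (0, LL y d))"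
    by (simp add: d1_LL[OF B(4) B(11)] linear_add[OF linear_d(2)[OF B(3) B(10)]])
  finally have "d2 y g (RR g d + fd (gam v) (t, y) (0, LL y d)) = LL (f ?x) d2'"
    using d1'(2) d2'(2) LL_translate[OF B(2) B(8)] by simp
  also have "f ?x = m (y, g)"
    using m_cancel_iv[of y "f ?x"] B(5) D(5) a_B by (simp add: g_def gam_def del: mem_ball mem_ball_0)
  also have "LL (m (y, g)) d2' = d2 y g (LL g d2')" using LL_translate[OF B(4) B(11)] by simp
  finally have "RR g d + fd (gam v) (t, y) (0, LL y d) = LL g d2'" using d2_inj[OF B(5) B(12)] by blast
  then show ?thesis using IL_LL[OF B(12)] d2'(1) by simp
qed


lemma IL_0: "IL 0 v = v"
  using IL_LL[of 0 v] by (simp add: LL_zero)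

text \<open>\<open>IL 0\<close> is the identity and \<open>IL\<close> is differentiable at 0;
  reducing to the finitely many basis vectors gives one \<open>\<delta>\<close> for all
  \<open>x\<close>.\<close>

lemma IL_lipschitz: "\<exists>\<delta>>0. \<exists>L\<ge>0. \<forall>g x. norm g < \<delta> \<longrightarrow> norm (x - IL g x) \<le> L * norm g * norm x"
proof -
  have "\<exists>\<delta>>0. \<exists>C\<ge>0. \<forall>g. norm g < \<delta> \<longrightarrow> norm (IL g b - IL 0 b) \<le> C * norm g" for b
  proof (rule has_derivative_imp_lipschitz_at)
    have "Cn_on 1 B1 (\<lambda>g. IL g b)"
      by (rule Cn_on_LR(3)[OF _ Cn_on_ident Cn_on_const]) auto
    from C1_derivative[OF this zero_in_B(2)]
    show "((\<lambda>g. IL g b) has_derivative fd (\<lambda>g. IL g b) 0) (at 0)" .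
  qed
  then obtain \<delta> C where \<delta>: "\<And>b. \<delta> b > 0" "\<And>b. C b \<ge> 0"
    "\<And>b g. norm g < \<delta> b \<Longrightarrow> norm (IL g b - b) \<le> C b * norm g"
    unfolding IL_0 by metis
  define \<delta>' where "\<delta>' = Min (insert (rad R) (\<delta> ` (Basis::'e set)))"
  have \<delta>': "\<delta>' > 0" "\<delta>' \<le> rad R" using \<delta>(1) rad_pos by (auto simp: \<delta>'_def)
  have \<delta>'_le: "\<delta>' \<le> \<delta> b" if "b \<in> Basis" for b
    unfolding \<delta>'_def by (rule Min_le) (use that in auto)
  define L where "L = (\<Sum>b\<in>(Basis::'e set). C b)"
  have "norm (x - IL g x) \<le> L * norm g * norm x" if g: "norm g < \<delta>'" for g x
  proof -
    have "g \<in> B1" using g \<delta>'(2) by (simp add: B1_def)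
    then have lin: "linear (\<lambda>x. IL g x - x)"
      using linear_compose_sub[OF linear_LR(3) linear_ident] by blast
    have "norm (IL g x - x) = norm (\<Sum>b\<in>Basis. (x \<bullet> b) *\<^sub>R (IL g b - b))"
      using linear_sum_Basis[OF lin, of x] by simp
    also have "\<dots> \<le> (\<Sum>b\<in>(Basis::'e set). norm x * (C b * norm g))"
    proof (rule sum_norm_le)
      fix b :: 'e assume b: "b \<in> Basis"
      have "norm (IL g b - b) \<le> C b * norm g" using \<delta>(3) \<delta>'_le[OF b] g by simp
      then show "norm ((x \<bullet> b) *\<^sub>R (IL g b - b)) \<le> norm x * (C b * norm g)"
        using Basis_le_norm[OF b, of x] by (auto intro!: mult_mono)
    qed
    also have "\<dots> = L * norm g * norm x"
      by (simp add: L_def sum_distrib_left sum_distrib_right mult_ac)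
    finally show ?thesis by (simp add: norm_minus_commute)
  qed
  moreover have "L \<ge> 0" unfolding L_def using \<delta>(2) by (intro sum_nonneg)
  ultimately show ?thesis using \<delta>'(1) by blast
qed

definition push :: "'e \<Rightarrow> 'e \<Rightarrow> 'e" where
  "push v y = fd (gam v) (0, y) (1, 0)"

text \<open>This identifies \<open>push v\<close> as the push-forward read in the left-invariant
  frame. Read from right to left, it recovers the derivative of \<open>f\<close> from
  \<open>push\<close>, which the bootstrapping uses.\<close>

lemma push_eq:
  assumes "y \<in> ball 0 a4"
  shows "push v y = IL y (fd f (k y) (RR (k y) v))"
proof -
  note d = domD[OF zero_dom[OF assms, of v]]
  have B: "k y \<in> B0" "y \<in> B0" "iv y \<in> B0" "y \<in> ball 0 \<rho>" "k y \<in> ball 0 \<rho>" using d a_B by blast+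
  have f1: "f (m (0, k y)) = y" using B by (simp add: group_laws f_k del: mem_ball mem_ball_0)
  have "((\<lambda>t. t *\<^sub>R v) has_derivative (\<lambda>h. h *\<^sub>R v)) (at 0)" by (auto intro!: derivative_eq_intros)
  from m_has_derivative_left[OF this _ B(1)]
  have m1: "((\<lambda>t. m (t *\<^sub>R v, k y)) has_derivative (\<lambda>h. RR (k y) (h *\<^sub>R v))) (at 0)" by (simp add: RR_def)
  have "(f has_derivative fd f (k y)) (at (m (0 *\<^sub>R v, k y)))"
    using C1_derivative[OF f_C1 B(5)] B by (simp add: group_laws)
  from has_derivative_compose[OF m1 this]
  have "((\<lambda>t. f (m (t *\<^sub>R v, k y))) has_derivative (\<lambda>h. fd f (k y) (RR (k y) (h *\<^sub>R v)))) (at 0)" .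
  from m_has_derivative_right[OF this B(3)]
  have "((\<lambda>t. gam v (t, y)) has_derivative (\<lambda>h. IL y (fd f (k y) (RR (k y) (h *\<^sub>R v))))) (at 0)"
    using B f1 by (simp add: gam_def IL_def)
  from fd_eqI[OF this] fd_eqI[OF fd_partial(2)[OF gam_C1 zero_dom[OF assms]]]
  have "(\<lambda>h. IL y (fd f (k y) (RR (k y) (h *\<^sub>R v)))) = (\<lambda>h. fd (gam v) (0, y) (h, 0))" by simp
  from fun_cong[OF this, of 1] show ?thesis by (simp add: push_def)
qed

text \<open>The quotients \<open>w n\<close> converge uniformly, but their
  \<open>y\<close>-derivatives are those of \<open>gam\<close> divided by \<open>t n\<close>, and a
  C^1 function gives no bound for that. Only their defect in the contact equation is shown to
  vanish.\<close>

lemma push_contact: "\<exists>r>0. contact_on (ball 0 r) (push v)"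
proof -
  define \<tau> where "\<tau> = tau v / 2"
  have \<tau>: "0 < \<tau>" using tau_pos[of v] by (simp add: \<tau>_def)
  define t where "t = (\<lambda>n. \<tau> / (real n + 1))"
  have t: "t n > 0" "t n \<le> \<tau>" for n using \<tau> by (auto simp: t_def field_simps)
  have t0: "t \<longlonglongrightarrow> 0"
    unfolding t_def
    by (rule real_tendsto_divide_at_top[OF tendsto_const])
      (rule filterlim_tendsto_add_at_top[OF tendsto_const filterlim_real_sequentially, of 1, unfolded add.commute[of 1]])
  define K where "K = cball (0::'e) (a4 / 2)"
  have K: "compact K" "ball 0 (a4 / 2) \<subseteq> K" "K \<subseteq> ball 0 a4" using a_facts(5) by (auto simp: K_def)
  have JK: "{0..\<tau>} \<times> K \<subseteq> dom v" using K(3) \<tau> by (auto simp: dom_def \<tau>_def subset_iff)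
  have inD: "(t n, y) \<in> dom v" if "y \<in> K" for n y
    using JK that t[of n] by (auto simp: less_imp_le subset_iff)
  have K0: "y \<in> ball 0 a4" if "y \<in> K" for y using that K(3) by blast
  define w where "w = (\<lambda>n y. (1 / t n) *\<^sub>R gam v (t n, y))"
  have w_ul: "uniform_limit K w (push v) sequentially"
    unfolding w_def push_def
    by (rule uniform_difference_quotient[OF gam_C1 \<tau> JK K(1) t0 t]) (use gam_0 K0 in blast)
  have gam_slice: "Cn_on 1 (ball 0 (a4/2)) (\<lambda>y. gam v (t n, y))" for n
    by (rule Cn_on_compose[OF open_ball Cn_on_Pair[OF open_ball Cn_on_const Cn_on_ident[OF open_ball]] gam_C1])
      (use inD K(2) in blast)
  have w_C1: "Cn_on 1 (ball 0 (a4/2)) (w n)" for n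
    unfolding w_def by (intro Cn_on_scaleR Cn_on_const gam_slice) simp
  \<comment> \<open>The increments are of size \<open>t\<close>, uniformly in \<open>y\<close>. This
    pays for the factor \<open>1 / t n\<close> in both error terms below.\<close>
  obtain C where C: "C > 0" "\<forall>\<^sub>F n in sequentially. \<forall>y\<in>K. norm (gam v (t n, y)) \<le> C * t n"
  proof -
    have "continuous_on K (push v)"
    proof -
      have "continuous_on (dom v) (\<lambda>p. fd (gam v) p (1, 0))" using C1_fd_continuous_on[OF gam_C1] .
      moreover have "continuous_on K (\<lambda>y. (0::real, y))" by (intro continuous_intros)
      moreover have "(\<lambda>y. (0, y)) ` K \<subseteq> dom v" using zero_dom K0 by blast
      ultimately show ?thesis unfolding push_def by (rule continuous_on_compose2)
    qed
    from compact_imp_bounded[OF compact_continuous_image[OF this K(1)]]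
    obtain B where B: "\<forall>y\<in>push v ` K. norm y \<le> B"
      unfolding bounded_iff by blast
    define C where "C = \<bar>B\<bar> + 1"
    have "\<forall>\<^sub>F n in sequentially. \<forall>y\<in>K. norm (gam v (t n, y)) \<le> C * t n"
      using uniform_limitD[OF w_ul zero_less_one]
    proof eventually_elim
      case (elim n)
      show ?case
      proof
        fix y assume y: "y \<in> K"
        have "norm (w n y) \<le> norm (push v y) + dist (w n y) (push v y)"
          using norm_triangle_ineq[of "push v y" "w n y - push v y"] by (simp add: dist_norm)
        also have "\<dots> \<le> C" using elim y B by (force simp: C_def)
        finally have "norm (gam v (t n, y)) / t n \<le> C" using t(1)[of n] by (simp add: w_def)
        then show "norm (gam v (t n, y)) \<le> C * t n" using t(1)[of n] by (simp add: divide_le_eq)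
      qed
    qed
    moreover have "C > 0" by (simp add: C_def)
    ultimately show ?thesis using that by blast
  qed
  have g_small: "\<forall>\<^sub>F n in sequentially. \<forall>y\<in>K. norm (gam v (t n, y)) \<le> C * t n \<and> norm (gam v (t n, y)) < \<delta>"
    if "\<delta> > 0" for \<delta>
  proof -
    have "(\<lambda>n. C * t n) \<longlonglongrightarrow> 0" using tendsto_mult_right_zero[OF t0] .
    then have "\<forall>\<^sub>F n in sequentially. C * t n < \<delta>" using order_tendstoD(2) that by blast
    with C(2) show ?thesis by eventually_elim force
  qed
  have "\<exists>\<rho>'>0. \<rho>' \<le> a4/2 \<and> contact_on (ball 0 \<rho>') (push v)"
  proof (rule weakly_contact_imp_contact[OF _ w_C1])
    show "0 < a4 / 2" using a_facts(5) by simp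
    show "uniform_limit (ball 0 (a4/2)) w (push v) sequentially" using uniform_limit_on_subset[OF w_ul K(2)] .
    fix d :: 'e assume d: "pr d = 0"
    define G where "G = (\<lambda>p. fd (gam v) p (0, LL (snd p) d))"
    \<comment> \<open>At \<open>t = 0\<close> the increment vanishes identically in
      \<open>y\<close>, hence so does its \<open>y\<close>-derivative, which is jointly
      continuous.\<close>
    have G_ul: "uniform_limit K (\<lambda>n y. G (t n, y)) (\<lambda>y. 0) sequentially"
    proof -
      have "Cn_on 0 (dom v) G" unfolding G_def
      proof (rule Cn_on_fd_compose[OF open_dom _ Cn_on_ident[OF open_dom]])
        show "Cn_on (Suc 0) (dom v) (gam v)" using gam_C1 by simp
        have "snd p \<in> B0" if "p \<in> dom v" for p
          using domD(2)[of "fst p" "snd p" v] that a_B by (metis prod.collapse)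
        then show "Cn_on 0 (dom v) (\<lambda>p. (0::real, LL (snd p) d))"
          by (intro Cn_on_Pair Cn_on_const Cn_on_LR(1) Cn_on_snd Cn_on_ident open_dom)
      qed
      then have "continuous_on ({0..\<tau>} \<times> K) G"
        using continuous_on_subset JK Cn_on_continuous_on by blast
      then have ul0: "uniform_limit K (\<lambda>n y. G (t n, y)) (\<lambda>y. G (0, y)) sequentially"
        by (rule uniform_limit_slices[OF _ compact_Icc K(1) _ t0]) (use \<tau> t in \<open>auto intro: less_imp_le\<close>)
      have G0: "G (0, y) = 0" if "y \<in> K" for y
        unfolding G_def
        using fd_unique_on[OF open_ball K0[OF that] gam_0 fd_partial(1)[OF gam_C1 zero_dom[OF K0[OF that]]]
            has_derivative_const] by simp
      show ?thesis
        by (rule iffD1[OF uniform_limit_cong' ul0]) (simp_all add: G0)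
    qed
    \<comment> \<open>The two parts of the defect: \<open>E1\<close> arises from dropping
      \<open>IL\<close> in front of the derivative of the increment, \<open>E2\<close> from
      replacing the adjoint action by its first-order expansion.\<close>
    define E1 where "E1 = (\<lambda>n y. (1 / t n) *\<^sub>R (G (t n, y) - IL (gam v (t n, y)) (G (t n, y))))"
    define E2 where "E2 = (\<lambda>n y. (1 / t n) *\<^sub>R (IL (gam v (t n, y)) (RR (gam v (t n, y)) d) - d + beta (gam v (t n, y)) d))"
    have E1: "uniform_limit K E1 (\<lambda>y. 0) sequentially"
    proof (rule uniform_limitI)
      fix e :: real assume e: "e > 0"
      obtain \<delta> L where \<delta>: "\<delta> > 0" "L \<ge> 0" "\<And>g x. norm g < \<delta> \<Longrightarrow> norm (x - IL g x) \<le> L * norm g * norm x"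
        using IL_lipschitz by blast
      \<comment> \<open>The factor \<open>1 / t n\<close> is absorbed by the size of the increment;
        smallness comes from \<open>G\<close>.\<close>
      define \<eta> where "\<eta> = e / (L * C + 1)"
      have pos: "L * C + 1 > 0" using \<delta>(2) C(1) by (simp add: add_nonneg_pos)
      have "\<eta> > 0" using e pos by (simp add: \<eta>_def)
      from uniform_limitD[OF G_ul this] g_small[OF \<delta>(1)]
      show "\<forall>\<^sub>F n in sequentially. \<forall>y\<in>K. dist (E1 n y) 0 < e"
      proof eventually_elim
        case (elim n)
        show ?case
        proof
          fix y assume y: "y \<in> K"
          have "norm (E1 n y) = norm (G (t n, y) - IL (gam v (t n, y)) (G (t n, y))) / t n"
            using t(1)[of n] by (simp add: E1_def)
          also have "\<dots> \<le> (L * (C * t n) * norm (G (t n, y))) / t n"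
          proof (rule divide_right_mono)
            have "norm (G (t n, y) - IL (gam v (t n, y)) (G (t n, y))) \<le> L * norm (gam v (t n, y)) * norm (G (t n, y))"
              using \<delta>(3) elim(2) y by blast
            also have "\<dots> \<le> L * (C * t n) * norm (G (t n, y))"
              using elim(2) y \<delta>(2) by (intro mult_right_mono mult_left_mono) auto
            finally show "norm (G (t n, y) - IL (gam v (t n, y)) (G (t n, y))) \<le> L * (C * t n) * norm (G (t n, y))" .
          qed (use t(1)[of n] in simp)
          also have "\<dots> = L * C * norm (G (t n, y))" using t(1)[of n] by simp
          also have "\<dots> \<le> L * C * \<eta>"
            using elim(1) y \<delta>(2) C(1) by (intro mult_left_mono) (auto intro: less_imp_le)
          also have "\<dots> < (L * C + 1) * \<eta>" using \<open>\<eta> > 0\<close> by (simp add: algebra_simps)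
          also have "\<dots> = e" using pos by (simp add: \<eta>_def)
          finally show "dist (E1 n y) 0 < e" by simp
        qed
      qed
    qed
    \<comment> \<open>Here smallness comes from the remainder in the derivative of the adjoint
      action, whose linear part is minus \<open>beta\<close>.\<close>
    have E2: "uniform_limit K E2 (\<lambda>y. 0) sequentially"
    proof (rule uniform_limitI)
      fix e :: real assume e: "e > 0"
      define \<eta> where "\<eta> = e / (C + 1)"
      have \<eta>: "\<eta> > 0" using e C(1) by (simp add: \<eta>_def add_pos_pos)
      have "IL 0 (RR 0 d) = d" by (simp add: IL_0 RR_zero)
      then obtain \<delta> where \<delta>: "\<delta> > 0" "\<And>g. norm g < \<delta> \<Longrightarrow> norm (IL g (RR g d) - d + beta g d) \<le> \<eta> * norm g"
        using adjoint_has_derivative[of d, unfolded has_derivative_at_alt] \<eta> by (auto simp: algebra_simps)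
      from g_small[OF \<delta>(1)]
      show "\<forall>\<^sub>F n in sequentially. \<forall>y\<in>K. dist (E2 n y) 0 < e"
      proof eventually_elim
        case (elim n)
        show ?case
        proof
          fix y assume y: "y \<in> K"
          let ?g = "gam v (t n, y)"
          have "norm (E2 n y) = norm (IL ?g (RR ?g d) - d + beta ?g d) / t n"
            using t(1)[of n] by (simp add: E2_def)
          also have "\<dots> \<le> (\<eta> * (C * t n)) / t n"
          proof (rule divide_right_mono)
            have "norm (IL ?g (RR ?g d) - d + beta ?g d) \<le> \<eta> * norm ?g" using \<delta>(2) elim y by blast
            also have "\<dots> \<le> \<eta> * (C * t n)" using elim y \<eta> by (intro mult_left_mono) auto
            finally show "norm (IL ?g (RR ?g d) - d + beta ?g d) \<le> \<eta> * (C * t n)" .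
          qed (use t(1)[of n] in simp)
          also have "\<dots> = \<eta> * C" using t(1)[of n] by simp
          also have "\<dots> < \<eta> * (C + 1)" using \<eta> by simp
          also have "\<dots> = e" using C(1) by (simp add: \<eta>_def)
          finally show "dist (E2 n y) 0 < e" by simp
        qed
      qed
    qed
    have blpr: "bounded_linear pr" using linear_pr linear_conv_bounded_linear by blast
    have "uniform_limit K (\<lambda>n y. pr (E1 n y) - pr (E2 n y)) (\<lambda>y. pr 0 - pr 0) sequentially"
      by (intro uniform_limit_minus bounded_linear.uniform_limit[OF blpr] E1 E2)
    then have ul12: "uniform_limit K (\<lambda>n y. pr (E1 n y) - pr (E2 n y)) (\<lambda>y. 0) sequentially" by simp
    \<comment> \<open>In the difference the two terms with \<open>IL\<close> cancel by
      \<open>gam_contact\<close>, and \<open>pr d = 0\<close> removes \<open>d\<close>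
      itself.\<close>
    have eq: "pr (fd (w n) y (LL y d)) - pr (beta (w n y) d) = pr (E1 n y) - pr (E2 n y)" if y: "y \<in> ball 0 (a4/2)" for n y
    proof -
      have yK: "y \<in> K" using y K(2) by blast
      let ?g = "gam v (t n, y)" and ?G = "G (t n, y)"
      have "?g \<in> B1" using domD(7)[OF inD[OF yK, of n]] a_B by blast
      then have lin: "linear (IL ?g)" using linear_LR(3) by blast
      have "fd (w n) y (LL y d) = (1 / t n) *\<^sub>R ?G"
        unfolding w_def G_def
        using fd_eqI[OF has_derivative_scaleR_right[OF fd_partial(1)[OF gam_C1 inD[OF yK, of n]], of "1 / t n"]] by simp
      moreover have "pr (IL ?g (RR ?g d)) + pr (IL ?g ?G) = 0"
        using gam_contact[OF inD[OF yK, of n] d] by (simp add: G_def linear_add[OF lin] linear_add[OF linear_pr])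
      ultimately show ?thesis
        using d by (simp add: w_def E1_def E2_def linear_cmul[OF linear_beta] linear_cmul[OF linear_pr] linear_add[OF linear_pr]
            linear_diff[OF linear_pr] scaleR_diff_right[symmetric] add_eq_0_iff)
    qed
    show "uniform_limit (ball 0 (a4/2)) (\<lambda>n y. pr (fd (w n) y (LL y d)) - pr (beta (w n y) d)) (\<lambda>y. 0) sequentially"
      by (rule iffD1[OF uniform_limit_cong' uniform_limit_on_subset[OF ul12 K(2)]]) (simp_all add: eq del: mem_ball mem_ball_0)
  qed
  then show ?thesis by blast
qed

text \<open>By \<open>push_eq\<close> the derivative of \<open>f\<close> at \<open>x\<close> along
  the right-invariant field of \<open>b\<close> is \<open>LL (f x) (push b (f x))\<close>. Each
  \<open>push b\<close> is of class C^n near 0, so the derivative of \<open>f\<close> is as regular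
  as \<open>f\<close> itself and the order rises by one.\<close>

proposition contact_map_smooth: "\<exists>r>0. Cn_on n (ball 0 r) f"
proof (induction n)
  case 0
  then show ?case using \<rho> Cn_on_le[OF f_C1] by blast
next
  case (Suc n)
  then obtain r1 where r1: "r1 > 0" "Cn_on n (ball 0 r1) f" by blast
  have "\<exists>r>0. Cn_on n (ball 0 r) (push b)" for b
    using push_contact[of b] contact_smooth by blast
  then obtain rb where rb: "\<And>b. rb b > 0" "\<And>b. Cn_on n (ball 0 (rb b)) (push b)" by metis
  define r2 where "r2 = Min (insert a4 (rb ` (Basis::'e set)))"
  have r2: "r2 > 0" "r2 \<le> a4" using rb(1) a_facts(5) by (auto simp: r2_def)
  have r2_le: "r2 \<le> rb b" if "b \<in> Basis" for b
    unfolding r2_def by (rule Min_le) (use that in auto)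
  obtain r3 where r3: "r3 > 0" "r3 \<le> r2" "\<And>x. x \<in> ball 0 r3 \<Longrightarrow> f x \<in> ball 0 r2"
    using fk_radius[OF r2(1)] by blast
  define r where "r = min r1 r3"
  define S where "S = ball (0::'e) r"
  have S: "open S" "S \<subseteq> ball 0 r1" "S \<subseteq> ball 0 r3" "S \<subseteq> ball 0 a4"
    using r3(2) r2(2) by (auto simp: S_def r_def)
  have S_in: "x \<in> ball 0 \<rho>" "x \<in> B2" "x \<in> B1" "x \<in> B0" "f x \<in> ball 0 r2" "f x \<in> ball 0 a4" "f x \<in> B2" "f x \<in> B0"
    if "x \<in> S" for x
  proof -
    have "x \<in> ball 0 a4" using that S(4) by blast
    then show "x \<in> ball 0 \<rho>" "x \<in> B2" "x \<in> B1" "x \<in> B0" using a_B by blast+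
    show 1: "f x \<in> ball 0 r2" using that S(3) r3(3) by blast
    then show 2: "f x \<in> ball 0 a4" using subset_ball[OF r2(2)] by blast
    then show "f x \<in> B2" "f x \<in> B0" using a_B by blast+
  qed
  have f_S: "Cn_on n S f" "Cn_on 1 S f"
    using Cn_on_subset[OF r1(2) S(2)] Cn_on_subset[OF f_C1, of S] S_in(1) by blast+
  have "Cn_on (Suc n) S f"
  proof (rule Cn_on_SucI[OF S(1)])
    show "(f has_derivative (\<lambda>h. \<Sum>b\<in>Basis. (IR x h \<bullet> b) *\<^sub>R LL (f x) (push b (f x)))) (at x)" if x: "x \<in> S" for x
    proof -
      have "fd f x (RR x b) = LL (f x) (push b (f x))" for b
        using push_eq[OF S_in(6)[OF x], of b] k_f[OF S_in(1)[OF x]] LL_IL[OF S_in(7)[OF x]] by simp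
      moreover have "linear (\<lambda>v. fd f x (RR x v))"
        using linear_compose[OF linear_LR(2)[OF S_in(4)[OF x]] C1_linear[OF f_S(2) x]] by (simp add: comp_def)
      ultimately have "fd f x h = (\<Sum>b\<in>Basis. (IR x h \<bullet> b) *\<^sub>R LL (f x) (push b (f x)))" for h
        using linear_sum_Basis[of "\<lambda>v. fd f x (RR x v)" "IR x h"] RR_IR[OF S_in(2)[OF x], of h] by simp
      then show ?thesis by (intro has_derivative_eq_rhs[OF C1_derivative[OF f_S(2) x]] ext)
    qed
    show "Cn_on n S (\<lambda>x. \<Sum>b\<in>Basis. (IR x h \<bullet> b) *\<^sub>R LL (f x) (push b (f x)))" for h
    proof (intro Cn_on_sum Cn_on_scaleR Cn_on_inner_left S(1))
      show "Cn_on n S (\<lambda>x. IR x h)"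
        by (rule Cn_on_LR(4)[OF S(1) Cn_on_ident[OF S(1)] Cn_on_const S_in(3)])
      show "Cn_on n S (\<lambda>x. LL (f x) (push b (f x)))" if b: "b \<in> Basis" for b
      proof (rule Cn_on_LR(1)[OF S(1) f_S(1) _ S_in(8)])
        show "Cn_on n S (\<lambda>x. push b (f x))"
          by (rule Cn_on_compose[OF S(1) f_S(1) rb(2)]) (use S_in(5) subset_ball[OF r2_le[OF b]] in blast)
      qed
    qed
  qed
  moreover have "r > 0" using r1(1) r3(1) by (simp add: r_def)
  ultimately show ?case unfolding S_def by blast
qed

end

section \<open>Charts of a Lie group\<close>

text \<open>What the regularity of maps into a manifold uses of its atlas. It passes to
  \<open>prod_atlas\<close> at once, so multiplication can be composed with parametrisations without
  examining transition maps of the product.\<close>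

definition charted :: "('a::topological_space, 'e::euclidean_space) chart set \<Rightarrow> bool" where
  "charted A \<longleftrightarrow> (\<Union>c\<in>A. chart_dom c) = UNIV \<and> (\<forall>c\<in>A. open (chart_dom c) \<and> inj_on (chart_map c) (chart_dom c))"

lemma smooth_atlasD:
  assumes "smooth_atlas A" "c \<in> A"
  shows "open (chart_dom c)" "open (chart_map c ` chart_dom c)" "inj_on (chart_map c) (chart_dom c)"
    "continuous_on (chart_dom c) (chart_map c)" "continuous_on (chart_map c ` chart_dom c) (chart_inv c)"
    "d \<in> A \<Longrightarrow> Ck_on \<infinity> (chart_map c ` (chart_dom c \<inter> chart_dom d)) (chart_map d \<circ> chart_inv c)"
proof -
  have h: "homeomorphism (chart_dom c) (chart_map c ` chart_dom c) (chart_map c) (chart_inv c)"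
    using assms unfolding smooth_atlas_def by blast
  show "open (chart_dom c)" "open (chart_map c ` chart_dom c)"
    using assms unfolding smooth_atlas_def by blast+
  show "continuous_on (chart_dom c) (chart_map c)" "continuous_on (chart_map c ` chart_dom c) (chart_inv c)"
    using h by (auto simp: homeomorphism_def)
  show "inj_on (chart_map c) (chart_dom c)"
    using h by (auto simp: homeomorphism_def intro: inj_on_inverseI)
  show "d \<in> A \<Longrightarrow> Ck_on \<infinity> (chart_map c ` (chart_dom c \<inter> chart_dom d)) (chart_map d \<circ> chart_inv c)"
    using assms unfolding smooth_atlas_def by blast
qed

lemma smooth_atlas_charted:
  assumes "smooth_atlas A"
  shows "charted A"
  unfolding charted_def
proof (intro conjI ballI)
  show "(\<Union>c\<in>A. chart_dom c) = UNIV" using assms unfolding smooth_atlas_def by (rule conjunct1)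
qed (simp_all add: smooth_atlasD[OF assms])

lemma chartedD:
  assumes "charted A"
  shows "\<exists>c\<in>A. x \<in> chart_dom c" "c \<in> A \<Longrightarrow> open (chart_dom c)"
    "c \<in> A \<Longrightarrow> y \<in> chart_dom c \<Longrightarrow> chart_inv c (chart_map c y) = y"
proof -
  have "x \<in> (\<Union>c\<in>A. chart_dom c)" using assms by (simp add: charted_def)
  then show "\<exists>c\<in>A. x \<in> chart_dom c" by blast
  show "c \<in> A \<Longrightarrow> open (chart_dom c)" using assms by (simp add: charted_def)
  show "c \<in> A \<Longrightarrow> y \<in> chart_dom c \<Longrightarrow> chart_inv c (chart_map c y) = y"
    using assms by (simp add: charted_def inv_into_f_f)
qed

lemma charted_prod_atlas:
  assumes "charted A" "charted B"
  shows "charted (prod_atlas A B)"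
  unfolding charted_def
proof (intro conjI ballI)
  show "(\<Union>c\<in>prod_atlas A B. chart_dom c) = UNIV"
  proof (rule sym, rule UNIV_eq_I)
    fix p :: "'a \<times> 'c"
    obtain c d where "c \<in> A" "fst p \<in> chart_dom c" "d \<in> B" "snd p \<in> chart_dom d"
      using chartedD(1)[OF assms(1)] chartedD(1)[OF assms(2)] by blast
    then have "(chart_dom c \<times> chart_dom d, map_prod (chart_map c) (chart_map d)) \<in> prod_atlas A B"
      and "p \<in> chart_dom c \<times> chart_dom d"
      unfolding prod_atlas_def by (blast, simp add: mem_Times_iff)
    then show "p \<in> (\<Union>c\<in>prod_atlas A B. chart_dom c)" by force
  qed
  fix e assume "e \<in> prod_atlas A B"
  then obtain c d where e: "e = (chart_dom c \<times> chart_dom d, map_prod (chart_map c) (chart_map d))" "c \<in> A" "d \<in> B"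
    by (auto simp: prod_atlas_def)
  show "open (chart_dom e)" using e assms by (simp add: chartedD(2) open_Times)
  show "inj_on (chart_map e) (chart_dom e)"
    using e assms unfolding charted_def by (auto simp: inj_on_def)
qed

lemma chart_at:
  assumes "charted A"
  shows "chart_at A x \<in> A" "x \<in> chart_dom (chart_at A x)"
proof -
  have "\<exists>c. c \<in> A \<and> x \<in> chart_dom c" using chartedD(1)[OF assms] by blast
  from someI_ex[OF this] show "chart_at A x \<in> A" "x \<in> chart_dom (chart_at A x)"
    unfolding chart_at_def by auto
qed

text \<open>Parametrisations by open sets of a Euclidean space: charts occur on the target side
  only, so derivatives in the parameter are ordinary ones.\<close>

definition param_Cn ::
  "nat \<Rightarrow> ('a::topological_space, 'e::euclidean_space) chart set \<Rightarrow> 'b::euclidean_space set \<Rightarrow> ('b \<Rightarrow> 'a) \<Rightarrow> bool" where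
  "param_Cn n A S F \<longleftrightarrow> continuous_on S F \<and>
     (\<forall>d\<in>A. Cn_on n {x \<in> S. F x \<in> chart_dom d} (\<lambda>x. chart_map d (F x)))"

lemma open_preimage_on:
  "open S \<Longrightarrow> continuous_on S F \<Longrightarrow> open T \<Longrightarrow> open {x \<in> S. F x \<in> T}"
  using continuous_open_preimage[of S F T] by (simp add: vimage_def Int_def)

lemma param_Cn_continuous: "param_Cn n A S F \<Longrightarrow> continuous_on S F"
  by (simp add: param_Cn_def)

lemma param_Cn_subset:
  assumes "param_Cn n A S F" "T \<subseteq> S"
  shows "param_Cn n A T F"
  unfolding param_Cn_def
proof (intro conjI ballI)
  show "continuous_on T F" using assms continuous_on_subset by (auto simp: param_Cn_def)
  show "Cn_on n {x \<in> T. F x \<in> chart_dom d} (\<lambda>x. chart_map d (F x))" if "d \<in> A" for d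
    by (rule Cn_on_subset[of n "{x \<in> S. F x \<in> chart_dom d}"]) (use assms that in \<open>auto simp: param_Cn_def\<close>)
qed

lemma param_Cn_chart:
  assumes "param_Cn n A S F" "d \<in> A" "\<And>x. x \<in> S \<Longrightarrow> F x \<in> chart_dom d"
  shows "Cn_on n S (\<lambda>x. chart_map d (F x))"
proof -
  have "{x \<in> S. F x \<in> chart_dom d} = S" using assms(3) by blast
  then show ?thesis using assms(1,2) unfolding param_Cn_def by force
qed

lemma param_Cn_const: "param_Cn n A S (\<lambda>x. a)"
  by (simp add: param_Cn_def Cn_on_const)

text \<open>Near each parameter a chart \<open>e\<close> of the intermediate manifold is inserted;
  preimages of chart domains are open, so these pieces form an open cover.\<close>

lemma param_Cn_compose_Ck_map:
  assumes A: "charted A" and B: "charted B" and "open S" and F: "param_Cn n A S F"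
    and f: "Ck_map k A B U f" and "\<And>x. x \<in> S \<Longrightarrow> F x \<in> U" and "enat n \<le> k"
  shows "param_Cn n B S (\<lambda>x. f (F x))"
  unfolding param_Cn_def
proof (intro conjI ballI)
  show c: "continuous_on S (\<lambda>x. f (F x))"
    using f assms(6) by (intro continuous_on_compose2[OF _ param_Cn_continuous[OF F]]) (auto simp: Ck_map_def)
  fix d assume d: "d \<in> B"
  define S' where "S' = {x \<in> S. f (F x) \<in> chart_dom d}"
  have S': "open S'" unfolding S'_def by (rule open_preimage_on[OF assms(3) c chartedD(2)[OF B d]])
  show "Cn_on n {x \<in> S. f (F x) \<in> chart_dom d} (\<lambda>x. chart_map d (f (F x)))"
    unfolding S'_def[symmetric]
  proof (rule Cn_on_open_cover)
    fix x assume x: "x \<in> S'"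
    obtain e where e: "e \<in> A" "F x \<in> chart_dom e" using chartedD(1)[OF A] by blast
    define T where "T = {y \<in> S. F y \<in> chart_dom e}"
    have T: "open T" unfolding T_def
      by (rule open_preimage_on[OF assms(3) param_Cn_continuous[OF F] chartedD(2)[OF A e(1)]])
    have "Cn_on n (S' \<inter> T) (\<lambda>y. (chart_map d \<circ> f \<circ> chart_inv e) (chart_map e (F y)))"
    proof (rule Cn_on_compose[where f="\<lambda>y. chart_map e (F y)"])
      show "open (S' \<inter> T)" using S' T by blast
      show "Cn_on n (S' \<inter> T) (\<lambda>y. chart_map e (F y))"
        by (rule Cn_on_subset[of n T]) (use F e(1) in \<open>auto simp: param_Cn_def T_def\<close>)
      show "Cn_on n (chart_map e ` {x \<in> U \<inter> chart_dom e. f x \<in> chart_dom d}) (chart_map d \<circ> f \<circ> chart_inv e)"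
        using f e(1) d assms(7) unfolding Ck_map_def Ck_on_def by blast
      show "chart_map e (F y) \<in> chart_map e ` {x \<in> U \<inter> chart_dom e. f x \<in> chart_dom d}" if "y \<in> S' \<inter> T" for y
        using that assms(6) by (auto simp: S'_def T_def)
    qed
    then have "Cn_on n (S' \<inter> T) (\<lambda>y. chart_map d (f (F y)))"
      by (rule Cn_on_cong) (use S' T e chartedD(3)[OF A e(1)] in \<open>auto simp: T_def\<close>)
    then show "\<exists>T. open T \<and> x \<in> T \<and> Cn_on n (S' \<inter> T) (\<lambda>y. chart_map d (f (F y)))"
      using T x e(2) by (intro exI[of _ T]) (auto simp: T_def S'_def)
  qed
qed

lemma param_Cn_Pair:
  assumes A: "charted A" and B: "charted B" and S: "open S" and F: "param_Cn n A S F" and H: "param_Cn n B S H"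
  shows "param_Cn n (prod_atlas A B) S (\<lambda>x. (F x, H x))"
  unfolding param_Cn_def
proof (intro conjI ballI)
  show "continuous_on S (\<lambda>x. (F x, H x))"
    using F H by (intro continuous_on_Pair param_Cn_continuous)
  fix e assume "e \<in> prod_atlas A B"
  then obtain c d where e: "e = (chart_dom c \<times> chart_dom d, map_prod (chart_map c) (chart_map d))" "c \<in> A" "d \<in> B"
    by (auto simp: prod_atlas_def)
  define T where "T = {x \<in> S. F x \<in> chart_dom c} \<inter> {x \<in> S. H x \<in> chart_dom d}"
  have T: "open T" unfolding T_def
    using open_preimage_on[OF S param_Cn_continuous[OF F] chartedD(2)[OF A e(2)]]
      open_preimage_on[OF S param_Cn_continuous[OF H] chartedD(2)[OF B e(3)]] by blast
  have "Cn_on n T (\<lambda>x. (chart_map c (F x), chart_map d (H x)))"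
    using F H e(2,3) by (intro Cn_on_Pair T) (auto simp: param_Cn_def T_def elim!: Cn_on_subset)
  moreover have "{x \<in> S. (F x, H x) \<in> chart_dom e} = T" by (auto simp: e T_def)
  ultimately show "Cn_on n {x \<in> S. (F x, H x) \<in> chart_dom e} (\<lambda>x. chart_map e (F x, H x))"
    by (simp add: e(1))
qed

lemma param_Cn_chart_inv:
  assumes A: "smooth_atlas A" and c: "c \<in> A"
  shows "param_Cn n A (chart_map c ` chart_dom c) (chart_inv c)"
  unfolding param_Cn_def
proof (intro conjI ballI)
  show "continuous_on (chart_map c ` chart_dom c) (chart_inv c)" using smooth_atlasD(5)[OF A c] .
  fix d assume d: "d \<in> A"
  have "{y \<in> chart_map c ` chart_dom c. chart_inv c y \<in> chart_dom d} = chart_map c ` (chart_dom c \<inter> chart_dom d)"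
    using chartedD(3)[OF smooth_atlas_charted[OF A] c] by force
  then show "Cn_on n {y \<in> chart_map c ` chart_dom c. chart_inv c y \<in> chart_dom d} (\<lambda>y. chart_map d (chart_inv c y))"
    using smooth_atlasD(6)[OF A c d] by (simp add: Ck_on_def comp_def)
qed

lemma param_Cn_reparam:
  assumes A: "charted A" and "open S" "open T" "param_Cn n A T F" "Cn_on n S g" "\<And>x. x \<in> S \<Longrightarrow> g x \<in> T"
  shows "param_Cn n A S (\<lambda>x. F (g x))"
  unfolding param_Cn_def
proof (intro conjI ballI)
  show c: "continuous_on S (\<lambda>x. F (g x))"
    using assms(6) by (intro continuous_on_compose2[OF param_Cn_continuous[OF assms(4)] Cn_on_continuous_on[OF assms(5)]]) auto
  fix d assume d: "d \<in> A"
  have o: "open {x \<in> S. F (g x) \<in> chart_dom d}" by (rule open_preimage_on[OF assms(2) c chartedD(2)[OF A d]])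
  show "Cn_on n {x \<in> S. F (g x) \<in> chart_dom d} (\<lambda>x. chart_map d (F (g x)))"
  proof (rule Cn_on_compose[where f=g and g="\<lambda>y. chart_map d (F y)", OF o])
    show "Cn_on n {x \<in> S. F (g x) \<in> chart_dom d} g" by (rule Cn_on_subset[OF assms(5)]) blast
    show "Cn_on n {x \<in> T. F x \<in> chart_dom d} (\<lambda>y. chart_map d (F y))"
      using assms(4) d by (simp add: param_Cn_def)
  qed (use assms(6) in auto)
qed

text \<open>The chain rule with the chart \<open>d\<close> inserted between \<open>F\<close> and a
  function \<open>H\<close> on the manifold. The comparisons of tangent vectors in different charts
  below are instances of it.\<close>

lemma fd_through_chart:
  assumes A: "charted A" and "open S" "u \<in> S" and F: "param_Cn 1 A S F" and d: "d \<in> A" "F u \<in> chart_dom d"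
    and H: "((\<lambda>y. H (chart_inv d y)) has_derivative H') (at (chart_map d (F u)))"
  shows "((\<lambda>x. H (F x)) has_derivative (\<lambda>v. H' (fd (\<lambda>x. chart_map d (F x)) u v))) (at u)"
proof -
  define T where "T = {x \<in> S. F x \<in> chart_dom d}"
  have T: "open T" "u \<in> T" unfolding T_def
    using open_preimage_on[OF assms(2) param_Cn_continuous[OF F] chartedD(2)[OF A d(1)]] assms(3) d(2) by auto
  have "Cn_on 1 T (\<lambda>x. chart_map d (F x))" using F d(1) by (simp add: param_Cn_def T_def)
  from has_derivative_compose[OF C1_derivative[OF this T(2)] H]
  have "((\<lambda>x. H (chart_inv d (chart_map d (F x)))) has_derivative (\<lambda>v. H' (fd (\<lambda>x. chart_map d (F x)) u v))) (at u)" .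
  then show ?thesis
    by (rule has_derivative_transform_within_open[OF _ T]) (simp add: T_def chartedD(3)[OF A d(1)])
qed

section \<open>Coordinates centred at the identity\<close>

context lie_group
begin

lemma charted_A: "charted A" using smooth_atlas_charted[OF smooth_atlas] .

lemma group_simps:
  "\<one> \<otimes> x = x" "x \<otimes> \<one> = x" "(x \<otimes> y) \<otimes> z = x \<otimes> (y \<otimes> z)" "inv x \<otimes> x = \<one>" "x \<otimes> inv x = \<one>"
  "inv x \<otimes> (x \<otimes> y) = y" "x \<otimes> (inv x \<otimes> y) = y" "inv \<one> = \<one>"
proof -
  have c: "x \<in> carrier G" for x by (simp add: carrier_UNIV)
  show 1: "\<one> \<otimes> x = x" "x \<otimes> \<one> = x" "(x \<otimes> y) \<otimes> z = x \<otimes> (y \<otimes> z)" "inv x \<otimes> x = \<one>" "x \<otimes> inv x = \<one>" "inv \<one> = \<one>" for x y z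
    using c by (simp_all add: m_assoc)
  show "inv x \<otimes> (x \<otimes> y) = y" "x \<otimes> (inv x \<otimes> y) = y" by (simp_all add: 1 flip: 1(3))
qed

lemma param_Cn_mult:
  assumes "open S" "param_Cn n A S F" "param_Cn n A S H"
  shows "param_Cn n A S (\<lambda>x. F x \<otimes> H x)"
  using param_Cn_compose_Ck_map[OF charted_prod_atlas[OF charted_A charted_A] charted_A assms(1)
      param_Cn_Pair[OF charted_A charted_A assms] smooth_mult] by simp

lemma param_Cn_inverse:
  assumes "open S" "param_Cn n A S F"
  shows "param_Cn n A S (\<lambda>x. inv (F x))"
  using param_Cn_compose_Ck_map[OF charted_A charted_A assms smooth_inverse] by simp

text \<open>The chart chosen at the identity need not send it to 0, as the local group requires;
  \<open>kap\<close> and \<open>iot\<close> include the shift, and \<open>Om\<close> is the shifted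
  image.\<close>

definition C0 :: "('a, 'e) chart" where "C0 = chart_at A \<one>"
definition kap :: "'a \<Rightarrow> 'e" where "kap x = chart_map C0 x - chart_map C0 \<one>"
definition iot :: "'e \<Rightarrow> 'a" where "iot u = chart_inv C0 (u + chart_map C0 \<one>)"
definition Om :: "'e set" where "Om = {u. u + chart_map C0 \<one> \<in> chart_map C0 ` chart_dom C0}"

lemma C0: "C0 \<in> A" "\<one> \<in> chart_dom C0"
  using chart_at[OF charted_A] by (simp_all add: C0_def)

lemma kap_iot:
  "u \<in> Om \<Longrightarrow> kap (iot u) = u" "u \<in> Om \<Longrightarrow> iot u \<in> chart_dom C0"
  "x \<in> chart_dom C0 \<Longrightarrow> iot (kap x) = x" "x \<in> chart_dom C0 \<Longrightarrow> kap x \<in> Om"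
  "iot 0 = \<one>" "kap \<one> = 0" "0 \<in> Om"
  using chartedD(3)[OF charted_A C0(1)] C0(2) by (auto simp: kap_def iot_def Om_def diff_eq_eq)

lemma open_Om: "open Om"
proof -
  have "Om = (\<lambda>u. u + chart_map C0 \<one>) -` (chart_map C0 ` chart_dom C0)" by (auto simp: Om_def)
  then show ?thesis
    using smooth_atlasD(2)[OF smooth_atlas C0(1)] by (simp add: continuous_intros open_vimage)
qed

lemma param_Cn_iot: "param_Cn n A Om iot"
  unfolding iot_def[abs_def]
proof (rule param_Cn_reparam[OF charted_A open_Om smooth_atlasD(2)[OF smooth_atlas C0(1)] param_Cn_chart_inv[OF smooth_atlas C0(1)]])
  show "Cn_on n Om (\<lambda>u. u + chart_map C0 \<one>)"
    by (intro Cn_on_add Cn_on_ident Cn_on_const open_Om)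
qed (simp add: Om_def)

lemma Cn_on_kap:
  assumes "open S" "param_Cn n A S F" "\<And>x. x \<in> S \<Longrightarrow> F x \<in> chart_dom C0"
  shows "Cn_on n S (\<lambda>x. kap (F x))"
  unfolding kap_def using param_Cn_chart[OF assms(2) C0(1) assms(3)]
  by (intro Cn_on_diff Cn_on_const assms(1))

lemma param_Cn_iot_compose:
  assumes "open S" "Cn_on n S g" "\<And>x. x \<in> S \<Longrightarrow> g x \<in> Om"
  shows "param_Cn n A S (\<lambda>x. iot (g x))"
  using param_Cn_reparam[OF charted_A assms(1) open_Om param_Cn_iot assms(2,3)] .

definition mm :: "'e \<times> 'e \<Rightarrow> 'e" where "mm p = kap (iot (fst p) \<otimes> iot (snd p))"
definition ii :: "'e \<Rightarrow> 'e" where "ii u = kap (inv (iot u))"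

lemma ex_radius: "\<exists>r>0. ball 0 r \<subseteq> Om \<and> (\<forall>u\<in>ball 0 r. inv (iot u) \<in> chart_dom C0) \<and>
  (\<forall>u\<in>ball 0 r. \<forall>v\<in>ball 0 r. iot u \<otimes> iot v \<in> chart_dom C0)"
proof -
  have oC: "open (chart_dom C0)" using chartedD(2)[OF charted_A C0(1)] .
  have oO: "open (Om \<times> Om)" using open_Om by (intro open_Times)
  have f: "param_Cn 0 A (Om \<times> Om) (\<lambda>p. iot (fst p))"
    by (rule param_Cn_iot_compose[OF oO Cn_on_fst[OF oO Cn_on_ident[OF oO]]]) auto
  have g: "param_Cn 0 A (Om \<times> Om) (\<lambda>p. iot (snd p))"
    by (rule param_Cn_iot_compose[OF oO Cn_on_snd[OF oO Cn_on_ident[OF oO]]]) auto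
  have "open {p \<in> Om \<times> Om. iot (fst p) \<otimes> iot (snd p) \<in> chart_dom C0}"
    by (rule open_preimage_on[OF oO param_Cn_continuous[OF param_Cn_mult[OF oO f g]] oC])
  moreover have "(0, 0) \<in> {p \<in> Om \<times> Om. iot (fst p) \<otimes> iot (snd p) \<in> chart_dom C0}"
    using C0(2) by (simp add: kap_iot group_simps)
  ultimately obtain S T where ST: "open S" "open T" "0 \<in> S" "0 \<in> T"
    "S \<times> T \<subseteq> {p \<in> Om \<times> Om. iot (fst p) \<otimes> iot (snd p) \<in> chart_dom C0}"
    by (elim open_prod_elim[where x="(0, 0)"]) auto
  have "open {u \<in> Om. inv (iot u) \<in> chart_dom C0}"
    by (rule open_preimage_on[OF open_Om param_Cn_continuous[OF param_Cn_inverse[OF open_Om param_Cn_iot[of 0]]] oC])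
  moreover have "0 \<in> {u \<in> Om. inv (iot u) \<in> chart_dom C0}"
    using C0(2) by (simp add: kap_iot group_simps)
  ultimately have "open (S \<inter> T \<inter> {u \<in> Om. inv (iot u) \<in> chart_dom C0})"
    "0 \<in> S \<inter> T \<inter> {u \<in> Om. inv (iot u) \<in> chart_dom C0}"
    using ST by blast+
  then obtain r where r: "r > 0" "ball 0 r \<subseteq> S \<inter> T \<inter> {u \<in> Om. inv (iot u) \<in> chart_dom C0}"
    using open_contains_ball by blast
  have "iot u \<otimes> iot v \<in> chart_dom C0" if "u \<in> ball 0 r" "v \<in> ball 0 r" for u v
  proof -
    have "(u, v) \<in> S \<times> T" using that r(2) by blast
    then have "(u, v) \<in> {p \<in> Om \<times> Om. iot (fst p) \<otimes> iot (snd p) \<in> chart_dom C0}" using ST(5) by blast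
    then show ?thesis by simp
  qed
  then show ?thesis using r by blast
qed

definition rad0 :: real where
  "rad0 = (SOME r. r > 0 \<and> ball 0 r \<subseteq> Om \<and> (\<forall>u\<in>ball 0 r. inv (iot u) \<in> chart_dom C0) \<and>
    (\<forall>u\<in>ball 0 r. \<forall>v\<in>ball 0 r. iot u \<otimes> iot v \<in> chart_dom C0))"

lemma rad0:
  "0 < rad0" "u \<in> ball 0 rad0 \<Longrightarrow> u \<in> Om" "u \<in> ball 0 rad0 \<Longrightarrow> inv (iot u) \<in> chart_dom C0"
  "u \<in> ball 0 rad0 \<Longrightarrow> v \<in> ball 0 rad0 \<Longrightarrow> iot u \<otimes> iot v \<in> chart_dom C0"
  using someI_ex[OF ex_radius] unfolding rad0_def[symmetric] by blast+

lemma iot_mm: "u \<in> ball 0 rad0 \<Longrightarrow> v \<in> ball 0 rad0 \<Longrightarrow> iot (mm (u, v)) = iot u \<otimes> iot v"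
  using rad0(4) by (simp add: mm_def kap_iot del: mem_ball mem_ball_0)

lemma iot_ii: "u \<in> ball 0 rad0 \<Longrightarrow> iot (ii u) = inv (iot u)"
  using rad0(3) by (simp add: ii_def kap_iot del: mem_ball mem_ball_0)

text \<open>The local laws are the group laws seen through \<open>kap\<close>, because
  \<open>iot\<close> turns \<open>mm\<close> and \<open>ii\<close> into multiplication and inversion
  on the ball.\<close>

sublocale L: local_lie mm ii rad0
proof
  have oB: "open (ball (0::'e) rad0 \<times> ball (0::'e) rad0)" by (intro open_Times open_ball)
  have f: "param_Cn n A (ball (0::'e) rad0 \<times> ball (0::'e) rad0) (\<lambda>p. iot (fst p))" for n
    by (rule param_Cn_iot_compose[OF oB Cn_on_fst[OF oB Cn_on_ident[OF oB]]]) (use rad0(2) in auto)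
  have g: "param_Cn n A (ball (0::'e) rad0 \<times> ball (0::'e) rad0) (\<lambda>p. iot (snd p))" for n
    by (rule param_Cn_iot_compose[OF oB Cn_on_snd[OF oB Cn_on_ident[OF oB]]]) (use rad0(2) in auto)
  show "Cn_on n (ball (0::'e) rad0 \<times> ball 0 rad0) mm" for n
    unfolding mm_def[abs_def] by (rule Cn_on_kap[OF oB param_Cn_mult[OF oB f g]]) (use rad0(4) in auto)
  show "Cn_on n (ball 0 rad0) ii" for n
    unfolding ii_def[abs_def]
  proof (rule Cn_on_kap[OF open_ball param_Cn_inverse[OF open_ball]])
    show "param_Cn n A (ball 0 rad0) iot"
      by (rule param_Cn_subset[OF param_Cn_iot]) (use rad0(2) in blast)
  qed (use rad0(3) in blast)
  fix u v w :: 'e assume u: "u \<in> ball 0 rad0"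
  show "mm (u, 0) = u" "mm (0, u) = u"
    using rad0(2)[OF u] by (simp_all add: mm_def kap_iot group_simps)
  show "mm (mm (u, v), w) = mm (u, mm (v, w))"
    if v: "v \<in> ball 0 rad0" and w: "w \<in> ball 0 rad0" "mm (u, v) \<in> ball 0 rad0" "mm (v, w) \<in> ball 0 rad0"
  proof -
    have "mm (mm (u, v), w) = kap (iot (mm (u, v)) \<otimes> iot w)" by (simp add: mm_def)
    also have "\<dots> = kap (iot u \<otimes> iot (mm (v, w)))"
      unfolding iot_mm[OF u v] iot_mm[OF v w(1)] by (simp add: group_simps)
    also have "\<dots> = mm (u, mm (v, w))" by (simp add: mm_def)
    finally show ?thesis .
  qed
  show "mm (ii u, u) = 0" "mm (u, ii u) = 0" if "ii u \<in> ball 0 rad0"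
  proof -
    have "mm (ii u, u) = kap (iot (ii u) \<otimes> iot u)" "mm (u, ii u) = kap (iot u \<otimes> iot (ii u))" by (simp_all add: mm_def)
    then show "mm (ii u, u) = 0" "mm (u, ii u) = 0" unfolding iot_ii[OF u] by (simp_all add: group_simps kap_iot)
  qed
qed (simp_all add: rad0(1) ii_def kap_iot group_simps)

lemma B0_Om: "u \<in> L.B0 \<Longrightarrow> u \<in> Om"
  using rad0(2) by (simp add: L.B0_def del: mem_ball mem_ball_0)

lemma iot_m: "u \<in> L.B0 \<Longrightarrow> v \<in> L.B0 \<Longrightarrow> iot (mm (u, v)) = iot u \<otimes> iot v"
  using iot_mm by (simp add: L.B0_def del: mem_ball mem_ball_0)

lemma param_Cn_translate: "param_Cn n A Om (\<lambda>u. x \<otimes> iot u)"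
  by (rule param_Cn_mult[OF open_Om param_Cn_const param_Cn_iot])

text \<open>The domain of the coordinate change from the chart \<open>d\<close> to
  \<open>kap\<close> after left translation by \<open>a\<close>; with \<open>a\<close> the inverse
  of \<open>x\<close> this recentres the chart at \<open>x\<close>.\<close>

definition tdom :: "('a, 'e) chart \<Rightarrow> 'a \<Rightarrow> 'e set" where
  "tdom d a = {y \<in> chart_map d ` chart_dom d. a \<otimes> chart_inv d y \<in> chart_dom C0}"

lemma chart_translate_kap:
  assumes "d \<in> A"
  shows "open (tdom d a)" "Cn_on n (tdom d a) (\<lambda>y. kap (a \<otimes> chart_inv d y))"
proof -
  have pc: "param_Cn n A (chart_map d ` chart_dom d) (\<lambda>y. a \<otimes> chart_inv d y)" for n
    by (rule param_Cn_mult[OF smooth_atlasD(2)[OF smooth_atlas assms] param_Cn_const param_Cn_chart_inv[OF smooth_atlas assms]])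
  show o: "open (tdom d a)" unfolding tdom_def
    by (rule open_preimage_on[OF smooth_atlasD(2)[OF smooth_atlas assms] param_Cn_continuous[OF pc[of 0]] chartedD(2)[OF charted_A C0(1)]])
  show "Cn_on n (tdom d a) (\<lambda>y. kap (a \<otimes> chart_inv d y))"
    by (rule Cn_on_kap[OF o param_Cn_subset[OF pc]]) (auto simp: tdom_def)
qed

text \<open>\<open>Lam d x\<close> is the differential at the identity of left translation by \<open>x\<close>, read in the chart \<open>d\<close>.\<close>

definition Lam :: "('a, 'e) chart \<Rightarrow> 'a \<Rightarrow> 'e \<Rightarrow> 'e" where
  "Lam d x a = fd (\<lambda>u. chart_map d (x \<otimes> iot u)) 0 a"

lemma Lam_has_derivative:
  assumes "d \<in> A" "x \<otimes> iot u \<in> chart_dom d" "u \<in> Om"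
  shows "((\<lambda>u. chart_map d (x \<otimes> iot u)) has_derivative fd (\<lambda>u. chart_map d (x \<otimes> iot u)) u) (at u)"
proof -
  have "Cn_on 1 {u \<in> Om. x \<otimes> iot u \<in> chart_dom d} (\<lambda>u. chart_map d (x \<otimes> iot u))"
    using param_Cn_translate[of 1 x] assms(1) by (simp add: param_Cn_def)
  from C1_derivative[OF this] show ?thesis using assms by simp
qed

lemma transition_has_derivative:
  assumes "c \<in> A" "d \<in> A" "x \<in> chart_dom c" "x \<in> chart_dom d"
  shows "((\<lambda>y. chart_map d (chart_inv c y)) has_derivative fd (\<lambda>y. chart_map d (chart_inv c y)) (chart_map c x)) (at (chart_map c x))"
proof -
  have "Cn_on 1 (chart_map c ` (chart_dom c \<inter> chart_dom d)) (\<lambda>y. chart_map d (chart_inv c y))"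
    using smooth_atlasD(6)[OF smooth_atlas assms(1,2)] by (simp add: Ck_on_def comp_def)
  from C1_derivative[OF this] show ?thesis using assms by simp
qed

text \<open>Both \<open>Lam c x a\<close> and \<open>Lam d x a\<close> are coordinates of one
  tangent vector. This matters because a field stores its value in a chart that varies with the
  point.\<close>

lemma Lam_change_chart:
  assumes "c \<in> A" "d \<in> A" "x \<in> chart_dom c" "x \<in> chart_dom d"
  shows "fd (\<lambda>y. chart_map d (chart_inv c y)) (chart_map c x) (Lam c x a) = Lam d x a"
proof -
  have "x \<otimes> iot 0 = x" by (simp add: kap_iot group_simps)
  then have "((\<lambda>u. chart_map d (x \<otimes> iot u)) has_derivative
      (\<lambda>v. fd (\<lambda>y. chart_map d (chart_inv c y)) (chart_map c x) (fd (\<lambda>u. chart_map c (x \<otimes> iot u)) 0 v))) (at 0)"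
    using transition_has_derivative[OF assms] assms
    by (intro fd_through_chart[OF charted_A open_Om kap_iot(7) param_Cn_translate]) simp_all
  from fd_eqI[OF this] show ?thesis by (simp add: Lam_def)
qed

text \<open>\<open>tangent_map\<close> uses the unshifted chart at the identity; the shift in
  \<open>iot\<close> has the identity as derivative.\<close>

lemma left_translation_tangent: "tangent_map A A (\<lambda>y. x \<otimes> y) \<one> a = Lam (chart_at A x) x a"
proof -
  let ?c = "chart_at A x"
  define g where "g = (\<lambda>w. chart_map ?c (x \<otimes> chart_inv C0 w))"
  note c = chart_at[OF charted_A, of x]
  have "((\<lambda>w. w - chart_map C0 \<one>) has_derivative (\<lambda>v. v)) (at (chart_map C0 \<one>))"
    by (auto intro!: derivative_eq_intros)
  moreover have "((\<lambda>u. chart_map ?c (x \<otimes> iot u)) has_derivative fd (\<lambda>u. chart_map ?c (x \<otimes> iot u)) 0)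
      (at (chart_map C0 \<one> - chart_map C0 \<one>))"
    using Lam_has_derivative[OF c(1), of x 0] c(2) by (simp add: kap_iot group_simps)
  ultimately have "fd (\<lambda>w. chart_map ?c (x \<otimes> iot (w - chart_map C0 \<one>))) (chart_map C0 \<one>) a = Lam ?c x a"
    unfolding Lam_def by (rule fd_compose)
  then show ?thesis
    by (simp add: tangent_map_def group_simps C0_def[symmetric] comp_def iot_def)
qed

lemma left_invariant_field_eq: "left_invariant_field G A a x = Lam (chart_at A x) x a"
  by (simp add: left_invariant_field_def left_translation_tangent)

lemma horizontal_eq: "horizontal G A D x = Lam (chart_at A x) x ` D"
  by (simp add: horizontal_def left_translation_tangent)

lemma field_in_chart_Lam:
  assumes "d \<in> A" "x \<in> chart_dom d" "Z x = Lam (chart_at A x) x a"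
  shows "field_in_chart A d Z (chart_map d x) = Lam d x a"
  using Lam_change_chart[OF chart_at(1)[OF charted_A] assms(1) chart_at(2)[OF charted_A] assms(2)] assms(3)
  by (simp add: field_in_chart_def chartedD(3)[OF charted_A assms(1,2)] comp_def)

text \<open>In the coordinate \<open>u\<close> of the point \<open>x \<otimes> iot u\<close>,
  left-invariant fields of the group become the fields \<open>LL\<close> of the local group.\<close>

lemma Lam_translate:
  assumes "d \<in> A" "x \<otimes> iot u \<in> chart_dom d" "u \<in> L.B1"
  shows "Lam d (x \<otimes> iot u) b = fd (\<lambda>u. chart_map d (x \<otimes> iot u)) u (L.LL u b)"
proof -
  have u: "u \<in> L.B0" "u \<in> Om" using assms(3) L.B_mono(1) B0_Om by auto
  have m0: "mm (u, 0) = u" using L.group_laws(1)[OF u(1)] .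
  have D1: "((\<lambda>w. mm (u, w)) has_derivative (\<lambda>v. L.d2 u 0 v)) (at 0)"
    using u by (intro L.m_has_derivative_right has_derivative_ident) auto
  have D2: "((\<lambda>u. chart_map d (x \<otimes> iot u)) has_derivative fd (\<lambda>u. chart_map d (x \<otimes> iot u)) u) (at (mm (u, 0)))"
    unfolding m0 by (rule Lam_has_derivative[OF assms(1,2) u(2)])
  have "chart_map d (x \<otimes> iot (mm (u, w))) = chart_map d ((x \<otimes> iot u) \<otimes> iot w)" if "w \<in> L.B0" for w
    using iot_m[OF u(1) that] by (simp add: group_simps)
  then have "fd (\<lambda>w. chart_map d (x \<otimes> iot (mm (u, w)))) 0 = fd (\<lambda>w. chart_map d ((x \<otimes> iot u) \<otimes> iot w)) 0"
    by (intro fd_cong_open[of L.B0]) auto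
  moreover have "fd (\<lambda>w. chart_map d (x \<otimes> iot (mm (u, w)))) 0 b = fd (\<lambda>u. chart_map d (x \<otimes> iot u)) u (L.d2 u 0 b)"
    using fd_compose[OF D1 D2] .
  ultimately show ?thesis by (simp add: Lam_def L.LL_def)
qed

end

section \<open>Contact fields and contact maps on a Lie group\<close>

text \<open>The product rule for a point-dependent linear map, when \<open>K\<close> is known to be
  differentiable on fixed vectors: expand \<open>h\<close> in the basis.\<close>

lemma linear_family_has_derivative:
  fixes K :: "'a::euclidean_space \<Rightarrow> 'b::euclidean_space \<Rightarrow> 'c::real_normed_vector"
  assumes S: "open S" "x \<in> S" and lin: "\<And>u. u \<in> S \<Longrightarrow> linear (K u)"
    and K: "\<And>v. ((\<lambda>u. K u v) has_derivative K' v) (at x)" and h: "(h has_derivative h') (at x)"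
  shows "((\<lambda>u. K u (h u)) has_derivative (\<lambda>w. K' (h x) w + K x (h' w))) (at x)"
proof -
  have sum: "((\<lambda>u. \<Sum>b\<in>Basis. (h u \<bullet> b) *\<^sub>R K u b) has_derivative
      (\<lambda>w. \<Sum>b\<in>Basis. (h x \<bullet> b) *\<^sub>R K' b w + (h' w \<bullet> b) *\<^sub>R K x b)) (at x)"
    by (intro has_derivative_sum has_derivative_scaleR has_derivative_inner_left h K)
  have K': "K' v w = (\<Sum>b\<in>Basis. (v \<bullet> b) *\<^sub>R K' b w)" for v w
  proof (rule fd_unique_on[OF S _ K])
    show "((\<lambda>u. \<Sum>b\<in>Basis. (v \<bullet> b) *\<^sub>R K u b) has_derivative (\<lambda>w. \<Sum>b\<in>Basis. (v \<bullet> b) *\<^sub>R K' b w)) (at x)"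
      by (intro has_derivative_sum has_derivative_scaleR_right K)
    show "K u v = (\<Sum>b\<in>Basis. (v \<bullet> b) *\<^sub>R K u b)" if "u \<in> S" for u
      using linear_sum_Basis[OF lin[OF that]] .
  qed
  have "(\<Sum>b\<in>Basis. (h x \<bullet> b) *\<^sub>R K' b w + (h' w \<bullet> b) *\<^sub>R K x b) = K' (h x) w + K x (h' w)" for w
    using K'[of "h x" w] linear_sum_Basis[OF lin[OF S(2)], of "h' w"] by (simp add: sum.distrib)
  then have "((\<lambda>u. \<Sum>b\<in>Basis. (h u \<bullet> b) *\<^sub>R K u b) has_derivative (\<lambda>w. K' (h x) w + K x (h' w))) (at x)"
    using sum by simp
  then show ?thesis
    by (rule has_derivative_transform_within_open[OF _ S]) (simp add: linear_sum_Basis[OF lin, symmetric])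
qed

context contact_structure
begin

text \<open>\<open>T\<close> is a change of coordinates, and symmetry of its second derivative makes
  the bracket natural. In the left-invariant frame the bracket at 0 is \<open>beta (\<zeta> 0)
  (\<xi> 0) + fd \<xi> 0 (\<zeta> 0) - fd \<zeta> 0 (\<xi> 0)\<close>. The middle term is horizontal
  because \<open>\<xi>\<close> takes horizontal values, and by the contact equation the other two
  cancel modulo the kernel of \<open>pr\<close>.\<close>

lemma bracket_horizontal:
  fixes T Z X :: "'e \<Rightarrow> 'e"
  assumes S: "open S" "0 \<in> S" "S \<subseteq> B0" and T: "Cn_on 2 S T"
    and Z: "\<And>u. u \<in> S \<Longrightarrow> Z (T u) = fd T u (LL u (\<zeta> u))" "(Z has_derivative Z') (at (T 0))"
    and X: "\<And>u. u \<in> S \<Longrightarrow> X (T u) = fd T u (LL u (\<xi> u))" "(X has_derivative X') (at (T 0))"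
    and C1: "Cn_on 1 S \<zeta>" "Cn_on 1 S \<xi>"
    and hor: "\<And>u. u \<in> S \<Longrightarrow> pr (\<xi> u) = 0"
    and contact: "\<And>v. pr v = 0 \<Longrightarrow> pr (fd \<zeta> 0 v) = pr (beta (\<zeta> 0) v)"
  shows "\<exists>v. pr v = 0 \<and> X' (Z (T 0)) - Z' (X (T 0)) = fd T 0 v"
proof -
  have T2: "Cn_on (Suc (Suc 0)) S T" using T by (simp add: numeral_2_eq_2)
  have T1: "Cn_on (Suc 0) S T" using Cn_on_SucD[OF T2] .
  have dT: "(T has_derivative fd T 0) (at 0)" using Cn_on_Suc_derivative[OF T1 S(2)] .
  have linT: "linear (fd T 0)" using has_derivative_linear[OF dT] .
  have dL: "((\<lambda>u. LL u v) has_derivative fd (\<lambda>u. LL u v) 0) (at 0)" for v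
    using LL_has_derivative[OF zero_in_B(1)] .
  have dF: "((\<lambda>u. fd T u v) has_derivative fd (\<lambda>u. fd T u v) 0) (at 0)" for v
    using Cn_on_Suc_derivative[of 0 S "\<lambda>u. fd T u v"] T2 S(2) by (simp add: Cn_on.simps(2)[of "Suc 0"])
  have eq: "F' (fd T 0 h) = fd (\<lambda>u. fd T u (\<phi> 0)) 0 h + fd T 0 (fd (\<lambda>u. LL u (\<phi> 0)) 0 h + fd \<phi> 0 h)"
    if F: "\<And>u. u \<in> S \<Longrightarrow> F (T u) = fd T u (LL u (\<phi> u))" and F': "(F has_derivative F') (at (T 0))" and \<phi>: "Cn_on 1 S \<phi>"
    for F F' :: "'e \<Rightarrow> 'e" and \<phi> h
  proof (rule fd_unique_on[where f="\<lambda>u. F (T u)" and f'="\<lambda>h. F' (fd T 0 h)" and g="\<lambda>u. fd T u (LL u (\<phi> u))", OF S(1,2) F])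
    show "((\<lambda>u. F (T u)) has_derivative (\<lambda>h. F' (fd T 0 h))) (at 0)"
      using has_derivative_compose[OF dT F'] .
    have "((\<lambda>u. LL u (\<phi> u)) has_derivative (\<lambda>h. fd (\<lambda>u. LL u (\<phi> 0)) 0 h + LL 0 (fd \<phi> 0 h))) (at 0)"
      by (rule linear_family_has_derivative[OF S(1,2) linear_LR(1) dL C1_derivative[OF \<phi> S(2)]]) (use S(3) in blast)
    then have "((\<lambda>u. LL u (\<phi> u)) has_derivative (\<lambda>h. fd (\<lambda>u. LL u (\<phi> 0)) 0 h + fd \<phi> 0 h)) (at 0)"
      by (simp add: LL_zero)
    from linear_family_has_derivative[OF S(1,2) Cn_on_Suc_linear[OF T1] dF this]
    show "((\<lambda>u. fd T u (LL u (\<phi> u))) has_derivative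
        (\<lambda>h. fd (\<lambda>u. fd T u (\<phi> 0)) 0 h + fd T 0 (fd (\<lambda>u. LL u (\<phi> 0)) 0 h + fd \<phi> 0 h))) (at 0)"
      by (simp add: LL_zero)
  qed
  define v where "v = beta (\<zeta> 0) (\<xi> 0) + fd \<xi> 0 (\<zeta> 0) - fd \<zeta> 0 (\<xi> 0)"
  have "X' (Z (T 0)) - Z' (X (T 0)) = X' (fd T 0 (\<zeta> 0)) - Z' (fd T 0 (\<xi> 0))"
    using Z(1)[OF S(2)] X(1)[OF S(2)] by (simp add: LL_zero)
  also have "\<dots> = fd T 0 (fd (\<lambda>u. LL u (\<xi> 0)) 0 (\<zeta> 0) + fd \<xi> 0 (\<zeta> 0)) - fd T 0 (fd (\<lambda>u. LL u (\<zeta> 0)) 0 (\<xi> 0) + fd \<zeta> 0 (\<xi> 0))"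
    using eq[where F=X and F'=X' and \<phi>=\<xi> and h="\<zeta> 0", OF X(1) X(2) C1(2)]
      eq[where F=Z and F'=Z' and \<phi>=\<zeta> and h="\<xi> 0", OF Z(1) Z(2) C1(1)]
      symmetric_fd[OF S(1,2) T, of "\<xi> 0" "\<zeta> 0"] by simp
  also have "\<dots> = fd T 0 v"
    by (simp add: linear_diff[OF linT, symmetric] v_def beta_def algebra_simps)
  finally have "X' (Z (T 0)) - Z' (X (T 0)) = fd T 0 v" .
  moreover have "pr v = 0"
  proof -
    have blpr: "bounded_linear pr" using linear_pr linear_conv_bounded_linear by blast
    have "pr (fd \<xi> 0 (\<zeta> 0)) = 0"
      using fd_unique_on[OF S(1,2) hor bounded_linear.has_derivative[OF blpr C1_derivative[OF C1(2) S(2)]] has_derivative_const]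
      by simp
    then show ?thesis
      using contact[OF hor[OF S(2)]] by (simp add: v_def linear_add[OF linear_pr] linear_diff[OF linear_pr])
  qed
  ultimately show ?thesis by blast
qed

end

section \<open>Transfer between the group and its local model\<close>

locale left_invariant_distribution = lie_group G A
  for G :: "'a::{t2_space, second_countable_topology} monoid" (structure)
    and A :: "('a, 'e::euclidean_space) chart set" +
  fixes pr :: "'e \<Rightarrow> 'e"
  assumes linear_pr: "linear pr"
begin

sublocale L: contact_structure mm ii rad0 pr
  by (rule contact_structure.intro[OF L.local_lie_axioms contact_structure_axioms.intro[OF linear_pr]])

abbreviation "D \<equiv> {v. pr v = 0}"

text \<open>Left translation by \<open>inv x\<close> followed by \<open>kap\<close> undoes the
  parametrisation \<open>x \<otimes> iot u\<close>.\<close>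

lemma Lam_left_inverse:
  assumes d: "d \<in> A" and x: "x \<in> chart_dom d"
  shows "fd (\<lambda>y. kap (inv x \<otimes> chart_inv d y)) (chart_map d x) (Lam d x a) = a"
    "linear (fd (\<lambda>y. kap (inv x \<otimes> chart_inv d y)) (chart_map d x))"
proof -
  have "chart_map d x \<in> tdom d (inv x)"
    using x C0(2) by (simp add: tdom_def chartedD(3)[OF charted_A d x] group_simps)
  from C1_derivative[OF chart_translate_kap(2)[OF d] this]
  have H: "((\<lambda>y. kap (inv x \<otimes> chart_inv d y)) has_derivative fd (\<lambda>y. kap (inv x \<otimes> chart_inv d y)) (chart_map d x))
      (at (chart_map d x))" .
  then show "linear (fd (\<lambda>y. kap (inv x \<otimes> chart_inv d y)) (chart_map d x))" by (rule has_derivative_linear)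
  have x0: "x \<otimes> iot 0 = x" by (simp add: kap_iot group_simps)
  have "((\<lambda>u. kap (inv x \<otimes> (x \<otimes> iot u))) has_derivative
      (\<lambda>v. fd (\<lambda>y. kap (inv x \<otimes> chart_inv d y)) (chart_map d x) (fd (\<lambda>u. chart_map d (x \<otimes> iot u)) 0 v))) (at 0)"
    using fd_through_chart[OF charted_A open_Om kap_iot(7) param_Cn_translate d, of x "\<lambda>z. kap (inv x \<otimes> z)"] H x x0
    by simp
  from fd_unique_on[OF open_Om kap_iot(7) _ this has_derivative_ident, of a]
  show "fd (\<lambda>y. kap (inv x \<otimes> chart_inv d y)) (chart_map d x) (Lam d x a) = a"
    by (simp add: Lam_def kap_iot group_simps)
qed

text \<open>Rigidity speaks of contact fields on the group, read in varying charts; this is the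
  passage from solutions of the coordinate equation to such fields.\<close>

lemma contact_field_of_contact_on:
  assumes N: "open N" "N \<subseteq> L.B2" and z: "L.contact_on N z"
  shows "contact_field G A D {x \<in> chart_dom C0. kap x \<in> N} (\<lambda>x. left_invariant_field G A (z (kap x)) x)"
proof -
  define W where "W = {x \<in> chart_dom C0. kap x \<in> N}"
  define Z where "Z = (\<lambda>x. left_invariant_field G A (z (kap x)) x)"
  have NB: "u \<in> L.B2" "u \<in> L.B1" "u \<in> L.B0" "u \<in> Om" if "u \<in> N" for u
    using that N(2) L.B_mono B0_Om by blast+
  have zC1: "Cn_on 1 N z" using L.contact_onD(1)[OF z] .
  have W: "open W"
    unfolding W_def kap_def
    by (rule open_preimage_on[OF chartedD(2)[OF charted_A C0(1)] _ N(1)])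
      (intro continuous_intros smooth_atlasD(4)[OF smooth_atlas C0(1)])
  have chart_image: "chart_map d ` (W'' \<inter> chart_dom d) = {y \<in> chart_map d ` chart_dom d. chart_inv d y \<in> W''}"
    if "d \<in> A" for d W''
    using chartedD(3)[OF charted_A that] by force
  have open_image: "open (chart_map d ` (W'' \<inter> chart_dom d))" if "d \<in> A" "open W''" for d W''
    unfolding chart_image[OF that(1)]
    by (rule open_preimage_on[OF smooth_atlasD(2,5)[OF smooth_atlas that(1)] that(2)])
  have Z_chart: "field_in_chart A d Z (chart_map d x) = Lam d x (z (kap x))" if "d \<in> A" "x \<in> chart_dom d" for d x
    by (rule field_in_chart_Lam[OF that]) (simp add: Z_def left_invariant_field_eq)
  have transl_smooth: "Cn_on n {u \<in> Om. x \<otimes> iot u \<in> chart_dom d} (\<lambda>u. chart_map d (x \<otimes> iot u))" if "d \<in> A" for n d x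
    using param_Cn_translate[of n x] that by (simp add: param_Cn_def)
  have Z_field: "Ck_field 1 A W Z"
    unfolding Ck_field_def
  proof
    fix d assume d: "d \<in> A"
    define P where "P = chart_map d ` (W \<inter> chart_dom d)"
    have P: "open P" unfolding P_def by (rule open_image[OF d W])
    define T where "T = (\<lambda>u. chart_map d (\<one> \<otimes> iot u))"
    define N' where "N' = {u \<in> N. \<one> \<otimes> iot u \<in> chart_dom d}"
    have N': "open N'"
    proof -
      have "continuous_on N (\<lambda>u. \<one> \<otimes> iot u)"
        using continuous_on_subset[OF param_Cn_continuous[OF param_Cn_translate[of 0]]] NB(4) by blast
      then show ?thesis unfolding N'_def by (rule open_preimage_on[OF N(1) _ chartedD(2)[OF charted_A d]])
    qed
    have "Cn_on 1 N' (\<lambda>u. fd T u (L.LL u (z u)))"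
    proof (rule Cn_on_fd_compose[OF N' _ Cn_on_ident[OF N']])
      show "Cn_on (Suc 1) N' T"
        unfolding T_def by (rule Cn_on_subset[OF transl_smooth[OF d]]) (use NB(4) in \<open>auto simp: N'_def\<close>)
      show "Cn_on 1 N' (\<lambda>u. L.LL u (z u))"
        by (rule L.Cn_on_LR(1)[OF N' Cn_on_ident[OF N'] Cn_on_subset[OF zC1]]) (use NB(3) in \<open>auto simp: N'_def\<close>)
    qed
    moreover have inv_P: "chart_inv d y \<in> W" "chart_inv d y \<in> chart_dom d" "chart_map d (chart_inv d y) = y" if "y \<in> P" for y
      using that chartedD(3)[OF charted_A d] by (auto simp: P_def)
    moreover have "Cn_on 1 P (\<lambda>y. kap (chart_inv d y))"
      by (rule Cn_on_kap[OF P param_Cn_subset[OF param_Cn_chart_inv[OF smooth_atlas d]]])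
        (use inv_P(1) in \<open>auto simp: P_def W_def\<close>)
    moreover have kap_N': "kap (chart_inv d y) \<in> N'" if "y \<in> P" for y
      using inv_P(1,2)[OF that] by (auto simp: N'_def W_def kap_iot group_simps)
    ultimately have "Cn_on 1 P (\<lambda>y. fd T (kap (chart_inv d y)) (L.LL (kap (chart_inv d y)) (z (kap (chart_inv d y)))))"
      by (intro Cn_on_compose[OF P, where f="\<lambda>y. kap (chart_inv d y)" and g="\<lambda>u. fd T u (L.LL u (z u))" and T=N'])
    moreover have "fd T (kap (chart_inv d y)) (L.LL (kap (chart_inv d y)) (z (kap (chart_inv d y)))) = field_in_chart A d Z y" if y: "y \<in> P" for y
    proof -
      let ?x = "chart_inv d y"
      have x: "\<one> \<otimes> iot (kap ?x) = ?x" using inv_P(1)[OF y] by (simp add: W_def kap_iot group_simps)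
      have "field_in_chart A d Z y = Lam d (\<one> \<otimes> iot (kap ?x)) (z (kap ?x))"
        using Z_chart[OF d inv_P(2)[OF y]] inv_P(3)[OF y] unfolding x by simp
      also have "\<dots> = fd T (kap ?x) (L.LL (kap ?x) (z (kap ?x)))"
        unfolding T_def
        by (rule Lam_translate[OF d]) (use x inv_P(2)[OF y] kap_N'[OF y] NB(2) in \<open>auto simp: N'_def\<close>)
      finally show ?thesis by simp
    qed
    ultimately have "Cn_on 1 P (field_in_chart A d Z)"
      by (rule Cn_on_cong[OF _ P])
    then show "Ck_on 1 (chart_map d ` (W \<inter> chart_dom d)) (field_in_chart A d Z)"
      unfolding P_def[symmetric] Ck_on_def using Cn_on_le by (auto simp: one_enat_def)
  qed
  \<comment> \<open>The bracket at \<open>x0\<close> is computed in coordinates centred there by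
    left translation. The representing function becomes a left translate of \<open>z\<close>, hence
    is again a solution, and the contact equation enters at 0 only.\<close>
  have "field_bracket A Z X x0 \<in> horizontal G A D x0"
    if W': "open W'" "W' \<subseteq> W" and X: "Ck_field \<infinity> A W' X" and hor: "\<And>x. x \<in> W' \<Longrightarrow> X x \<in> horizontal G A D x" and x0: "x0 \<in> W'"
    for W' X x0
  proof -
    define d where "d = chart_at A x0"
    have d: "d \<in> A" "x0 \<in> chart_dom d" using chart_at[OF charted_A] by (simp_all add: d_def)
    define y0 where "y0 = kap x0"
    have y0: "y0 \<in> N" "iot y0 = x0" using x0 W'(2) by (auto simp: y0_def W_def kap_iot)
    define T where "T = (\<lambda>u. chart_map d (x0 \<otimes> iot u))"
    define S where "S = {u \<in> L.B2. x0 \<otimes> iot u \<in> W' \<inter> chart_dom d}"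
    have B2_Om: "L.B2 \<subseteq> Om" using L.B_mono B0_Om by blast
    have S: "open S"
      unfolding S_def
      by (rule open_preimage_on[OF L.open_B(3) continuous_on_subset[OF param_Cn_continuous[OF param_Cn_translate[of 0]] B2_Om]])
        (use W'(1) chartedD(2)[OF charted_A d(1)] in blast)
    have T0: "x0 \<otimes> iot 0 = x0" by (simp add: kap_iot group_simps)
    have S0: "0 \<in> S" using x0 d(2) T0 by (simp add: S_def)
    have S_B: "u \<in> L.B2" "u \<in> L.B1" "u \<in> L.B0" "u \<in> Om" "x0 \<otimes> iot u \<in> W'" "x0 \<otimes> iot u \<in> chart_dom d" if "u \<in> S" for u
      using that L.B_mono B0_Om by (auto simp: S_def)
    have T_Cn: "Cn_on n S T" for n
      unfolding T_def by (rule Cn_on_subset[OF transl_smooth[OF d(1)]]) (use S_B in auto)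
    have inv_T: "chart_inv d (T u) = x0 \<otimes> iot u" if "u \<in> S" for u
      using chartedD(3)[OF charted_A d(1) S_B(6)[OF that]] by (simp add: T_def)
    define \<zeta> where "\<zeta> = (\<lambda>u. z (mm (y0, u)))"
    have mm_kap: "mm (y0, u) = kap (x0 \<otimes> iot u)" for u by (simp add: mm_def y0(2))
    have \<zeta>: "L.contact_on S \<zeta>"
      unfolding \<zeta>_def
    proof (rule L.contact_on_translate[OF z N(1) NB(2)[OF y0(1)] S])
      show "S \<subseteq> L.B1" using S_B(2) by blast
      show "mm (y0, u) \<in> N" if "u \<in> S" for u
        using S_B(5)[OF that] W'(2) by (auto simp: mm_kap W_def)
    qed
    define Z' where "Z' = field_in_chart A d Z"
    define X' where "X' = field_in_chart A d X"
    have Z'_T: "Z' (T u) = fd T u (L.LL u (\<zeta> u))" if u: "u \<in> S" for u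
    proof -
      have "Z' (T u) = Lam d (x0 \<otimes> iot u) (\<zeta> u)"
        using Z_chart[OF d(1) S_B(6)[OF u]] by (simp add: Z'_def T_def \<zeta>_def mm_kap)
      then show ?thesis using Lam_translate[OF d(1) S_B(6)[OF u] S_B(2)[OF u]] by (simp add: T_def)
    qed
    define Ti where "Ti = (\<lambda>y. kap (inv x0 \<otimes> chart_inv d y))"
    define P where "P = tdom d (inv x0)"
    have Ti_Cn: "Cn_on n P Ti" for n
      unfolding Ti_def P_def by (rule chart_translate_kap(2)[OF d(1)])
    have T_P: "T u \<in> P" if "u \<in> S" for u
      using S_B(4,6)[OF that] inv_T[OF that] by (auto simp: P_def tdom_def group_simps kap_iot T_def)
    have Ti_T: "Ti (T u) = u" if "u \<in> S" for u
      using S_B(4)[OF that] inv_T[OF that] by (simp add: Ti_def group_simps kap_iot)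
    have fd_Ti_T: "fd Ti (T u) (fd T u h) = h" if u: "u \<in> S" for u h
      using fd_unique_on[OF S u Ti_T has_derivative_compose[OF C1_derivative[OF T_Cn u] C1_derivative[OF Ti_Cn T_P[OF u]]]
          has_derivative_ident] .
    \<comment> \<open>The coordinates of \<open>X\<close> in the left-invariant frame. The explicit
      formula shows their regularity; comparison with the vector \<open>a\<close> from the
      horizontality of \<open>X\<close> shows that they lie in the kernel of
      \<open>pr\<close>.\<close>
    define \<xi> where "\<xi> = (\<lambda>u. L.IL u (fd Ti (T u) (X' (T u))))"
    define PX where "PX = chart_map d ` (W' \<inter> chart_dom d)"
    have PX: "open PX" unfolding PX_def by (rule open_image[OF d(1) W'(1)])
    have X'_Cn: "Cn_on n PX X'" for n
      using X d(1) by (simp add: Ck_field_def Ck_on_def X'_def PX_def)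
    have T_PX: "T u \<in> PX" if "u \<in> S" for u
      using S_B(5,6)[OF that] by (auto simp: PX_def T_def)
    have \<xi>_C1: "Cn_on 1 S \<xi>"
      unfolding \<xi>_def
    proof (rule L.Cn_on_LR(3)[OF S Cn_on_ident[OF S]])
      show "Cn_on 1 S (\<lambda>u. fd Ti (T u) (X' (T u)))"
        by (rule Cn_on_fd_compose[OF S Ti_Cn T_Cn Cn_on_compose[OF S T_Cn X'_Cn T_PX] T_P])
    qed (rule S_B(2))
    have \<xi>: "pr (\<xi> u) = 0 \<and> X' (T u) = fd T u (L.LL u (\<xi> u))" if u: "u \<in> S" for u
    proof -
      obtain a where a: "pr a = 0" "X (x0 \<otimes> iot u) = Lam (chart_at A (x0 \<otimes> iot u)) (x0 \<otimes> iot u) a"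
        using hor[OF S_B(5)[OF u]] unfolding horizontal_eq by blast
      have X'a: "X' (T u) = fd T u (L.LL u a)"
        using field_in_chart_Lam[where Z=X, OF d(1) S_B(6)[OF u] a(2)] Lam_translate[OF d(1) S_B(6)[OF u] S_B(2)[OF u]]
        by (simp add: X'_def T_def)
      then have "\<xi> u = a" by (simp add: \<xi>_def fd_Ti_T[OF u] L.IL_LL[OF S_B(1)[OF u]])
      then show ?thesis using a(1) X'a by simp
    qed
    have Z'_der: "(Z' has_derivative fd Z' (T 0)) (at (T 0))"
    proof (rule C1_derivative)
      show "Cn_on 1 (chart_map d ` (W \<inter> chart_dom d)) Z'"
        using Z_field d(1) by (simp add: Ck_field_def Ck_on_def Z'_def one_enat_def)
      show "T 0 \<in> chart_map d ` (W \<inter> chart_dom d)"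
        using x0 W'(2) d(2) by (auto simp: T_def T0)
    qed
    have "\<exists>v. pr v = 0 \<and> fd X' (T 0) (Z' (T 0)) - fd Z' (T 0) (X' (T 0)) = fd T 0 v"
    proof (rule L.bracket_horizontal[OF S S0 _ T_Cn Z'_T Z'_der _ C1_derivative[OF X'_Cn T_PX[OF S0]] L.contact_onD(1)[OF \<zeta>] \<xi>_C1])
      show "pr (fd \<zeta> 0 v) = pr (L.beta (\<zeta> 0) v)" if "pr v = 0" for v
        using L.contact_onD(2)[OF \<zeta> S0 that] by (simp add: L.LL_zero)
    qed (use \<xi> S_B(3) in auto)
    moreover have "field_bracket A Z X x0 = fd X' (T 0) (Z' (T 0)) - fd Z' (T 0) (X' (T 0))"
      by (simp add: field_bracket_def Let_def d_def[symmetric] Z'_def X'_def T_def T0)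
    ultimately show ?thesis
      by (auto simp: horizontal_eq d_def[symmetric] Lam_def T_def)
  qed
  then show ?thesis
    unfolding contact_field_def W_def[symmetric] Z_def[symmetric] using W Z_field by blast
qed

text \<open>The spanning contact fields serve as their own index set. The linear map
  \<open>Li\<close> reads a field in the left-invariant frame, so an expansion of \<open>Z\<close>
  becomes one of \<open>z\<close> with the same coefficients.\<close>

lemma rigid_contact_germs:
  assumes "finite_dim_contact_germs G A D \<one>"
  shows "\<exists>(B :: ('a \<Rightarrow> 'e) set) Psi. rigid_contact mm ii rad0 pr B Psi"
proof -
  obtain B where B: "finite B" "\<And>Z. contact_field_near G A D \<one> Z \<Longrightarrow> \<exists>r. eventually (\<lambda>x. Z x = (\<Sum>Y\<in>B. r Y *\<^sub>R Y x)) (nhds \<one>)"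
    using assms unfolding finite_dim_contact_germs_def by blast
  define Li where "Li = (\<lambda>x. fd (\<lambda>y. kap (inv x \<otimes> chart_inv (chart_at A x) y)) (chart_map (chart_at A x) x))"
  have Li: "Li x (Lam (chart_at A x) x a) = a" "linear (Li x)" for x a
    unfolding Li_def using Lam_left_inverse[OF chart_at[OF charted_A]] by blast+
  define Psi where "Psi = (\<lambda>Y u. Li (iot u) (Y (iot u)))"
  have "rigid_contact mm ii rad0 pr B Psi"
  proof unfold_locales
    show "finite B" by (rule B(1))
    fix N z assume N: "open N" "0 \<in> N" and z: "L.contact_on N z"
    define N' where "N' = N \<inter> L.B2"
    define Z where "Z = (\<lambda>x. left_invariant_field G A (z (kap x)) x)"
    have N': "open N'" "0 \<in> N'" "N' \<subseteq> L.B2" "N' \<subseteq> N" "N' \<subseteq> Om"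
      using N L.B_mono B0_Om by (auto simp: N'_def)
    have "contact_field_near G A D \<one> Z"
      unfolding contact_field_near_def Z_def
      using contact_field_of_contact_on[OF N'(1,3) L.contact_on_subset[OF z N'(4)]] N'(2) C0(2)
      by (intro exI[of _ "{x \<in> chart_dom C0. kap x \<in> N'}"]) (simp add: kap_iot)
    from B(2)[OF this] obtain r where r: "eventually (\<lambda>x. Z x = (\<Sum>Y\<in>B. r Y *\<^sub>R Y x)) (nhds \<one>)" by blast
    have "continuous_on Om iot" using param_Cn_continuous[OF param_Cn_iot[of 0]] .
    then have "isCont iot 0" using open_Om kap_iot(7) by (simp add: continuous_on_eq_continuous_at)
    then have "filterlim iot (nhds \<one>) (nhds 0)"
      unfolding isCont_def tendsto_at_iff_tendsto_nhds by (simp add: kap_iot)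
    then have "\<forall>\<^sub>F u in nhds 0. Z (iot u) = (\<Sum>Y\<in>B. r Y *\<^sub>R Y (iot u))"
      using r eventually_compose_filterlim by blast
    moreover have "\<forall>\<^sub>F u in nhds 0. u \<in> N'" using N'(1,2) by (rule eventually_nhds_in_open)
    ultimately have "\<forall>\<^sub>F u in nhds 0. z u = (\<Sum>Y\<in>B. r Y *\<^sub>R Psi Y u)"
    proof eventually_elim
      case (elim u)
      have ku: "kap (iot u) = u" using elim(2) N'(5) kap_iot(1) by blast
      have "z u = Li (iot u) (Z (iot u))"
        by (simp add: Z_def left_invariant_field_eq Li ku)
      also have "\<dots> = (\<Sum>Y\<in>B. r Y *\<^sub>R Psi Y u)"
        unfolding elim(1) by (simp add: linear_sum[OF Li(2)] linear_cmul[OF Li(2)] Psi_def)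
      finally show ?case .
    qed
    then show "\<exists>r. \<forall>\<^sub>F u in nhds 0. z u = (\<Sum>Y\<in>B. r Y *\<^sub>R Psi Y u)" by blast
  qed
  then show ?thesis by blast
qed


text \<open>Left translations are smooth and preserve the horizontal bundle, so \<open>f\<close>
  near \<open>p\<close> may be replaced by the germ \<open>ft\<close> at the identity that fixes 0.
  The neighbourhood may depend on \<open>n\<close>.\<close>

lemma contact_map_smooth_at:
  assumes germs: "finite_dim_contact_germs G A D \<one>" and f: "contact_map 1 G A D U f" and p: "p \<in> U"
    and c: "c \<in> A" "p \<in> chart_dom c" and e: "e \<in> A"
  shows "\<exists>T. open T \<and> chart_map c p \<in> T \<and>
    Cn_on n (chart_map c ` {x \<in> U \<inter> chart_dom c. f x \<in> chart_dom e} \<inter> T) (chart_map e \<circ> f \<circ> chart_inv c)"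
proof -
  obtain B :: "('a \<Rightarrow> 'e) set" and Psi where rc: "rigid_contact mm ii rad0 pr B Psi"
    using rigid_contact_germs[OF germs] by blast
  obtain V where V: "open V" "p \<in> V" "V \<subseteq> U" "open (f ` V)" "inj_on f V"
    "Ck_map 1 A A V f" "Ck_map 1 A A (f ` V) (inv_into V f)"
    using f p unfolding contact_map_def Ck_local_diffeo_def by blast
  define g where "g = inv_into V f"
  have g_f: "g (f x) = x" if "x \<in> V" for x using that V(5) by (simp add: g_def)
  have f_g: "f (g y) = y" "g y \<in> V" if "y \<in> f ` V" for y
    using that by (simp_all add: g_def f_inv_into_f inv_into_into)
  have oC: "open (chart_dom C0)" using chartedD(2)[OF charted_A C0(1)] .
  have one: "enat 1 \<le> 1" by (simp add: one_enat_def)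
  define ft where "ft = (\<lambda>u. kap (inv (f p) \<otimes> f (p \<otimes> iot u)))"
  define kt where "kt = (\<lambda>u. kap (inv p \<otimes> g (f p \<otimes> iot u)))"
  \<comment> \<open>Kept general because it is used for \<open>f\<close>, for its local inverse, and
    again for \<open>f\<close> at points \<open>q\<close> near \<open>p\<close>.\<close>
  have in_coordinates: "\<exists>S. open S \<and> 0 \<in> S \<and> Cn_on 1 S (\<lambda>u. kap (inv b \<otimes> h (a \<otimes> iot u))) \<and>
      (\<forall>u\<in>S. u \<in> Om \<and> a \<otimes> iot u \<in> Y \<and> inv b \<otimes> h (a \<otimes> iot u) \<in> chart_dom C0) \<and>
      param_Cn 1 A S (\<lambda>u. h (a \<otimes> iot u))"
    if Y: "open Y" "a \<in> Y" and h: "Ck_map 1 A A Y h" "h a = b" for a b Y h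
  proof -
    define S1 where "S1 = {u \<in> Om. a \<otimes> iot u \<in> Y}"
    have S1: "open S1" unfolding S1_def
      by (rule open_preimage_on[OF open_Om param_Cn_continuous[OF param_Cn_translate[of 0]] Y(1)])
    have "param_Cn 1 A S1 (\<lambda>u. a \<otimes> iot u)" by (rule param_Cn_subset[OF param_Cn_translate]) (auto simp: S1_def)
    then have p1: "param_Cn 1 A S1 (\<lambda>u. h (a \<otimes> iot u))"
      by (rule param_Cn_compose_Ck_map[OF charted_A charted_A S1 _ h(1) _ one]) (simp add: S1_def)
    have p2: "param_Cn 1 A S1 (\<lambda>u. inv b \<otimes> h (a \<otimes> iot u))"
      by (rule param_Cn_mult[OF S1 param_Cn_const p1])
    define S where "S = {u \<in> S1. inv b \<otimes> h (a \<otimes> iot u) \<in> chart_dom C0}"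
    have S: "open S" unfolding S_def by (rule open_preimage_on[OF S1 param_Cn_continuous[OF p2] oC])
    have "Cn_on 1 S (\<lambda>u. kap (inv b \<otimes> h (a \<otimes> iot u)))"
      by (rule Cn_on_kap[OF S param_Cn_subset[OF p2]]) (auto simp: S_def)
    moreover have "0 \<in> S" using Y(2) h(2) C0(2) by (simp add: S_def S1_def kap_iot group_simps)
    moreover have "param_Cn 1 A S (\<lambda>u. h (a \<otimes> iot u))" by (rule param_Cn_subset[OF p1]) (auto simp: S_def)
    ultimately show ?thesis using S by (intro exI[of _ S]) (auto simp: S_def S1_def)
  qed
  obtain Sf where Sf: "open Sf" "0 \<in> Sf" "Cn_on 1 Sf ft" "\<And>u. u \<in> Sf \<Longrightarrow> u \<in> Om" "\<And>u. u \<in> Sf \<Longrightarrow> p \<otimes> iot u \<in> V"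
    "\<And>u. u \<in> Sf \<Longrightarrow> inv (f p) \<otimes> f (p \<otimes> iot u) \<in> chart_dom C0"
    using in_coordinates[OF V(1,2,6) refl] unfolding ft_def by blast
  have fp: "f p \<in> f ` V" "g (f p) = p" using V(2) g_f by auto
  obtain Sk where Sk: "open Sk" "0 \<in> Sk" "Cn_on 1 Sk kt" "\<And>u. u \<in> Sk \<Longrightarrow> u \<in> Om" "\<And>u. u \<in> Sk \<Longrightarrow> f p \<otimes> iot u \<in> f ` V"
    "\<And>u. u \<in> Sk \<Longrightarrow> inv p \<otimes> g (f p \<otimes> iot u) \<in> chart_dom C0"
    using in_coordinates[OF V(4) fp(1) V(7)[folded g_def] fp(2)] unfolding kt_def by blast
  have iot_ft: "iot (ft u) = inv (f p) \<otimes> f (p \<otimes> iot u)" "ft u \<in> Om" if "u \<in> Sf" for u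
    using Sf(6)[OF that] by (simp_all add: ft_def kap_iot)
  have iot_kt: "iot (kt u) = inv p \<otimes> g (f p \<otimes> iot u)" if "u \<in> Sk" for u
    using Sk(6)[OF that] by (simp add: kt_def kap_iot)
  have ft0: "ft 0 = 0" "kt 0 = 0" using fp(2) by (simp_all add: ft_def kt_def kap_iot group_simps)
  define S where "S = Sf \<inter> Sk \<inter> L.B1 \<inter> {u \<in> Sf. ft u \<in> L.B1}"
  have "open S" unfolding S_def
    by (intro open_Int Sf(1) Sk(1) L.open_B(2) open_preimage_on[OF Sf(1) Cn_on_continuous_on[OF Sf(3)] L.open_B(2)])
  moreover have "0 \<in> S"
    using Sf(2) Sk(2) ft0 by (simp add: S_def)
  ultimately obtain \<rho> where \<rho>: "\<rho> > 0" "ball 0 \<rho> \<subseteq> S" using open_contains_ball by blast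
  have \<rho>S: "u \<in> Sf" "u \<in> Sk" "u \<in> L.B1" "u \<in> L.B0" "ft u \<in> L.B1" "ft u \<in> L.B0" if "u \<in> ball 0 \<rho>" for u
    using that \<rho>(2) L.B_mono(1) by (auto simp: S_def subset_iff simp del: mem_ball mem_ball_0)
  have contact: "\<exists>v'. pr v' = 0 \<and> fd ft x (L.LL x v) = L.LL (ft x) v'" if x: "x \<in> ball 0 \<rho>" and v: "pr v = 0" for x v
  proof -
    define q where "q = p \<otimes> iot x"
    have q: "q \<in> V" "q \<in> U" using Sf(5)[OF \<rho>S(1)[OF x]] V(3) by (auto simp: q_def)
    define cq where "cq = chart_at A q"
    define d where "d = chart_at A (f q)"
    have cq: "cq \<in> A" "q \<in> chart_dom cq" and d: "d \<in> A" "f q \<in> chart_dom d"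
      using chart_at[OF charted_A] by (simp_all add: cq_def d_def)
    have q0: "q \<otimes> iot 0 = q" "f q \<otimes> iot 0 = f q" by (simp_all add: kap_iot group_simps)
    obtain Sq where Sq: "open Sq" "0 \<in> Sq" "param_Cn 1 A Sq (\<lambda>u. f (q \<otimes> iot u))" "\<And>u. u \<in> Sq \<Longrightarrow> u \<in> Om"
      using in_coordinates[OF V(1) q(1) V(6) refl] by blast
    have f_cq: "((\<lambda>y. chart_map d (f (chart_inv cq y))) has_derivative
        fd (\<lambda>y. chart_map d (f (chart_inv cq y))) (chart_map cq q)) (at (chart_map cq q))"
    proof (rule C1_derivative)
      show "Cn_on 1 (chart_map cq ` {x \<in> V \<inter> chart_dom cq. f x \<in> chart_dom d}) (\<lambda>y. chart_map d (f (chart_inv cq y)))"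
        using V(6) cq(1) d(1) one by (simp add: Ck_map_def Ck_on_def comp_def)
      show "chart_map cq q \<in> chart_map cq ` {x \<in> V \<inter> chart_dom cq. f x \<in> chart_dom d}"
        using q cq d by blast
    qed
    have "((\<lambda>u. chart_map d (f (q \<otimes> iot u))) has_derivative
        (\<lambda>v. fd (\<lambda>y. chart_map d (f (chart_inv cq y))) (chart_map cq q) (Lam cq q v))) (at 0)"
      using fd_through_chart[OF charted_A open_Om kap_iot(7) param_Cn_translate cq(1), of q "\<lambda>z. chart_map d (f z)"]
        f_cq cq(2) q0 by (simp add: Lam_def)
    from fd_eqI[OF this]
    have tan: "tangent_map A A f q (Lam cq q v) = fd (\<lambda>u. chart_map d (f (q \<otimes> iot u))) 0 v"
      by (simp add: tangent_map_def cq_def[symmetric] d_def[symmetric] comp_def)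
    have "tangent_map A A f q ` horizontal G A D q \<subseteq> horizontal G A D (f q)"
      using f q(2) unfolding contact_map_def by blast
    then have "tangent_map A A f q (Lam cq q v) \<in> Lam d (f q) ` D"
      using v unfolding horizontal_eq cq_def[symmetric] d_def[symmetric] by blast
    then obtain v' where v': "pr v' = 0" "fd (\<lambda>u. chart_map d (f (q \<otimes> iot u))) 0 v = Lam d (f q) v'"
      unfolding tan by blast
    \<comment> \<open>Through \<open>H\<close> the curve family \<open>f (q \<otimes> iot u)\<close>
      becomes \<open>ft (mm (x, u))\<close>, and \<open>f q \<otimes> iot u\<close> becomes
      \<open>mm (ft x, u)\<close>. Comparing derivatives at \<open>u = 0\<close> turns the inclusion
      of tangent vectors in charts into one in the frame \<open>LL\<close>.\<close>
    define H where "H = (\<lambda>z. kap (inv (f p) \<otimes> z))"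
    define H' where "H' = fd (\<lambda>y. H (chart_inv d y)) (chart_map d (f q))"
    have H': "((\<lambda>y. H (chart_inv d y)) has_derivative H') (at (chart_map d (f q)))"
    proof -
      have "Cn_on 1 (tdom d (inv (f p))) (\<lambda>y. H (chart_inv d y))"
        unfolding H_def by (rule chart_translate_kap(2)[OF d(1)])
      moreover have "chart_map d (f q) \<in> tdom d (inv (f p))"
        using d(2) Sf(6)[OF \<rho>S(1)[OF x]] by (simp add: tdom_def chartedD(3)[OF charted_A d] q_def[symmetric])
      ultimately show ?thesis unfolding H'_def by (rule C1_derivative)
    qed
    have iq: "iot (ft x) = inv (f p) \<otimes> f q" using iot_ft(1)[OF \<rho>S(1)[OF x]] by (simp add: q_def)
    have l1: "((\<lambda>u. H (f (q \<otimes> iot u))) has_derivative (\<lambda>v. H' (fd (\<lambda>u. chart_map d (f (q \<otimes> iot u))) 0 v))) (at 0)"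
      using fd_through_chart[OF charted_A Sq(1,2,3) d(1), of H H'] H' d(2) q0 by simp
    have r1: "((\<lambda>u. H (f q \<otimes> iot u)) has_derivative (\<lambda>v. H' (Lam d (f q) v))) (at 0)"
      using fd_through_chart[OF charted_A open_Om kap_iot(7) param_Cn_translate d(1), of "f q" H H'] H' d(2) q0
      by (simp add: Lam_def)
    have l2: "((\<lambda>u. ft (mm (x, u))) has_derivative (\<lambda>v. fd ft x (L.LL x v))) (at 0)"
    proof -
      have m0: "mm (x, 0) = x" using L.group_laws(1)[OF \<rho>S(4)[OF x]] .
      have "((\<lambda>u. mm (x, u)) has_derivative (\<lambda>v. L.LL x v)) (at 0)"
        unfolding L.LL_def using \<rho>S(4)[OF x] by (intro L.m_has_derivative_right has_derivative_ident) auto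
      moreover have "(ft has_derivative fd ft x) (at (mm (x, 0)))"
        unfolding m0 using C1_derivative[OF Sf(3) \<rho>S(1)[OF x]] .
      ultimately show ?thesis by (rule has_derivative_compose)
    qed
    have "H (f (q \<otimes> iot u)) = ft (mm (x, u))" if "u \<in> L.B0" for u
      by (simp add: H_def ft_def q_def iot_m[OF \<rho>S(4)[OF x] that] group_simps)
    from fd_unique_on[OF L.open_B(1) L.zero_in_B(1) this l1 l2]
    have left: "H' (fd (\<lambda>u. chart_map d (f (q \<otimes> iot u))) 0 v) = fd ft x (L.LL x v)" .
    have r2: "((\<lambda>u. mm (ft x, u)) has_derivative (\<lambda>v. L.LL (ft x) v)) (at 0)"
      unfolding L.LL_def using \<rho>S(6)[OF x] by (intro L.m_has_derivative_right has_derivative_ident) auto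
    have "H (f q \<otimes> iot u) = mm (ft x, u)" if "u \<in> L.B0" for u
      by (simp add: H_def mm_def iq group_simps)
    from fd_unique_on[OF L.open_B(1) L.zero_in_B(1) this r1 r2]
    have "H' (Lam d (f q) v') = L.LL (ft x) v'" .
    then show ?thesis using left v' by auto
  qed
  have "contact_map_germ mm ii rad0 pr B Psi ft kt \<rho>"
  proof (rule contact_map_germ.intro[OF rc contact_map_germ_axioms.intro])
    show "0 < \<rho>" by (rule \<rho>(1))
    show "Cn_on 1 (ball 0 \<rho>) ft" "Cn_on 1 (ball 0 \<rho>) kt"
      using Cn_on_subset[OF Sf(3)] Cn_on_subset[OF Sk(3)] \<rho>S(1,2) by blast+
    show "ft (kt y) = y" if "y \<in> ball 0 \<rho>" for y
    proof -
      note y = \<rho>S(2)[OF that]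
      have "ft (kt y) = kap (inv (f p) \<otimes> f (g (f p \<otimes> iot y)))" by (simp add: ft_def iot_kt[OF y] group_simps)
      then show ?thesis using f_g(1)[OF Sk(5)[OF y]] Sk(4)[OF y] by (simp add: group_simps kap_iot)
    qed
    show "kt (ft x) = x" if "x \<in> ball 0 \<rho>" for x
    proof -
      note x = \<rho>S(1)[OF that]
      have "kt (ft x) = kap (inv p \<otimes> g (f (p \<otimes> iot x)))" by (simp add: kt_def iot_ft(1)[OF x] group_simps)
      then show ?thesis using g_f[OF Sf(5)[OF x]] Sf(4)[OF x] by (simp add: group_simps kap_iot)
    qed
  qed (use ft0 contact in auto)
  from contact_map_germ.contact_map_smooth[OF this, of n]
  obtain r where r: "r > 0" "Cn_on n (ball 0 r) ft" by blast
  define r' where "r' = min r \<rho>"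
  have r': "r' > 0" "ball 0 r' \<subseteq> ball (0::'e) r" "ball 0 r' \<subseteq> ball (0::'e) \<rho>"
    using r(1) \<rho>(1) by (auto simp: r'_def)
  define P1 where "P1 = tdom c (inv p)"
  have P1: "open P1" unfolding P1_def by (rule chart_translate_kap(1)[OF c(1)])
  define h where "h = (\<lambda>y. kap (inv p \<otimes> chart_inv c y))"
  have h: "Cn_on n P1 h" unfolding h_def P1_def by (rule chart_translate_kap(2)[OF c(1)])
  define Q where "Q = {y \<in> P1. h y \<in> ball 0 r'}"
  have Q: "open Q" unfolding Q_def
    by (rule open_preimage_on[OF P1 Cn_on_continuous_on[OF h] open_ball])
  have pQ: "chart_map c p \<in> Q"
    using c C0(2) r'(1) by (auto simp: Q_def P1_def tdom_def h_def chartedD(3)[OF charted_A c] group_simps kap_iot)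
  \<comment> \<open>Undoes the centring: on \<open>Q\<close> this is \<open>f\<close> read in the
    chart \<open>c\<close>, now composed of pieces of class C^n.\<close>
  define F where "F = (\<lambda>y. f p \<otimes> iot (ft (h y)))"
  have hQ: "h y \<in> ball 0 r" "h y \<in> Sf" "iot (h y) = inv p \<otimes> chart_inv c y" if "y \<in> Q" for y
  proof -
    have "h y \<in> ball 0 r'" "y \<in> P1" using that by (auto simp: Q_def)
    then show "h y \<in> ball 0 r" "h y \<in> Sf" "iot (h y) = inv p \<otimes> chart_inv c y"
      using r' \<rho>S(1) by (auto simp: h_def P1_def tdom_def kap_iot subset_iff simp del: mem_ball mem_ball_0)
  qed
  have F_eq: "F y = f (chart_inv c y)" if "y \<in> Q" for y
    by (simp add: F_def iot_ft(1)[OF hQ(2)[OF that]] hQ(3)[OF that] group_simps)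
  have "Cn_on n Q (\<lambda>y. ft (h y))"
    by (rule Cn_on_compose[OF Q Cn_on_subset[OF h] r(2) hQ(1)]) (auto simp: Q_def)
  then have F: "param_Cn n A Q F"
    unfolding F_def using iot_ft(2)[OF hQ(2)] by (intro param_Cn_mult[OF Q param_Cn_const] param_Cn_iot_compose[OF Q])
  define T where "T = {y \<in> Q. F y \<in> chart_dom e}"
  have T: "open T" unfolding T_def
    by (rule open_preimage_on[OF Q param_Cn_continuous[OF F] chartedD(2)[OF charted_A e]])
  have "Cn_on n T (\<lambda>y. chart_map e (F y))" using F e by (simp add: param_Cn_def T_def)
  then have "Cn_on n T (chart_map e \<circ> f \<circ> chart_inv c)"
    by (rule Cn_on_cong[OF _ T]) (simp add: F_eq T_def)
  moreover have "chart_map c ` {x \<in> U \<inter> chart_dom c. f x \<in> chart_dom e} \<inter> Q \<subseteq> T"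
    using F_eq chartedD(3)[OF charted_A c(1)] by (auto simp: T_def)
  ultimately have "Cn_on n (chart_map c ` {x \<in> U \<inter> chart_dom c. f x \<in> chart_dom e} \<inter> Q) (chart_map e \<circ> f \<circ> chart_inv c)"
    by (rule Cn_on_subset)
  then show ?thesis using Q pQ by blast
qed

end

text \<open>\<open>pr\<close> is the identity minus the orthogonal projection onto
  \<open>D\<close>.\<close>

lemma subspace_eq_kernel:
  fixes D :: "'e::euclidean_space set"
  assumes "subspace D"
  shows "\<exists>pr :: 'e \<Rightarrow> 'e. linear pr \<and> D = {v. pr v = 0}"
proof -
  obtain B where B: "B \<subseteq> D" "pairwise orthogonal B" "\<And>x. x \<in> B \<Longrightarrow> norm x = 1" "independent B" "span B = D"
    using orthonormal_basis_subspace[OF assms] by metis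
  have fin: "finite B" using B(4) independent_imp_finite by blast
  define pr where "pr = (\<lambda>v. v - (\<Sum>b\<in>B. (v \<bullet> b) *\<^sub>R b))"
  have "linear pr"
    unfolding pr_def
    by (rule linearI) (simp_all add: inner_add_left scaleR_add_left sum.distrib scaleR_diff_right scaleR_sum_right)
  moreover have "pr v = 0" if "v \<in> D" for v
    using orthonormal_basis_expand[OF B(2,3) _ fin, of v] that B(5) by (simp add: pr_def)
  moreover have "v \<in> D" if "pr v = 0" for v
  proof -
    have "(\<Sum>b\<in>B. (v \<bullet> b) *\<^sub>R b) \<in> span B" by (intro span_sum span_scale span_base)
    then show ?thesis using that B(5) by (simp add: pr_def)
  qed
  ultimately show ?thesis by blast
qed

theorem theorem1p1:
  fixes G :: "'a::{t2_space, second_countable_topology} monoid"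
    and A :: "('a, 'e::euclidean_space) chart set"
    and V :: "nat \<Rightarrow> 'e set" and s :: nat
    and U :: "'a set" and f :: "'a \<Rightarrow> 'a"
  assumes "carnot_group G A V s"
    and "smoothly_rigid G A (V 1)"
    and "open U"
    and "contact_map 1 G A (V 1) U f"
  shows "Ck_map \<infinity> A A U f"
proof -
  interpret carnot_group G A V s by (rule assms(1))
  have "subspace (V 1)" using subspaces[of 1] steps by simp
  then obtain pr :: "'e \<Rightarrow> 'e" where pr: "linear pr" "V 1 = {v. pr v = 0}"
    using subspace_eq_kernel by blast
  interpret left_invariant_distribution G A pr
    by (rule left_invariant_distribution.intro[OF lie_group_axioms left_invariant_distribution_axioms.intro[OF pr(1)]])
  have germs: "finite_dim_contact_germs G A {v. pr v = 0} \<one>\<^bsub>G\<^esub>"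
    using assms(2) unfolding smoothly_rigid_def pr(2) by blast
  note f = assms(4)[unfolded pr(2)]
  have "continuous_on U f"
  proof (rule continuous_at_imp_continuous_on, rule ballI)
    fix p assume "p \<in> U"
    then obtain V where V: "open V" "p \<in> V" "Ck_map 1 A A V f"
      using f unfolding contact_map_def Ck_local_diffeo_def by blast
    then have "continuous_on V f" by (simp add: Ck_map_def)
    then show "isCont f p" using V(1,2) by (simp add: continuous_on_eq_continuous_at)
  qed
  \<comment> \<open>The neighbourhoods may shrink as \<open>n\<close> grows; class C^\<infinity>
    means every finite order separately, so a cover for each fixed \<open>n\<close>
    suffices.\<close>
  moreover have "Cn_on n (chart_map c ` {x \<in> U \<inter> chart_dom c. f x \<in> chart_dom d}) (chart_map d \<circ> f \<circ> chart_inv c)"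
    if "c \<in> A" "d \<in> A" for n c d
  proof (rule Cn_on_open_cover)
    fix y assume "y \<in> chart_map c ` {x \<in> U \<inter> chart_dom c. f x \<in> chart_dom d}"
    then obtain p where p: "p \<in> U" "p \<in> chart_dom c" "y = chart_map c p" by blast
    show "\<exists>T. open T \<and> y \<in> T \<and>
        Cn_on n (chart_map c ` {x \<in> U \<inter> chart_dom c. f x \<in> chart_dom d} \<inter> T) (chart_map d \<circ> f \<circ> chart_inv c)"
      unfolding p(3) by (rule contact_map_smooth_at[OF germs f p(1) that(1) p(2) that(2)])
  qed
  ultimately show ?thesis by (simp add: Ck_map_def Ck_on_def)
qed

end
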